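(* Let $0<\varepsilon<1$ and $\beta>\beta_c(\varepsilon)$, let $c_n$ be defined by $2^{\varepsilon n}\mathbb P(\tau_n(x)\ge c_n)=1$ and let $\theta_n$ be any sequence such that $\frac{4}{1-\alpha(\varepsilon)}\log r^\star_n<\log\theta_n\ll n$. Then there exist numerical constants $0<c_-,c_+<\infty$ and a subset $\Omega'\subseteq\Omega$ with $\mathbb P(\Omega')=1$ such that on $\Omega'$, for all but a finite number of indices $n$, $$\bigl(n^{c_-}(r_n^\star)^{1+\alpha_n(\varepsilon)+o(1)}\bigr)^{-1}\le b_n\le n^{c_+}(r_n^\star)^{1+\alpha_n(\varepsilon)},$$ where $o(1)$ denotes a sequence tending to $0$ as $n\to\infty$. Thus, with $a_n=2^{\varepsilon n}/b_n$, $\lim_{n\to\infty}n^{-1}\log a_n=\varepsilon\log2$, $\mathbb P$-almost surely.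
   Context: Model. $\mathcal V_n=\{-1,1\}^n$, $\mathcal E_n$ the set of pairs of vertices differing in exactly one coordinate. For each $n>1$, $(\mathcal H_n(x))_{x\in\mathcal V_n}$ are independent centered Gaussian variables of variance $n$, all defined on a common probability space $(\Omega,\mathcal F,\mathbb P)$ (the random environment). For $\beta>0$, $\tau_n(x)=e^{-\beta\mathcal H_n(x)}$; $\beta_c(\varepsilon)=\sqrt{2\varepsilon\log2}$, $\alpha(\varepsilon)=\beta_c(\varepsilon)/\beta$. Fix a constant $c_\star>1+\log4$ and let $r_n^\star$ be the solution of $n^{c_\star}\mathbb P(\tau_n(x)\ge r_n^\star)=1$. For positive sequences, $x_n\ll y_n$ means $x_n/y_n\to0$. Exploration process. Given the environment, $Y_n$ is the Markov jump process on $\mathcal V_n$ with rates $$\widetilde\lambda_n(x,y)=\frac1{nr_n^\star}\,\frac{\min(\tau_n(y),\tau_n(x))}{\min(1/r_n^\star,\tau_n(x))}\quad\text{if }(x,y)\in\mathcal E_n,$$ and $0$ otherwise. Its reversible invariant probability measure is $\pi_n(x)=\min(1/r_n^\star,\tau_n(x))/\sum_{z}\min(1/r_n^\star,\tau_n(z))$. $E_{\pi_n}$ denotes expectation for $Y_n$ started from $\pi_n$ (environment fixed), and $\ell_n^x(t)=\int_0^t\mathbf 1_{\{Y_n(s)=x\}}ds$. The sequence $b_n$. Let $\alpha_n(\varepsilon)=(n\beta^2)^{-1}\log c_n$, $$F_{\beta,\varepsilon,n}(x)=x^{\alpha_n(\varepsilon)-\frac{\log x}{2n\beta^2}}\Bigl(1-\frac{\log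 x}{n\beta\beta_c(\varepsilon)}\Bigr)^{-1},\ x>0,\qquad F_{\beta,\varepsilon,n}(0)=0,$$ $T_n=\{x\in\mathcal V_n:\tau_n(x)\ge c_n(n^2\theta_n)^{-1}\}$, and $$b_n=(\theta_n\pi_n(T_n))^{-1}\sum_{x\in T_n}E_{\pi_n}\bigl[F_{\beta,\varepsilon,n}(\ell_n^x(\theta_n))\bigr].$$ *)

theory Defs
  imports "HOL-Probability.Probability"
begin

section \<open>Markov jump processes on a finite state space\<close>

definition generator :: "'s set \<Rightarrow> ('s \<Rightarrow> 's \<Rightarrow> real) \<Rightarrow> 's \<Rightarrow> 's \<Rightarrow> real" where
  "generator S q x y = (if x = y then - (\<Sum>z\<in>S - {x}. q x z) else q x y)"

fun kernel_power :: "'s set \<Rightarrow> ('s \<Rightarrow> 's \<Rightarrow> real) \<Rightarrow> nat \<Rightarrow> 's \<Rightarrow> 's \<Rightarrow> real" where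
  "kernel_power S Q 0 x y = (if x = y then 1 else 0)"
| "kernel_power S Q (Suc k) x y = (\<Sum>z\<in>S. Q x z * kernel_power S Q k z y)"

text \<open>The transition function is the matrix exponential of $t$ times the generator.\<close>

definition transition :: "'s set \<Rightarrow> ('s \<Rightarrow> 's \<Rightarrow> real) \<Rightarrow> real \<Rightarrow> 's \<Rightarrow> 's \<Rightarrow> real" where
  "transition S q t x y = (\<Sum>k. t ^ k / fact k * kernel_power S (generator S q) k x y)"

text \<open>
  \<open>Y\<close>, defined on the probability space \<open>P\<close>, is a Markov jump process on the finite set \<open>S\<close> with
  jump rates \<open>q\<close> (off the diagonal) and initial distribution \<open>\<mu>\<close>. Its paths are right-continuous
  with left limits in the discrete topology, i.e. they are step functions with finitely many
  jumps in each bounded time interval. The Markov property is expressed through the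
  finite-dimensional distributions.
\<close>

definition markov_jump_process ::
  "'s set \<Rightarrow> ('s \<Rightarrow> 's \<Rightarrow> real) \<Rightarrow> ('s \<Rightarrow> real) \<Rightarrow> 'v measure \<Rightarrow> (real \<Rightarrow> 'v \<Rightarrow> 's) \<Rightarrow> bool" where
  "markov_jump_process S q \<mu> P Y \<longleftrightarrow>
     finite S \<and> prob_space P \<and>
     (\<forall>t\<ge>0. Y t \<in> measurable P (count_space S)) \<and>
     (\<forall>v\<in>space P.
        (\<forall>t\<ge>0. eventually (\<lambda>s. Y s v = Y t v) (at_right t)) \<and>
        (\<forall>t>0. \<exists>y. eventually (\<lambda>s. Y s v = y) (at_left t))) \<and>
     (\<forall>(k::nat) (t :: nat \<Rightarrow> real) (x :: nat \<Rightarrow> 's).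
        t 0 = 0 \<and> (\<forall>i<k. t i < t (Suc i)) \<and> (\<forall>i\<le>k. x i \<in> S) \<longrightarrow>
        measure P {v \<in> space P. \<forall>i\<le>k. Y (t i) v = x i} =
          \<mu> (x 0) * (\<Prod>i<k. transition S q (t (Suc i) - t i) (x i) (x (Suc i))))"

definition local_time :: "(real \<Rightarrow> 'v \<Rightarrow> 's) \<Rightarrow> 's \<Rightarrow> real \<Rightarrow> 'v \<Rightarrow> real" where
  "local_time Y x t v = (\<integral>s\<in>{0..t}. (indicator {x} (Y s v) :: real) \<partial>lborel)"


section \<open>Hypercube and random environment\<close>

type_synonym vertex = "nat \<Rightarrow> int"

definition hypercube :: "nat \<Rightarrow> vertex set" where
  "hypercube n = {1..n} \<rightarrow>\<^sub>E {-1, 1}"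

definition adjacent :: "nat \<Rightarrow> vertex \<Rightarrow> vertex \<Rightarrow> bool" where
  "adjacent n x y \<longleftrightarrow>
     x \<in> hypercube n \<and> y \<in> hypercube n \<and> card {i \<in> {1..n}. x i \<noteq> y i} = 1"

text \<open>Nothing is assumed about the joint law of the environments for different \<open>n\<close>.\<close>

definition gaussian_environment :: "'w measure \<Rightarrow> (nat \<Rightarrow> vertex \<Rightarrow> 'w \<Rightarrow> real) \<Rightarrow> bool" where
  "gaussian_environment M H \<longleftrightarrow>
     prob_space M \<and>
     (\<forall>n>1. prob_space.indep_vars M (\<lambda>_. borel) (H n) (hypercube n) \<and>
        (\<forall>x\<in>hypercube n. distributed M lborel (H n x) (normal_density 0 (sqrt (real n)))))"

definition tau :: "real \<Rightarrow> (nat \<Rightarrow> vertex \<Rightarrow> 'w \<Rightarrow> real) \<Rightarrow> nat \<Rightarrow> 'w \<Rightarrow> vertex \<Rightarrow> real" where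
  "tau \<beta> H n w x = exp (- \<beta> * H n x w)"

definition tail_prob ::
  "'w measure \<Rightarrow> real \<Rightarrow> (nat \<Rightarrow> vertex \<Rightarrow> 'w \<Rightarrow> real) \<Rightarrow> nat \<Rightarrow> vertex \<Rightarrow> real \<Rightarrow> real" where
  "tail_prob M \<beta> H n x u = measure M {w \<in> space M. tau \<beta> H n w x \<ge> u}"

definition beta_c :: "real \<Rightarrow> real" where
  "beta_c \<epsilon> = sqrt (2 * \<epsilon> * ln 2)"

definition alpha :: "real \<Rightarrow> real \<Rightarrow> real" where
  "alpha \<beta> \<epsilon> = beta_c \<epsilon> / \<beta>"


section \<open>Quantities for a fixed size and a fixed environment\<close>

text \<open>
  In this section \<open>\<tau>\<close> is a realization of the landscape on the hypercube of dimension \<open>n\<close>, and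
  \<open>r\<close>, \<open>c\<close>, \<open>\<theta>\<close> are the values at \<open>n\<close> of the sequences $r_n^\star$, $c_n$, $\theta_n$.
\<close>

definition jump_rate :: "nat \<Rightarrow> real \<Rightarrow> (vertex \<Rightarrow> real) \<Rightarrow> vertex \<Rightarrow> vertex \<Rightarrow> real" where
  "jump_rate n r \<tau> x y =
     (if adjacent n x y
      then 1 / (real n * r) * (min (\<tau> y) (\<tau> x) / min (1 / r) (\<tau> x)) else 0)"

definition inv_measure :: "nat \<Rightarrow> real \<Rightarrow> (vertex \<Rightarrow> real) \<Rightarrow> vertex \<Rightarrow> real" where
  "inv_measure n r \<tau> x = min (1 / r) (\<tau> x) / (\<Sum>z\<in>hypercube n. min (1 / r) (\<tau> z))"

definition alpha_n :: "real \<Rightarrow> nat \<Rightarrow> real \<Rightarrow> real" where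
  "alpha_n \<beta> n c = ln c / (real n * \<beta>\<^sup>2)"

definition F_fun :: "real \<Rightarrow> real \<Rightarrow> nat \<Rightarrow> real \<Rightarrow> real \<Rightarrow> real" where
  "F_fun \<beta> \<epsilon> n c x =
     (if x > 0
      then x powr (alpha_n \<beta> n c - ln x / (2 * real n * \<beta>\<^sup>2)) *
           inverse (1 - ln x / (real n * \<beta> * beta_c \<epsilon>))
      else 0)"

definition top_set :: "nat \<Rightarrow> real \<Rightarrow> real \<Rightarrow> (vertex \<Rightarrow> real) \<Rightarrow> vertex set" where
  "top_set n c \<theta> \<tau> = {x \<in> hypercube n. \<tau> x \<ge> c * inverse ((real n)\<^sup>2 * \<theta>)}"

text \<open>Here \<open>Y\<close> is meant to be the exploration process started from its invariant measure, on \<open>P\<close>.\<close>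

definition b_fun ::
  "real \<Rightarrow> real \<Rightarrow> nat \<Rightarrow> real \<Rightarrow> real \<Rightarrow> real \<Rightarrow> (vertex \<Rightarrow> real) \<Rightarrow>
     'v measure \<Rightarrow> (real \<Rightarrow> 'v \<Rightarrow> vertex) \<Rightarrow> real" where
  "b_fun \<beta> \<epsilon> n r c \<theta> \<tau> P Y =
     inverse (\<theta> * (\<Sum>x\<in>top_set n c \<theta> \<tau>. inv_measure n r \<tau> x)) *
     (\<Sum>x\<in>top_set n c \<theta> \<tau>. \<integral>v. F_fun \<beta> \<epsilon> n c (local_time Y x \<theta> v) \<partial>P)"

end

theory Submission
  imports Defs "HOL-Real_Asymp.Real_Asymp"
begin

text \<open>
  On \<open>T\<^sub>n\<close> the invariant measure is a constant \<open>\<mu>0\<close>, and the local time \<open>l\<close> of such a site has mean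
  \<open>\<theta> \<mu>0\<close>, so \<open>b\<close> is the average of \<open>E[F(l)] / E[l]\<close> over \<open>T\<^sub>n\<close>; here \<open>F(l)\<close> is comparable to \<open>l\<close> to
  the power \<open>\<alpha> = \<alpha>\<^sub>n(\<epsilon>) \<in> [0, 1]\<close> on the relevant scale.

  Upper bound: a site can only be hit after its cluster in \<open>{\<tau> \<ge> r}\<close> has been entered, and all edges
  across the boundary of the cluster carry little conductance. Hence the hitting probability is at
  most \<open>2 |cluster| r \<theta> \<mu>0\<close>, which gives \<open>b \<le> 6 r powr (1 - \<alpha>)\<close> times the average cluster size.

  Lower bound: \<open>F(l)\<close> is at least \<open>L powr (\<alpha> - 1) l\<close>, up to a power of \<open>n\<close>, for \<open>1/L \<le> l \<le> L\<close> with
  \<open>L = n^4 r\<close>, and these values of \<open>l\<close> carry a fixed fraction of its mean as soon as the expected local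
  time at the site of the process started there (the Green function) is at most a power of \<open>n\<close> times
  \<open>r\<close>. That bound comes from one path, through sites with \<open>\<tau> \<ge> 1/r\<close>, to a site where the Green
  function is small.

  Clusters and obstructed paths are controlled on average over \<open>T\<^sub>n\<close> by first moments, and \<open>|T\<^sub>n|\<close> by its
  variance; since \<open>c_star > 2\<close> the error probabilities are summable. Both bounds on \<open>b\<close> hold without
  the correction \<open>o(1)\<close>.
\<close>

section \<open>Transition functions and the Dirichlet form\<close>

text \<open>An edge \<open>x\<close>, \<open>y\<close> has conductance \<mu>0 min(\<tau> x, \<tau>
  y) / n, which is unbounded between two high neighbours, so the flow into a single site gives no
  useful hitting bound. Merging high neighbours into clusters leaves only boundary edges of
  conductance at most \<mu>0 r / n. Dually, between sites with \<tau> \<ge> 1/r the conductance is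
  at least \<mu>0 / (n r), and \<open>n\<close> such edges in a row keep the Green function below
  about n^3 r. By the symmetry of the Gaussian field, sites above r and sites below 1/r both have
  density at most n^(-c_star): clusters are then subcritical, and a path of \<open>n\<close> sites
  is obstructed with probability at most n^(1 - c_star), a summable quantity. The process starts
  from equilibrium, so first moments of local times are exact, entrance probabilities come from the
  equilibrium flow, and second moments from the Green function; no relaxation time enters. Finally
  (ln r)^2 is of order at most n ln n, so the Gaussian correction inside \<open>F_fun\<close> costs
  only a power of \<open>n\<close> on the whole window [1/L, L].\<close>

lemma kernel_power_bound:
  assumes "finite S" "x \<in> S"
  shows "\<bar>kernel_power S Q k x y\<bar> \<le> (\<Sum>x\<in>S. \<Sum>z\<in>S. \<bar>Q x z\<bar>) ^ k"
  using assms(2)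
proof (induction k arbitrary: x)
  case (Suc k)
  let ?B = "\<Sum>x\<in>S. \<Sum>z\<in>S. \<bar>Q x z\<bar>"
  have "\<bar>kernel_power S Q (Suc k) x y\<bar> \<le> (\<Sum>z\<in>S. \<bar>Q x z\<bar> * \<bar>kernel_power S Q k z y\<bar>)"
    by (simp add: abs_mult order_trans[OF sum_abs])
  also have "\<dots> \<le> (\<Sum>z\<in>S. \<bar>Q x z\<bar> * ?B ^ k)"
    using Suc.IH by (intro sum_mono mult_left_mono) auto
  also have "\<dots> = (\<Sum>z\<in>S. \<bar>Q x z\<bar>) * ?B ^ k"
    by (simp add: sum_distrib_right)
  also have "\<dots> \<le> ?B * ?B ^ k"
    using Suc.prems assms(1)
    by (intro mult_right_mono member_le_sum[of x S "\<lambda>x. \<Sum>z\<in>S. \<bar>Q x z\<bar>"] zero_le_power sum_nonneg)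
       auto
  finally show ?case by simp
qed simp

lemma summable_transition:
  assumes "finite S" "x \<in> S"
  shows "summable (\<lambda>k. t ^ k / fact k * kernel_power S Q k x y :: real)"
proof (rule summable_comparison_test')
  let ?B = "\<Sum>x\<in>S. \<Sum>z\<in>S. \<bar>Q x z\<bar>"
  show "summable (\<lambda>k. (\<bar>t\<bar> * ?B) ^ k / fact k)"
    using summable_exp[of "\<bar>t\<bar> * ?B"] by (simp add: divide_inverse mult.commute)
  fix k :: nat
  have "norm (t ^ k / fact k * kernel_power S Q k x y) = \<bar>t\<bar> ^ k / fact k * \<bar>kernel_power S Q k x y\<bar>"
    by (simp add: abs_mult power_abs)
  also have "\<dots> \<le> \<bar>t\<bar> ^ k / fact k * ?B ^ k"
    by (intro mult_left_mono kernel_power_bound[OF assms]) auto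
  finally show "norm (t ^ k / fact k * kernel_power S Q k x y) \<le> (\<bar>t\<bar> * ?B) ^ k / fact k"
    by (simp add: power_mult_distrib)
qed

lemma transition_0: "transition S q 0 x y = (if x = y then 1 else 0)"
proof -
  have "transition S q 0 x y = (\<Sum>k. (kernel_power S (generator S q) k x y / fact k) * 0 ^ k)"
    unfolding transition_def by (intro suminf_cong) simp
  also have "\<dots> = kernel_power S (generator S q) 0 x y / fact 0"
    by (rule powser_zero)
  finally show ?thesis by simp
qed

text \<open>Termwise differentiation shifts the exponential series by one index, and the recursion
  of \<open>kernel_power\<close> releases its factor on the left. The backward form is the useful
  one, since the Green function is later studied as a function of its starting site.\<close>

lemma transition_backward_equation:
  assumes S: "finite S" and x: "x \<in> S"
  shows "((\<lambda>t. transition S q t x y) has_real_derivative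
           (\<Sum>z\<in>S. generator S q x z * transition S q t z y)) (at t)"
proof -
  let ?Q = "generator S q"
  let ?c = "\<lambda>k. kernel_power S ?Q k x y / fact k"
  have sm: "summable (\<lambda>k. ?c k * t ^ k)" for t
    using summable_transition[OF S x, of t ?Q y] by (simp add: mult.commute)
  have "DERIV (\<lambda>t. \<Sum>k. ?c k * t ^ k) t :> (\<Sum>k. diffs ?c k * t ^ k)"
    by (rule termdiffs_strong_converges_everywhere) (use sm in auto)
  moreover have "(\<lambda>t. \<Sum>k. ?c k * t ^ k) = (\<lambda>t. transition S q t x y)"
    by (simp add: transition_def mult.commute)
  moreover have "(\<Sum>k. diffs ?c k * t ^ k) = (\<Sum>z\<in>S. ?Q x z * transition S q t z y)"
  proof -
    have "diffs ?c k * t ^ k = (\<Sum>z\<in>S. ?Q x z * (t ^ k / fact k * kernel_power S ?Q k z y))" for k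
    proof -
      have "diffs ?c k = (\<Sum>z\<in>S. ?Q x z * kernel_power S ?Q k z y) / fact k"
        by (simp add: diffs_def divide_simps)
      then show ?thesis
        by (simp add: sum_distrib_left sum_distrib_right sum_divide_distrib mult_ac)
    qed
    then have "(\<Sum>k. diffs ?c k * t ^ k)
      = (\<Sum>k. \<Sum>z\<in>S. ?Q x z * (t ^ k / fact k * kernel_power S ?Q k z y))"
      by simp
    also have "\<dots> = (\<Sum>z\<in>S. \<Sum>k. ?Q x z * (t ^ k / fact k * kernel_power S ?Q k z y))"
      by (intro suminf_sum summable_mult summable_transition S)
    also have "\<dots> = (\<Sum>z\<in>S. ?Q x z * transition S q t z y)"
      unfolding transition_def by (intro sum.cong refl suminf_mult summable_transition S)
    finally show ?thesis .
  qed
  ultimately show ?thesis by simp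
qed

lemma continuous_on_transition:
  assumes "finite S" "x \<in> S"
  shows "continuous_on A (\<lambda>t. transition S q t x y)"
  using transition_backward_equation[OF assms]
  by (intro continuous_at_imp_continuous_on ballI) (blast intro: DERIV_isCont)

section \<open>Stationarity and energy of reversible generators\<close>

lemma reversible_generator_sum:
  assumes S: "finite S" and y: "y \<in> S"
    and rev: "\<And>x y. x \<in> S \<Longrightarrow> y \<in> S \<Longrightarrow> \<mu> x * q x y = \<mu> y * q y x"
  shows "(\<Sum>x\<in>S. \<mu> x * generator S q x y) = (0::real)"
proof -
  have "(\<Sum>x\<in>S. \<mu> x * generator S q x y)
      = \<mu> y * generator S q y y + (\<Sum>x\<in>S - {y}. \<mu> x * generator S q x y)"
    using S y by (simp add: sum.remove)
  also have "(\<Sum>x\<in>S - {y}. \<mu> x * generator S q x y) = (\<Sum>x\<in>S - {y}. \<mu> y * q y x)"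
    using rev y by (intro sum.cong) (auto simp: generator_def)
  finally show ?thesis
    by (simp add: generator_def sum_distrib_left)
qed

text \<open>Differentiating in \<open>t\<close> brings the product of \<mu> and the generator to the
  front, and this vanishes by detailed balance; so the sum keeps its value at time 0.\<close>

lemma transition_stationary:
  assumes S: "finite S" and y: "y \<in> S"
    and rev: "\<And>x y. x \<in> S \<Longrightarrow> y \<in> S \<Longrightarrow> \<mu> x * q x y = \<mu> y * q y x"
  shows "(\<Sum>x\<in>S. \<mu> x * transition S q t x y) = \<mu> y"
proof -
  let ?f = "\<lambda>t. \<Sum>x\<in>S. \<mu> x * transition S q t x y"
  have "DERIV ?f t :> 0" for t
  proof -
    have "DERIV ?f t :> (\<Sum>x\<in>S. \<mu> x * (\<Sum>z\<in>S. generator S q x z * transition S q t z y))"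
      by (intro DERIV_sum DERIV_cmult transition_backward_equation S)
    also have "(\<Sum>x\<in>S. \<mu> x * (\<Sum>z\<in>S. generator S q x z * transition S q t z y))
      = (\<Sum>z\<in>S. (\<Sum>x\<in>S. \<mu> x * generator S q x z) * transition S q t z y)"
      unfolding sum_distrib_left sum_distrib_right by (subst sum.swap) (simp add: mult_ac)
    also have "\<dots> = 0"
      using reversible_generator_sum[OF S _ rev] by simp
    finally show ?thesis .
  qed
  then have "?f t = ?f 0"
    using DERIV_isconst_all[of ?f t 0] by blast
  also have "?f 0 = \<mu> y"
    using S y by (simp add: transition_0 if_distrib sum.delta cong: if_cong)
  finally show ?thesis .
qed

text \<open>The Dirichlet form of \<open>h\<close> pairs it with its image under the generator, and a single edge
  contributes at most the whole form.\<close>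

lemma dirichlet_form_edge_bound:
  assumes S: "finite S" and x: "x \<in> S" and z: "z \<in> S" and w: "w \<in> S"
    and \<mu>: "\<And>z. z \<in> S \<Longrightarrow> 0 \<le> \<mu> z" and q: "\<And>z w. z \<in> S \<Longrightarrow> w \<in> S \<Longrightarrow> 0 \<le> q z w"
    and rev: "\<And>x y. x \<in> S \<Longrightarrow> y \<in> S \<Longrightarrow> \<mu> x * q x y = \<mu> y * q y x"
    and h: "\<And>z. z \<in> S \<Longrightarrow> 0 \<le> h z" and g: "\<And>z. z \<in> S \<Longrightarrow> 0 \<le> g z"
    and eq: "\<And>z. z \<in> S \<Longrightarrow>
        (\<Sum>w\<in>S. generator S q z w * h w) = g z - (if z = x then 1 else 0)"
  shows "\<mu> z * q z w * (h z - h w)\<^sup>2 \<le> \<mu> x * (h x :: real)"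
proof (cases "z = w")
  case True
  then show ?thesis using \<mu> h x by simp
next
  case False
  let ?e = "\<lambda>z w. \<mu> z * q z w * (h z - h w)\<^sup>2"
  have gen: "(\<Sum>w\<in>S. generator S q z w * h w) = (\<Sum>w\<in>S. q z w * (h w - h z))" if "z \<in> S" for z
  proof -
    have "(\<Sum>w\<in>S. generator S q z w * h w)
        = generator S q z z * h z + (\<Sum>w\<in>S-{z}. q z w * h w)"
    proof -
      have "(\<Sum>w\<in>S-{z}. generator S q z w * h w) = (\<Sum>w\<in>S-{z}. q z w * h w)"
        by (intro sum.cong) (auto simp: generator_def)
      then show ?thesis
        using S that by (simp add: sum.remove)
    qed
    also have "\<dots> = (\<Sum>w\<in>S-{z}. q z w * (h w - h z))"
      by (simp add: generator_def right_diff_distrib sum_subtractf sum_distrib_right)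
    also have "\<dots> = (\<Sum>w\<in>S. q z w * (h w - h z))"
      using S that by (simp add: sum.remove)
    finally show ?thesis .
  qed
  let ?D = "\<Sum>z\<in>S. \<Sum>w\<in>S. \<mu> z * q z w * h z * (h w - h z)"
  \<comment> \<open>Reversibility lets \<open>z\<close> and \<open>w\<close> trade places; adding
    the two forms of \<open>?D\<close> completes the square.\<close>
  have sw: "?D = (\<Sum>z\<in>S. \<Sum>w\<in>S. \<mu> z * q z w * h w * (h z - h w))"
    by (subst sum.swap) (intro sum.cong refl, simp add: rev)
  have "2 * ?D = - (\<Sum>z\<in>S. \<Sum>w\<in>S. ?e z w)"
  proof -
    have "2 * ?D = ?D + (\<Sum>z\<in>S. \<Sum>w\<in>S. \<mu> z * q z w * h w * (h z - h w))"
      using sw by simp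
    also have "\<dots> = (\<Sum>z\<in>S. \<Sum>w\<in>S. - ?e z w)"
      unfolding sum.distrib[symmetric]
      by (intro sum.cong refl) (simp add: power2_eq_square algebra_simps)
    finally show ?thesis by (simp add: sum_negf)
  qed
  \<comment> \<open>The equation for \<open>h\<close> replaces the generator by \<open>g\<close>
    minus a unit mass at \<open>x\<close>; the \<open>g\<close> part is nonnegative and is
    dropped.\<close>
  moreover have "?D \<ge> - (\<mu> x * h x)"
  proof -
    have "?D = (\<Sum>z\<in>S. \<mu> z * h z * (\<Sum>w\<in>S. q z w * (h w - h z)))"
      by (simp add: sum_distrib_left mult_ac)
    also have "\<dots> = (\<Sum>z\<in>S. \<mu> z * h z * (g z - (if z = x then 1 else 0)))"
      using gen eq by (intro sum.cong refl) simp
    also have "\<dots> = (\<Sum>z\<in>S. \<mu> z * h z * g z) - (\<Sum>z\<in>S. if z = x then \<mu> z * h z else 0)"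
      unfolding sum_subtractf[symmetric] by (intro sum.cong) (auto simp: algebra_simps)
    also have "\<dots> = (\<Sum>z\<in>S. \<mu> z * h z * g z) - \<mu> x * h x"
      using S x by simp
    finally show ?thesis
      using sum_nonneg[of S "\<lambda>z. \<mu> z * h z * g z"] \<mu> h g by auto
  qed
  \<comment> \<open>The double sum contains the edge in both orientations, which pays for the factor
    2 in front of \<open>?D\<close>.\<close>
  moreover have "?e z w + ?e w z \<le> (\<Sum>z\<in>S. \<Sum>w\<in>S. ?e z w)"
  proof -
    have "?e z w + ?e w z = (\<Sum>(a, b)\<in>{(z, w), (w, z)}. ?e a b)"
      using False by simp
    also have "\<dots> \<le> (\<Sum>(a, b)\<in>S \<times> S. ?e a b)"
      using S z w \<mu> q by (intro sum_mono2) auto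
    also have "\<dots> = (\<Sum>z\<in>S. \<Sum>w\<in>S. ?e z w)"
      by (simp add: sum.cartesian_product)
    finally show ?thesis .
  qed
  moreover have "?e w z = ?e z w"
    using rev[OF z w] by (simp add: power2_commute)
  ultimately show ?thesis by linarith
qed

section \<open>Stationary reversible jump processes\<close>

locale reversible_jump_process =
  fixes S :: "'s set" and q :: "'s \<Rightarrow> 's \<Rightarrow> real" and \<mu> :: "'s \<Rightarrow> real"
    and P :: "'v measure" and Y :: "real \<Rightarrow> 'v \<Rightarrow> 's"
  assumes mjp: "markov_jump_process S q \<mu> P Y"
    and \<mu>_pos: "x \<in> S \<Longrightarrow> 0 < \<mu> x"
    and q_nonneg: "x \<in> S \<Longrightarrow> y \<in> S \<Longrightarrow> 0 \<le> q x y"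
    and rev: "x \<in> S \<Longrightarrow> y \<in> S \<Longrightarrow> \<mu> x * q x y = \<mu> y * q y x"
begin

abbreviation trans_fun where "trans_fun \<equiv> transition S q"

lemma finite_S: "finite S"
  using mjp by (simp add: markov_jump_process_def)

lemma prob_space_P: "prob_space P"
  using mjp by (simp add: markov_jump_process_def)

sublocale prob_space P
  by (rule prob_space_P)

lemma Y_measurable: "0 \<le> t \<Longrightarrow> Y t \<in> measurable P (count_space S)"
  using mjp by (simp add: markov_jump_process_def)

lemma Y_in_S: "0 \<le> t \<Longrightarrow> v \<in> space P \<Longrightarrow> Y t v \<in> S"
  using measurable_space[OF Y_measurable] by simp

lemma Y_right_continuous: "v \<in> space P \<Longrightarrow> 0 \<le> t \<Longrightarrow> eventually (\<lambda>s. Y s v = Y t v) (at_right t)"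
  using mjp by (simp add: markov_jump_process_def)

section \<open>One- and two-time laws under stationarity\<close>

lemma finite_dimensional_distribution:
  assumes "t 0 = 0" "\<And>i. i < k \<Longrightarrow> t i < t (Suc i)" "\<And>i. i \<le> k \<Longrightarrow> x i \<in> S"
  shows "prob {v \<in> space P. \<forall>i\<le>k. Y (t i) v = x i}
    = \<mu> (x 0) * (\<Prod>i<k. trans_fun (t (Suc i) - t i) (x i) (x (Suc i)))"
  using mjp assms unfolding markov_jump_process_def by blast

lemma sets_Y_pred: "0 \<le> t \<Longrightarrow> {v \<in> space P. Y t v \<in> B} \<in> sets P"
proof -
  assume t: "0 \<le> t"
  have "{v \<in> space P. Y t v \<in> B} = Y t -` (B \<inter> S) \<inter> space P"
    using Y_in_S[OF t] by auto
  then show ?thesis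
    using measurable_sets[OF Y_measurable[OF t], of "B \<inter> S"] by simp
qed

lemma sets_Y_eq: "0 \<le> t \<Longrightarrow> {v \<in> space P. Y t v = x} \<in> sets P"
  using sets_Y_pred[of t "{x}"] by simp

lemma sets_Y_eq2: "0 \<le> s \<Longrightarrow> 0 \<le> t \<Longrightarrow> {v \<in> space P. Y s v = x \<and> Y t v = y} \<in> sets P"
  using sets.sets_Collect_conj[OF sets_Y_eq[of t y] sets_Y_eq[of s x]] by simp

text \<open>The law of the process is given only along time points that begin with 0. Events at
  later times are reached by summing over the initial state.\<close>

lemma prob_sum_initial:
  assumes "A \<in> sets P"
  shows "prob A = (\<Sum>x\<in>S. prob {v \<in> space P. Y 0 v = x \<and> v \<in> A})"
proof -
  have eq: "A = (\<Union>x\<in>S. {v \<in> space P. Y 0 v = x \<and> v \<in> A})"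
    using sets.sets_into_space[OF assms] Y_in_S[of 0] by auto
  have "{v \<in> space P. Y 0 v = x \<and> v \<in> A} \<in> sets P" for x
    using sets.Int[OF sets_Y_eq[of 0 x] assms] by (simp add: Int_def conj_ac)
  then have "prob (\<Union>x\<in>S. {v \<in> space P. Y 0 v = x \<and> v \<in> A})
      = (\<Sum>x\<in>S. prob {v \<in> space P. Y 0 v = x \<and> v \<in> A})"
    by (intro finite_measure_finite_Union finite_S) (auto simp: disjoint_family_on_def)
  with eq show ?thesis by simp
qed

lemma prob_Y_eq:
  assumes t: "0 \<le> t" and x: "x \<in> S"
  shows "prob {v \<in> space P. Y t v = x} = \<mu> x"
proof (cases "t = 0")
  case True
  then show ?thesis
    using finite_dimensional_distribution[of "\<lambda>_. 0" 0 "\<lambda>_. x"] x by simp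
next
  case False
  have "prob {v \<in> space P. Y 0 v = y \<and> v \<in> {v \<in> space P. Y t v = x}} = \<mu> y * trans_fun t y x"
    if y: "y \<in> S" for y
    using finite_dimensional_distribution[of "\<lambda>i. if i = 0 then 0 else t" 1 "\<lambda>i. if i = 0 then y else x"]
      False t x y
    by (simp add: le_Suc_eq all_conj_distrib imp_disjL conj_ac cong: conj_cong)
  then show ?thesis
    using prob_sum_initial[OF sets_Y_eq[OF t, of x]] transition_stationary[OF finite_S x rev]
    by simp
qed

lemma prob_Y_eq2:
  assumes s: "0 \<le> s" and t: "s \<le> t" and x: "x \<in> S" and y: "y \<in> S"
  shows "prob {v \<in> space P. Y s v = x \<and> Y t v = y} = \<mu> x * trans_fun (t - s) x y"
proof -
  \<comment> \<open>The prescribed time points start at 0 and increase strictly, so coinciding times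
    and \<open>s = 0\<close> have to be treated apart from the generic case.\<close>
  consider "s = t" | "s = 0" "s < t" | "0 < s" "s < t"
    using s t by linarith
  then show ?thesis
  proof cases
    case 1
    have "{v \<in> space P. Y t v = x \<and> Y t v = y} = {}" if "x \<noteq> y"
      using that by auto
    then show ?thesis
      using 1 s x prob_Y_eq[of t x] by (cases "x = y") (simp_all add: transition_0 cong: conj_cong)
  next
    case 2
    then show ?thesis
      using finite_dimensional_distribution[of "\<lambda>i. if i = 0 then 0 else t" 1 "\<lambda>i. if i = 0 then x else y"]
        x y
      by (simp add: le_Suc_eq all_conj_distrib imp_disjL conj_ac cong: conj_cong)
  next
    case 3
    let ?A = "{v \<in> space P. Y s v = x \<and> Y t v = y}"
    have "prob {v \<in> space P. Y 0 v = z \<and> v \<in> ?A}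
        = (\<mu> z * trans_fun s z x) * trans_fun (t - s) x y" if z: "z \<in> S" for z
    proof -
      let ?t = "\<lambda>i::nat. if i = 0 then 0 else if i = 1 then s else t"
      let ?x = "\<lambda>i::nat. if i = 0 then z else if i = 1 then x else y"
      have "prob {v \<in> space P. \<forall>i\<le>2. Y (?t i) v = ?x i}
          = \<mu> (?x 0) * (\<Prod>i<2. trans_fun (?t (Suc i) - ?t i) (?x i) (?x (Suc i)))"
        using 3 x y z by (intro finite_dimensional_distribution) auto
      moreover have "{v \<in> space P. \<forall>i\<le>2. Y (?t i) v = ?x i}
          = {v \<in> space P. Y 0 v = z \<and> v \<in> ?A}"
        by (auto simp: numeral_2_eq_2 le_Suc_eq all_conj_distrib imp_disjL)
      ultimately show ?thesis by (simp add: numeral_2_eq_2)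
    qed
    then have "prob ?A = (\<Sum>z\<in>S. \<mu> z * trans_fun s z x) * trans_fun (t - s) x y"
      using prob_sum_initial[OF sets_Y_eq2[of s t x y]] 3 by (simp add: sum_distrib_right)
    then show ?thesis
      using transition_stationary[OF finite_S x rev] by simp
  qed
qed

text \<open>The matrix exponential does not display its sign; nonnegativity is read off from a
  two-time probability after division by \<open>\<mu> x > 0\<close>.\<close>

lemma transition_nonneg:
  assumes "0 \<le> t" "x \<in> S" "y \<in> S"
  shows "0 \<le> trans_fun t x y"
proof -
  have "0 \<le> \<mu> x * trans_fun t x y"
    using prob_Y_eq2[of 0 t x y] assms measure_nonneg[of P "{v \<in> space P. Y 0 v = x \<and> Y t v = y}"]
    by simp
  then show ?thesis
    using \<mu>_pos[of x] assms by (simp add: zero_le_mult_iff)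
qed

text \<open>Approximating time from the right by grid points, \<open>Y\<close> becomes jointly measurable. Negative times
  are sent to \<open>0\<close>, since nothing is known about \<open>Y\<close> there.\<close>

lemma measurable_occupation:
  "(\<lambda>(s :: real, v). indicator {x} (Y (max 0 s) v) :: real) \<in> borel_measurable (lborel \<Otimes>\<^sub>M P)"
proof -
  \<comment> \<open>The \<open>+ 1\<close> puts the grid point strictly to the right of
    \<open>s\<close>, where right-continuity applies. For fixed \<open>N\<close> the index has
    countably many values, so each approximation is measurable because every single
    \<open>Y t\<close> is.\<close>
  define g :: "nat \<Rightarrow> real \<Rightarrow> nat" where "g N s = nat \<lfloor>max 0 s * (N + 1)\<rfloor> + 1" for N s
  define f :: "nat \<Rightarrow> real \<times> 'v \<Rightarrow> real"
    where "f N p = indicator {x} (Y (real (g N (fst p)) / (N + 1)) (snd p))" for N p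
  have f: "f N \<in> borel_measurable (lborel \<Otimes>\<^sub>M P)" for N
    unfolding f_def
  proof (rule measurable_compose_countable[where g = "\<lambda>p. g N (fst p)" and
        f = "\<lambda>i p. indicator {x} (Y (real i / (N + 1)) (snd p))"])
    show "(\<lambda>p. g N (fst p)) \<in> measurable (lborel \<Otimes>\<^sub>M P) (count_space UNIV)"
    proof -
      have "(\<lambda>s. \<lfloor>max 0 s * real (N + 1)\<rfloor>) \<in> measurable lborel (count_space UNIV)"
        by (rule measurable_compose[OF _ measurable_real_floor]) measurable
      then have "g N \<in> measurable lborel (count_space UNIV)"
        unfolding g_def by (rule measurable_compose[where g = "\<lambda>i. nat i + 1"]) simp
      then show ?thesis
        by (rule measurable_compose[OF measurable_fst])
    qed
  next
    fix i
    have "Y (real i / (N + 1)) \<in> measurable P (count_space S)"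
      by (rule Y_measurable) auto
    then have "(\<lambda>v. indicator {x} (Y (real i / (N + 1)) v) :: real) \<in> borel_measurable P"
      by (rule measurable_compose) simp
    then show "(\<lambda>p. indicator {x} (Y (real i / (N + 1)) (snd p)) :: real)
        \<in> borel_measurable (lborel \<Otimes>\<^sub>M P)"
      by (rule measurable_compose[OF measurable_snd])
  qed
  show ?thesis
  proof (rule borel_measurable_LIMSEQ_real[where u = f])
    fix p :: "real \<times> 'v" assume p: "p \<in> space (lborel \<Otimes>\<^sub>M P)"
    define s where "s = max 0 (fst p)"
    have v: "snd p \<in> space P" using p by (auto simp: space_pair_measure)
    obtain b where b: "b > s" "\<And>r. s < r \<Longrightarrow> r < b \<Longrightarrow> Y r (snd p) = Y s (snd p)"
      using Y_right_continuous[OF v, of s] by (auto simp: s_def eventually_at_right_field)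
    have "(\<lambda>N. 1 / (real N + 1)) \<longlonglongrightarrow> 0"
      using LIMSEQ_inverse_real_of_nat by (simp add: inverse_eq_divide add.commute)
    then have "\<forall>\<^sub>F N in sequentially. 1 / (real N + 1) < b - s"
      using b(1) by (intro order_tendstoD) auto
    then have "\<forall>\<^sub>F N in sequentially. f N p = indicator {x} (Y s (snd p))"
    proof eventually_elim
      case (elim N)
      have "real (g N (fst p)) = of_int \<lfloor>s * (N + 1)\<rfloor> + 1"
        by (simp add: g_def s_def add.commute)
      then have "s * (N + 1) < real (g N (fst p))" "real (g N (fst p)) \<le> s * (N + 1) + 1"
        by linarith+
      moreover have "s + 1 / (N + 1) = (s * (N + 1) + 1) / (N + 1)"
        by (simp add: field_simps)
      ultimately have "s < real (g N (fst p)) / (N + 1)" "real (g N (fst p)) / (N + 1) \<le> s + 1 / (N + 1)"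
        by (simp_all add: pos_less_divide_eq divide_right_mono)
      moreover from this have "real (g N (fst p)) / (N + 1) < b"
        using elim by (simp add: add.commute)
      ultimately show ?case
        using b(2)[of "real (g N (fst p)) / (N + 1)"] by (simp add: f_def)
    qed
    then show "(\<lambda>N. f N p) \<longlonglongrightarrow> (case p of (s, v) \<Rightarrow> indicator {x} (Y (max 0 s) v))"
      by (auto simp: s_def case_prod_beta intro: tendsto_eventually)
  qed (rule f)
qed

text \<open>The integrand of the local time in its jointly measurable form. The \<open>max 0\<close>
  changes nothing, as the first indicator vanishes at negative times.\<close>

definition occ :: "'s \<Rightarrow> real \<Rightarrow> real \<Rightarrow> 'v \<Rightarrow> real" where
  "occ x t s v = indicator {0..t} s * indicator {x} (Y (max 0 s) v)"

lemma occ_nonneg: "0 \<le> occ x t s v"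
  by (simp add: occ_def)

lemma occ_measurable: "(\<lambda>(s, v). occ x t s v) \<in> borel_measurable (lborel \<Otimes>\<^sub>M P)"
proof -
  have "(\<lambda>p. indicator {0..t} (fst p) * (case p of (s, v) \<Rightarrow> indicator {x} (Y (max 0 s) v)) :: real)
     \<in> borel_measurable (lborel \<Otimes>\<^sub>M P)"
    by (intro borel_measurable_times measurable_occupation) measurable
  then show ?thesis by (simp add: occ_def case_prod_beta)
qed

lemma occ_measurable1: "s \<in> UNIV \<Longrightarrow> (\<lambda>v. occ x t s v) \<in> borel_measurable P"
  using measurable_compose[OF measurable_Pair1' occ_measurable, of s] by simp

lemma occ_measurable2: "v \<in> space P \<Longrightarrow> (\<lambda>s. occ x t s v) \<in> borel_measurable lborel"
  using measurable_compose[OF measurable_Pair2' occ_measurable, of v] by simp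

lemma local_time_occ: "local_time Y x t v = (\<integral>s. occ x t s v \<partial>lborel)"
  unfolding local_time_def set_lebesgue_integral_def occ_def
  by (intro Bochner_Integration.integral_cong) (auto simp: indicator_def max_def)

lemma integrable_occ:
  assumes "v \<in> space P"
  shows "integrable lborel (\<lambda>s. occ x t s v)"
proof (rule Bochner_Integration.integrable_bound)
  show "integrable lborel (indicator {0..t} :: real \<Rightarrow> real)"
    by (intro integrable_real_indicator) (auto simp: emeasure_lborel_Icc_eq)
  show "AE s in lborel. norm (occ x t s v) \<le> norm (indicator {0..t} s :: real)"
    by (simp add: occ_def indicator_def)
qed (rule occ_measurable2[OF assms])

lemma local_time_measurable: "local_time Y x t \<in> borel_measurable P"
proof -
  have "(\<lambda>(v, s). occ x t s v) \<in> borel_measurable (P \<Otimes>\<^sub>M lborel)"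
    using measurable_pair_swap[OF occ_measurable[of x t]] by simp
  then have "(\<lambda>v. \<integral>s. occ x t s v \<partial>lborel) \<in> borel_measurable P"
    by (rule lborel.borel_measurable_lebesgue_integral)
  moreover have "local_time Y x t = (\<lambda>v. \<integral>s. occ x t s v \<partial>lborel)"
    by (rule ext) (rule local_time_occ)
  ultimately show ?thesis by simp
qed

lemma local_time_nonneg: "0 \<le> local_time Y x t v"
  unfolding local_time_occ by (intro Bochner_Integration.integral_nonneg occ_nonneg)

lemma local_time_le:
  assumes "v \<in> space P" "0 \<le> t"
  shows "local_time Y x t v \<le> t"
proof -
  have "local_time Y x t v \<le> (\<integral>s. indicator {0..t} s \<partial>lborel)"
    unfolding local_time_occ
    using assms(1) by (intro integral_mono integrable_occ integrable_real_indicator)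
      (auto simp: occ_def indicator_def emeasure_lborel_Icc_eq)
  then show ?thesis using assms by simp
qed

lemma ennreal_local_time:
  "v \<in> space P \<Longrightarrow> ennreal (local_time Y x t v) = (\<integral>\<^sup>+s. occ x t s v \<partial>lborel)"
  unfolding local_time_occ
  by (intro nn_integral_eq_integral[symmetric] integrable_occ) (auto simp: occ_nonneg)

end

section \<open>Moments of local times and the Green function\<close>

context reversible_jump_process
begin

interpretation pair_sigma_finite lborel P
  by unfold_locales

lemma nn_integral_occ:
  assumes "x \<in> S"
  shows "(\<integral>\<^sup>+v. occ x t s v \<partial>P) = indicator {0..t} s * ennreal (\<mu> x)"
proof (cases "s \<in> {0..t}")
  case True
  have "(\<integral>\<^sup>+v. occ x t s v \<partial>P) = (\<integral>\<^sup>+v. indicator {v \<in> space P. Y s v = x} v \<partial>P)"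
    using True by (intro nn_integral_cong) (auto simp: occ_def indicator_def max_def)
  also have "\<dots> = ennreal (\<mu> x)"
    using True sets_Y_eq[of s x] prob_Y_eq[of s x] assms by (simp add: emeasure_eq_measure)
  finally show ?thesis using True by simp
qed (simp add: occ_def)

lemma nn_integral_local_time:
  assumes x: "x \<in> S" and t: "0 \<le> t"
  shows "(\<integral>\<^sup>+v. local_time Y x t v \<partial>P) = ennreal (t * \<mu> x)"
proof -
  have "(\<integral>\<^sup>+v. local_time Y x t v \<partial>P) = (\<integral>\<^sup>+v. (\<integral>\<^sup>+s. occ x t s v \<partial>lborel) \<partial>P)"
    by (intro nn_integral_cong ennreal_local_time)
  also have "\<dots> = (\<integral>\<^sup>+s. (\<integral>\<^sup>+v. occ x t s v \<partial>P) \<partial>lborel)"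
    using measurable_compose[OF occ_measurable measurable_ennreal, of x t]
    by (intro Fubini') (simp add: case_prod_beta')
  also have "\<dots> = (\<integral>\<^sup>+s. ennreal (\<mu> x) * indicator {0..t} s \<partial>lborel)"
    by (simp add: nn_integral_occ x mult.commute)
  also have "\<dots> = ennreal (\<mu> x) * ennreal t"
    using t by (simp add: nn_integral_cmult_indicator)
  finally show ?thesis
    using \<mu>_pos[OF x] t by (simp add: ennreal_mult' mult.commute)
qed

lemma integrable_local_time:
  assumes "0 \<le> t"
  shows "integrable P (local_time Y x t)"
  by (rule integrable_const_bound[where B = t])
     (auto simp: local_time_measurable local_time_le local_time_nonneg assms)

lemma expectation_local_time:
  assumes "x \<in> S" "0 \<le> t"
  shows "expectation (local_time Y x t) = t * \<mu> x"
  using nn_integral_local_time[OF assms] \<mu>_pos[of x] assms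
  by (subst integral_eq_nn_integral) (auto simp: local_time_measurable local_time_nonneg)

text \<open>The expected time spent in \<open>y\<close> up to \<open>t\<close> when starting from
  \<open>x\<close>, defined analytically so that no process started at a fixed site has to be
  constructed.\<close>

definition green :: "real \<Rightarrow> 's \<Rightarrow> 's \<Rightarrow> real" where
  "green t x y = integral {0..t} (\<lambda>s. trans_fun s x y)"

lemma has_integral_green:
  assumes "x \<in> S"
  shows "((\<lambda>s. trans_fun s x y) has_integral green t x y) {0..t}"
  unfolding green_def
  by (intro integrable_integral integrable_continuous_real continuous_on_transition finite_S assms)

lemma green_nonneg:
  assumes "x \<in> S" "y \<in> S"
  shows "0 \<le> green t x y"
  using has_integral_nonneg[OF has_integral_green[OF assms(1)]] transition_nonneg assms by auto

lemma nn_integral_occ2: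
  assumes x: "x \<in> S" and s: "s \<in> {0..t}" and r: "r \<in> {0..t}"
  shows "(\<integral>\<^sup>+v. ennreal (occ x t s v) * occ x t r v \<partial>P) = ennreal (\<mu> x * trans_fun \<bar>r - s\<bar> x x)"
proof -
  have "(\<integral>\<^sup>+v. ennreal (occ x t s v) * occ x t r v \<partial>P)
      = (\<integral>\<^sup>+v. indicator {v \<in> space P. Y s v = x \<and> Y r v = x} v \<partial>P)"
    using s r by (intro nn_integral_cong) (auto simp: occ_def indicator_def max_def)
  also have "\<dots> = ennreal (prob {v \<in> space P. Y s v = x \<and> Y r v = x})"
    using s r sets_Y_eq2[of s r x x] by (simp add: emeasure_eq_measure)
  also have "prob {v \<in> space P. Y s v = x \<and> Y r v = x} = \<mu> x * trans_fun \<bar>r - s\<bar> x x"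
    using prob_Y_eq2[of s r x x] prob_Y_eq2[of r s x x] s r x
    by (cases "s \<le> r") (auto simp: conj_commute)
  finally show ?thesis .
qed

text \<open>The square is a double time integral whose integrand has mean
  \<open>\<mu> x * trans_fun \<bar>r - s\<bar> x x\<close>. For fixed \<open>s\<close>, the times
  before and after \<open>s\<close> each contribute at most one Green function, whence the factor
  2.\<close>

lemma nn_integral_local_time_sq:
  assumes x: "x \<in> S" and t: "0 \<le> t"
  shows "(\<integral>\<^sup>+v. ennreal ((local_time Y x t v)\<^sup>2) \<partial>P) \<le> ennreal (2 * t * \<mu> x * green t x x)"
proof -
  let ?o = "\<lambda>s v. ennreal (occ x t s v)"
  have meas: "(\<lambda>(s, v). ?o s v) \<in> borel_measurable (lborel \<Otimes>\<^sub>M P)"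
    using measurable_compose[OF occ_measurable measurable_ennreal, of x t]
    by (simp add: case_prod_beta')
  have measl: "local_time Y x t \<in> borel_measurable P"
    by (rule local_time_measurable)
  have o2: "(\<lambda>v. ?o s v) \<in> borel_measurable P" for s
    using occ_measurable1[of s] by simp
  have o1: "(\<lambda>s. ?o s v) \<in> borel_measurable lborel" if "v \<in> space P" for v
    using occ_measurable2[OF that] by simp
  \<comment> \<open>Extended by zero to the whole line, the return probability can be shifted and
    reflected by the invariance of Lebesgue measure.\<close>
  define g where "g s = ennreal (trans_fun s x x) * indicator {0..t} s" for s
  have g_meas: "g \<in> borel_measurable borel"
  proof -
    have "(\<lambda>s. trans_fun s x x) \<in> borel_measurable borel"
      by (intro borel_measurable_continuous_onI continuous_on_transition finite_S x)
    then show ?thesis unfolding g_def by measurable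
  qed
  have g: "(\<integral>\<^sup>+s. g s \<partial>lborel) = ennreal (green t x x)"
    unfolding g_def by (rule nn_integral_has_integral_lebesgue'[OF _ has_integral_green])
      (auto simp: transition_nonneg x)
  have g1: "(\<integral>\<^sup>+r. g (r - s) \<partial>lborel) = ennreal (green t x x)" for s
    using nn_integral_real_affine[of g 1 "- s"] g_meas g by simp
  have g2: "(\<integral>\<^sup>+r. g (s - r) \<partial>lborel) = ennreal (green t x x)" for s
    using nn_integral_real_affine[of g "-1" s] g_meas g by simp
  have inner: "(\<integral>\<^sup>+r. (\<integral>\<^sup>+v. ?o s v * ?o r v \<partial>P) \<partial>lborel)
      \<le> ennreal (2 * \<mu> x * green t x x) * indicator {0..t} s" for s
  proof (cases "s \<in> {0..t}")
    case True
    have "(\<integral>\<^sup>+v. ?o s v * ?o r v \<partial>P) \<le> ennreal (\<mu> x) * (g (r - s) + g (s - r))" for r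
    proof (cases "r \<in> {0..t}")
      case r: True
      have "(\<integral>\<^sup>+v. ?o s v * ?o r v \<partial>P) = ennreal (\<mu> x) * ennreal (trans_fun \<bar>r - s\<bar> x x)"
        using nn_integral_occ2[OF x True r] \<mu>_pos[OF x] by (simp add: ennreal_mult')
      also have "ennreal (trans_fun \<bar>r - s\<bar> x x) \<le> g (r - s) + g (s - r)"
        using True r by (cases "s \<le> r") (auto simp: g_def indicator_def)
      finally show ?thesis by (simp add: mult_left_mono)
    qed (simp add: occ_def)
    then have "(\<integral>\<^sup>+r. (\<integral>\<^sup>+v. ?o s v * ?o r v \<partial>P) \<partial>lborel)
        \<le> (\<integral>\<^sup>+r. ennreal (\<mu> x) * (g (r - s) + g (s - r)) \<partial>lborel)"
      by (intro nn_integral_mono)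
    also have "\<dots> = ennreal (\<mu> x) * (ennreal (green t x x) + ennreal (green t x x))"
      using g_meas by (subst nn_integral_cmult; (subst nn_integral_add)?) (simp_all add: g1 g2)
    also have "\<dots> = ennreal (2 * \<mu> x * green t x x)"
      using \<mu>_pos[OF x] green_nonneg[OF x x]
      by (simp add: ennreal_mult'[symmetric] ennreal_plus[symmetric] algebra_simps del: ennreal_plus)
    finally show ?thesis using True by simp
  qed (simp add: occ_def)
  have "(\<integral>\<^sup>+v. ennreal ((local_time Y x t v)\<^sup>2) \<partial>P)
      = (\<integral>\<^sup>+v. (\<integral>\<^sup>+s. ?o s v * ennreal (local_time Y x t v) \<partial>lborel) \<partial>P)"
    using o1 by (intro nn_integral_cong)
      (simp add: power2_eq_square ennreal_mult' local_time_nonneg ennreal_local_time nn_integral_multc)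
  also have "\<dots> = (\<integral>\<^sup>+s. (\<integral>\<^sup>+v. ?o s v * ennreal (local_time Y x t v) \<partial>P) \<partial>lborel)"
    unfolding case_prod_beta'
    by (intro Fubini', unfold case_prod_beta',
        intro borel_measurable_times_ennreal meas[unfolded case_prod_beta']
          measurable_compose[OF measurable_compose[OF measurable_snd measl] measurable_ennreal])
  also have "\<dots> = (\<integral>\<^sup>+s. (\<integral>\<^sup>+v. (\<integral>\<^sup>+r. ?o s v * ?o r v \<partial>lborel) \<partial>P) \<partial>lborel)"
    using o1 by (intro nn_integral_cong) (simp add: ennreal_local_time nn_integral_cmult)
  also have "\<dots> = (\<integral>\<^sup>+s. (\<integral>\<^sup>+r. (\<integral>\<^sup>+v. ?o s v * ?o r v \<partial>P) \<partial>lborel) \<partial>lborel)"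
    by (intro nn_integral_cong Fubini', unfold case_prod_beta',
        intro borel_measurable_times_ennreal meas[unfolded case_prod_beta']
          measurable_compose[OF measurable_snd o2])
  also have "\<dots> \<le> (\<integral>\<^sup>+s. ennreal (2 * \<mu> x * green t x x) * indicator {0..t} s \<partial>lborel)"
    by (intro nn_integral_mono inner)
  also have "\<dots> = ennreal (2 * t * \<mu> x * green t x x)"
    using t by (subst nn_integral_cmult_indicator) (simp_all add: ennreal_mult''[symmetric] ennreal_mult'[symmetric] mult_ac)
  finally show ?thesis .
qed

lemma expectation_local_time_sq:
  assumes "x \<in> S" "0 \<le> t"
  shows "expectation (\<lambda>v. (local_time Y x t v)\<^sup>2) \<le> 2 * t * \<mu> x * green t x x"
proof -
  have "0 \<le> 2 * t * \<mu> x * green t x x"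
    using assms \<mu>_pos[of x] green_nonneg[of x x t] by simp
  then show ?thesis
    using nn_integral_local_time_sq[OF assms] local_time_measurable[of x t]
    by (subst integral_eq_nn_integral) (auto intro: enn2real_leI)
qed

text \<open>The backward equation integrated over \<open>{0..t}\<close>. The finite horizon leaves
  the nonnegative term \<open>trans_fun t z x\<close>, which is the \<open>g\<close> of
  \<open>dirichlet_form_edge_bound\<close>.\<close>

lemma generator_green:
  assumes z: "z \<in> S" and t: "0 \<le> t"
  shows "(\<Sum>w\<in>S. generator S q z w * green t w x) = trans_fun t z x - (if z = x then 1 else 0)"
proof -
  have 1: "((\<lambda>s. \<Sum>w\<in>S. generator S q z w * trans_fun s w x) has_integral
      (\<Sum>w\<in>S. generator S q z w * green t w x)) {0..t}"
    by (intro has_integral_sum has_integral_mult_right has_integral_green finite_S)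
  have 2: "((\<lambda>s. \<Sum>w\<in>S. generator S q z w * trans_fun s w x) has_integral
      trans_fun t z x - trans_fun 0 z x) {0..t}"
    using transition_backward_equation[OF finite_S z, of q x] t
    by (intro fundamental_theorem_of_calculus)
       (auto simp: has_real_derivative_iff_has_vector_derivative intro: has_vector_derivative_at_within)
  show ?thesis
    using has_integral_unique[OF 1 2] by (simp add: transition_0)
qed

text \<open>Time spent in \<open>y\<close> from a stationary start: although the Green function may
  be large at its pole, its average over starting sites is small. This supplies the far end of the
  path in \<open>green_bound\<close>.\<close>

lemma sum_green:
  assumes "y \<in> S" "0 \<le> t"
  shows "(\<Sum>z\<in>S. \<mu> z * green t z y) = t * \<mu> y"
proof -
  have "((\<lambda>s. \<Sum>z\<in>S. \<mu> z * trans_fun s z y) has_integral (\<Sum>z\<in>S. \<mu> z * green t z y)) {0..t}"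
    by (intro has_integral_sum has_integral_mult_right has_integral_green finite_S)
  then have 1: "((\<lambda>s. \<mu> y) has_integral (\<Sum>z\<in>S. \<mu> z * green t z y)) {0..t}"
    by (simp add: transition_stationary[OF finite_S assms(1) rev])
  have 2: "((\<lambda>s. \<mu> y) has_integral t * \<mu> y) {0..t}"
    using has_integral_const_real[of "\<mu> y" 0 t] assms by simp
  show ?thesis
    by (rule has_integral_unique[OF 1 2])
qed

text \<open>The energy of the Green function is controlled by its value at the pole, so it cannot
  change much across a well conducting edge.\<close>

lemma green_edge_bound:
  assumes "x \<in> S" "z \<in> S" "w \<in> S" "0 \<le> t"
  shows "\<mu> z * q z w * (green t z x - green t w x)\<^sup>2 \<le> \<mu> x * green t x x"
proof (rule dirichlet_form_edge_bound[where S = S and g = "\<lambda>z. trans_fun t z x"])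
  show "\<mu> x * q x y = \<mu> y * q y x" if "x \<in> S" "y \<in> S" for x y
    using rev that .
qed (use assms \<mu>_pos in \<open>auto simp: finite_S q_nonneg generator_green green_nonneg transition_nonneg less_imp_le\<close>)

section \<open>Hitting probabilities from the equilibrium flow\<close>

lemma prob_Y_in:
  assumes C: "C \<subseteq> S" and t: "0 \<le> t"
  shows "prob {v \<in> space P. Y t v \<in> C} = (\<Sum>z\<in>C. \<mu> z)"
proof -
  have fin: "finite C" using C finite_S finite_subset by auto
  have "{v \<in> space P. Y t v \<in> C} = (\<Union>z\<in>C. {v \<in> space P. Y t v = z})" by auto
  also have "prob \<dots> = (\<Sum>z\<in>C. prob {v \<in> space P. Y t v = z})"
    using fin sets_Y_eq[OF t]
    by (intro finite_measure_finite_Union) (auto simp: disjoint_family_on_def)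
  also have "\<dots> = (\<Sum>z\<in>C. \<mu> z)"
    using C prob_Y_eq[OF t] by (intro sum.cong) auto
  finally show ?thesis .
qed

lemma prob_enter:
  assumes C: "C \<subseteq> S" and s: "0 \<le> s" and t: "s \<le> t"
  shows "prob {v \<in> space P. Y s v \<notin> C \<and> Y t v \<in> C}
    = (\<Sum>u\<in>S - C. \<Sum>z\<in>C. \<mu> u * trans_fun (t - s) u z)"
proof -
  let ?F = "\<lambda>p. {v \<in> space P. Y s v = fst p \<and> Y t v = snd p}"
  have t': "0 \<le> t" using s t by simp
  have fin: "finite C" using C finite_S finite_subset by auto
  have "{v \<in> space P. Y s v \<notin> C \<and> Y t v \<in> C} = (\<Union>p\<in>(S - C) \<times> C. ?F p)"
    using Y_in_S[OF s] by auto
  also have "prob \<dots> = (\<Sum>p\<in>(S - C) \<times> C. prob (?F p))"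
  proof (rule finite_measure_finite_Union)
    show "finite ((S - C) \<times> C)" using fin finite_S by simp
    show "?F ` ((S - C) \<times> C) \<subseteq> sets P" using sets_Y_eq2[OF s t'] by auto
    show "disjoint_family_on ?F ((S - C) \<times> C)"
      by (auto simp: disjoint_family_on_def)
  qed
  also have "\<dots> = (\<Sum>p\<in>(S - C) \<times> C. \<mu> (fst p) * trans_fun (t - s) (fst p) (snd p))"
    using C s t by (intro sum.cong refl prob_Y_eq2) auto
  finally show ?thesis by (simp add: sum.cartesian_product case_prod_beta)
qed

text \<open>Each time the process sampled along a grid of mesh \<open>t / N\<close> enters \<open>C\<close>, it crosses the boundary of
  \<open>C\<close> within one step; by stationarity all steps cost the same.\<close>

lemma hitting_prob:
  assumes x: "x \<in> C" and C: "C \<subseteq> S" and t: "0 < t"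
  shows "prob {v \<in> space P. 0 < local_time Y x t v}
    \<le> (\<Sum>z\<in>C. \<mu> z) + t * (\<Sum>u\<in>S - C. \<Sum>z\<in>C. \<mu> u * q u z)"
proof -
  define h where "h N = t / (real N + 1)" for N
  have h_pos: "0 < h N" for N using t by (simp add: h_def)
  have h_lim: "h \<longlonglongrightarrow> 0"
    using tendsto_mult_left[OF LIMSEQ_inverse_real_of_nat, of t]
    by (simp add: h_def[abs_def] divide_inverse add.commute)
  define A where "A N = {v \<in> space P. \<exists>k\<le>N. Y (k * h N) v \<in> C}" for N :: nat
  \<comment> \<open>\<open>B n\<close> asks that every grid from the \<open>n\<close>-th on detects
    a visit to \<open>C\<close>. These events increase, and a path with positive local time lies in
    one of them, so the bound for a single grid passes to the limit by continuity from
    below.\<close>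
  define B where "B n = (\<Inter>N\<in>{n..}. A N)" for n
  let ?E = "{v \<in> space P. 0 < local_time Y x t v}"
  have h0: "0 \<le> real k * h N" for k N using h_pos[of N] by simp
  have A_sets: "A N \<in> sets P" for N
  proof -
    have "A N = (\<Union>k\<in>{..N}. {v \<in> space P. Y (k * h N) v \<in> C})" by (auto simp: A_def)
    then show ?thesis using sets_Y_pred[OF h0] by auto
  qed
  have B_sets: "B n \<in> sets P" for n
    unfolding B_def using A_sets by (intro sets.countable_INT') auto
  let ?b = "\<lambda>N. (\<Sum>z\<in>C. \<mu> z) + real N * (\<Sum>u\<in>S - C. \<Sum>z\<in>C. \<mu> u * trans_fun (h N) u z)"
  have step: "prob {v \<in> space P. Y (k * h N) v \<notin> C \<and> Y (Suc k * h N) v \<in> C}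
      = (\<Sum>u\<in>S - C. \<Sum>z\<in>C. \<mu> u * trans_fun (h N) u z)" for k N
    using prob_enter[OF C h0[of k N], of "Suc k * h N"] h_pos[of N] by (simp add: algebra_simps)
  have F_sets: "{v \<in> space P. Y (k * h N) v \<notin> C \<and> Y (Suc k * h N) v \<in> C} \<in> sets P" for k N
    by (intro sets.sets_Collect_conj sets_Y_pred[OF h0] sets_Y_pred[OF h0, of _ _ "- C", simplified])
  have A_bound: "prob (A N) \<le> ?b N" for N
  proof -
    have "A N \<subseteq> {v \<in> space P. Y 0 v \<in> C}
        \<union> (\<Union>k<N. {v \<in> space P. Y (k * h N) v \<notin> C \<and> Y (Suc k * h N) v \<in> C})"
    proof
      fix v assume "v \<in> A N"
      then obtain k where k: "k \<le> N" "Y (k * h N) v \<in> C" and v: "v \<in> space P"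
        by (auto simp: A_def)
      \<comment> \<open>At the first grid time in \<open>C\<close>, either the path starts in
        \<open>C\<close> or the preceding step enters it.\<close>
      define m where "m = (LEAST k. Y (real k * h N) v \<in> C)"
      have m: "Y (m * h N) v \<in> C" "m \<le> k"
        unfolding m_def using k(2) by (auto intro: LeastI Least_le)
      show "v \<in> {v \<in> space P. Y 0 v \<in> C}
        \<union> (\<Union>k<N. {v \<in> space P. Y (k * h N) v \<notin> C \<and> Y (Suc k * h N) v \<in> C})"
      proof (cases m)
        case (Suc j)
        then have "Y (j * h N) v \<notin> C"
          unfolding m_def by (metis lessI not_less_Least)
        then show ?thesis using m Suc k v by auto
      qed (use m v in auto)
    qed
    then have "prob (A N) \<le> prob ({v \<in> space P. Y 0 v \<in> C}
        \<union> (\<Union>k<N. {v \<in> space P. Y (k * h N) v \<notin> C \<and> Y (Suc k * h N) v \<in> C}))"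
      using sets_Y_pred[of 0 C] F_sets by (intro finite_measure_mono sets.Un sets.finite_UN) auto
    also have "\<dots> \<le> prob {v \<in> space P. Y 0 v \<in> C}
        + prob (\<Union>k<N. {v \<in> space P. Y (k * h N) v \<notin> C \<and> Y (Suc k * h N) v \<in> C})"
      using sets_Y_pred[of 0 C] F_sets by (intro measure_Un_le sets.finite_UN) auto
    also have "prob (\<Union>k<N. {v \<in> space P. Y (k * h N) v \<notin> C \<and> Y (Suc k * h N) v \<in> C})
      \<le> (\<Sum>k<N. prob {v \<in> space P. Y (k * h N) v \<notin> C \<and> Y (Suc k * h N) v \<in> C})"
      using F_sets by (intro finite_measure_subadditive_finite) auto
    also have "\<dots> = N * (\<Sum>u\<in>S - C. \<Sum>z\<in>C. \<mu> u * trans_fun (h N) u z)"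
      unfolding step by simp
    also have "prob {v \<in> space P. Y 0 v \<in> C} = (\<Sum>z\<in>C. \<mu> z)"
      by (rule prob_Y_in[OF C]) simp
    finally show ?thesis by simp
  qed
  have lim: "?b \<longlonglongrightarrow> (\<Sum>z\<in>C. \<mu> z) + t * (\<Sum>u\<in>S - C. \<Sum>z\<in>C. \<mu> u * q u z)"
  proof -
    \<comment> \<open>Off the diagonal the transition function vanishes at time 0, and its
      derivative there is the jump rate; hence the grid bound converges to the flow across the
      boundary.\<close>
    have deriv: "(\<lambda>N. trans_fun (h N) u z / h N) \<longlonglongrightarrow> q u z" if "u \<in> S - C" "z \<in> C" for u z
    proof -
      have uz: "u \<in> S" "u \<noteq> z" "z \<in> S" using that C by auto
      have "(\<Sum>w\<in>S. generator S q u w * trans_fun 0 w z) = q u z"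
      proof -
        have "(\<Sum>w\<in>S. generator S q u w * trans_fun 0 w z)
            = (\<Sum>w\<in>S. if w = z then generator S q u w else 0)"
          by (intro sum.cong) (auto simp: transition_0)
        then show ?thesis using uz finite_S by (simp add: generator_def)
      qed
      then have "((\<lambda>e. trans_fun e u z / e) \<longlongrightarrow> q u z) (at 0)"
        using transition_backward_equation[OF finite_S uz(1), of q z 0] uz
        by (simp add: DERIV_def transition_0)
      moreover have "h N \<noteq> 0" for N using h_pos[of N] by simp
      then have "filterlim h (at 0) sequentially"
        using h_lim by (simp add: filterlim_at)
      ultimately show ?thesis
        by (rule filterlim_compose)
    qed
    have Nh: "(\<lambda>N. real N * h N) \<longlonglongrightarrow> t"
    proof -
      have "real N * h N = t - h N" for N by (simp add: h_def field_simps)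
      then show ?thesis using tendsto_diff[OF tendsto_const h_lim, of t] by simp
    qed
    have "(\<lambda>N. (\<Sum>z\<in>C. \<mu> z) + real N * h N * (\<Sum>u\<in>S - C. \<Sum>z\<in>C. \<mu> u * (trans_fun (h N) u z / h N)))
      \<longlonglongrightarrow> (\<Sum>z\<in>C. \<mu> z) + t * (\<Sum>u\<in>S - C. \<Sum>z\<in>C. \<mu> u * q u z)"
      by (intro tendsto_intros Nh deriv)
    moreover have "real N * h N * (\<Sum>u\<in>S - C. \<Sum>z\<in>C. \<mu> u * (trans_fun (h N) u z / h N))
        = real N * (\<Sum>u\<in>S - C. \<Sum>z\<in>C. \<mu> u * trans_fun (h N) u z)" for N
      using h_pos[of N] by (simp add: sum_distrib_left)
    ultimately show ?thesis by (simp only:)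
  qed
  have B_bound: "prob (B n) \<le> (\<Sum>z\<in>C. \<mu> z) + t * (\<Sum>u\<in>S - C. \<Sum>z\<in>C. \<mu> u * q u z)" for n
  proof (rule LIMSEQ_le_const[OF lim], intro exI allI impI)
    fix N assume "n \<le> N"
    then have "prob (B n) \<le> prob (A N)"
      using A_sets by (intro finite_measure_mono) (auto simp: B_def)
    then show "prob (B n) \<le> ?b N" using A_bound[of N] by linarith
  qed
  have sub: "?E \<subseteq> (\<Union>n. B n)"
  proof
    fix v assume "v \<in> ?E"
    then have v: "v \<in> space P" and pos: "0 < local_time Y x t v" by auto
    \<comment> \<open>The visit occurs strictly before \<open>t\<close>, as the single instant
      \<open>t\<close> carries no local time. This leaves room for a later grid point with index at
      most \<open>N\<close>.\<close>
    have "\<exists>s\<in>{0..<t}. Y s v = x"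
    proof (rule ccontr)
      assume "\<not> ?thesis"
      then have "occ x t s v \<le> indicator {t} s" for s
        by (auto simp: occ_def indicator_def max_def)
      then have "(\<integral>s. occ x t s v \<partial>lborel) \<le> (\<integral>s. indicator {t} s \<partial>lborel)"
        by (intro integral_mono integrable_occ v integrable_real_indicator) auto
      then show False using pos by (simp add: local_time_occ)
    qed
    then obtain s where s: "0 \<le> s" "s < t" "Y s v = x" by auto
    obtain b where b: "b > s" "\<And>r. s < r \<Longrightarrow> r < b \<Longrightarrow> Y r v = Y s v"
      using Y_right_continuous[OF v s(1)] by (auto simp: eventually_at_right_field)
    have "\<forall>\<^sub>F N in sequentially. h N < min (b - s) (t - s)"
      using b(1) s by (intro order_tendstoD(2)[OF h_lim]) auto
    then obtain n where n: "\<And>N. n \<le> N \<Longrightarrow> h N < min (b - s) (t - s)"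
      by (auto simp: eventually_sequentially)
    have "v \<in> A N" if "n \<le> N" for N
    proof -
      \<comment> \<open>The first grid point strictly after \<open>s\<close>: for a fine grid it
        precedes both \<open>t\<close> and the time \<open>b\<close> up to which the path is known
        to stay at \<open>x\<close>.\<close>
      define k where "k = nat \<lfloor>s / h N\<rfloor> + 1"
      have "real k = of_int \<lfloor>s / h N\<rfloor> + 1"
        using s h_pos[of N] by (simp add: k_def)
      then have "s / h N < k" "k \<le> s / h N + 1" by linarith+
      then have k: "s < k * h N" "k * h N \<le> s + h N"
        using h_pos[of N] by (simp_all add: field_simps)
      then have "k * h N < b" "k * h N < t" using n[OF that] by auto
      then have "t * real k < t * real (N + 1)"
        by (simp add: h_def field_simps)
      then have "k \<le> N"
        using t by (simp add: mult_less_cancel_left_pos del: of_nat_add)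
      then show ?thesis
        using b(2)[of "k * h N"] k \<open>k * h N < b\<close> s x v by (auto simp: A_def)
    qed
    then show "v \<in> (\<Union>n. B n)" by (auto simp: B_def)
  qed
  have inc: "incseq B" by (force simp: B_def incseq_def)
  have "(\<lambda>n. prob (B n)) \<longlonglongrightarrow> prob (\<Union>n. B n)"
    using B_sets inc by (intro finite_Lim_measure_incseq) auto
  then have "prob (\<Union>n. B n) \<le> (\<Sum>z\<in>C. \<mu> z) + t * (\<Sum>u\<in>S - C. \<Sum>z\<in>C. \<mu> u * q u z)"
    using B_bound by (intro LIMSEQ_le_const2) auto
  moreover have "prob ?E \<le> prob (\<Union>n. B n)"
    using B_sets sub by (intro finite_measure_mono) auto
  ultimately show ?thesis by linarith
qed

end

section \<open>The exploration process on the hypercube\<close>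

lemma finite_hypercube: "finite (hypercube n)"
  by (simp add: hypercube_def finite_PiE)

lemma card_hypercube: "card (hypercube n) = 2 ^ n"
  by (simp add: hypercube_def card_PiE numeral_2_eq_2)

lemma hypercube_nonempty: "hypercube n \<noteq> {}"
proof
  assume "hypercube n = {}"
  then show False using card_hypercube[of n] by simp
qed

lemma adjacent_sym: "adjacent n x y \<longleftrightarrow> adjacent n y x"
proof -
  have "{i \<in> {1..n}. x i \<noteq> y i} = {i \<in> {1..n}. y i \<noteq> x i}" by auto
  then show ?thesis by (auto simp: adjacent_def)
qed

lemma adjacent_imp_flip:
  assumes "adjacent n x y"
  shows "\<exists>i\<in>{1..n}. y = x(i := - x i)"
proof -
  have x: "x \<in> hypercube n" and y: "y \<in> hypercube n" and "card {i \<in> {1..n}. x i \<noteq> y i} = 1"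
    using assms by (auto simp: adjacent_def)
  then obtain i where i: "{i \<in> {1..n}. x i \<noteq> y i} = {i}"
    by (auto simp: card_1_singleton_iff)
  have "y = x(i := - x i)"
  proof
    fix j
    consider "j = i" | "j \<in> {1..n}" "j \<noteq> i" | "j \<notin> {1..n}" by blast
    then show "y j = (x(i := - x i)) j"
    proof cases
      case 1
      have "i \<in> {1..n}" "x i \<noteq> y i" using i by blast+
      moreover from this have "x i \<in> {-1, 1}" "y i \<in> {-1, 1}"
        using x y by (auto simp: hypercube_def PiE_iff)
      ultimately have "y i = - x i" by force
      then show ?thesis using 1 by auto
    next
      case 2
      then have "x j = y j" using i by blast
      then show ?thesis using 2 by simp
    next
      case 3
      moreover have "i \<in> {1..n}" using i by blast
      ultimately have "j \<noteq> i" by blast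
      moreover have "x j = y j"
        using 3 x y unfolding hypercube_def by (metis PiE_arb)
      ultimately show ?thesis by simp
    qed
  qed
  moreover have "i \<in> {1..n}" using i by blast
  ultimately show ?thesis by blast
qed

lemma finite_adjacent: "finite {y. adjacent n x y}"
  by (rule finite_subset[OF _ finite_hypercube[of n]]) (auto simp: adjacent_def)

lemma card_adjacent_le: "card {y. adjacent n x y} \<le> n"
proof -
  have "{y. adjacent n x y} \<subseteq> (\<lambda>i. x(i := - x i)) ` {1..n}"
    using adjacent_imp_flip by blast
  then have "card {y. adjacent n x y} \<le> card ((\<lambda>i. x(i := - x i)) ` {1..n})"
    by (intro card_mono) auto
  also have "\<dots> \<le> n"
    using card_image_le[of "{1..n}" "\<lambda>i. x(i := - x i)"] by simp
  finally show ?thesis .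
qed

text \<open>The canonical path on the hypercube, which adopts the coordinates of \<open>y\<close> in
  increasing order. It stands still at coordinates where \<open>x\<close> and \<open>y\<close>
  agree, so steps are adjacent or trivial.\<close>

definition interpolate :: "vertex \<Rightarrow> vertex \<Rightarrow> nat \<Rightarrow> vertex" where
  "interpolate x y i = (\<lambda>j. if j \<le> i then y j else x j)"

lemma interpolate_in_hypercube:
  "x \<in> hypercube n \<Longrightarrow> y \<in> hypercube n \<Longrightarrow> interpolate x y i \<in> hypercube n"
  by (auto simp: hypercube_def interpolate_def PiE_def extensional_def Pi_def)

lemma interpolate_0: "x \<in> hypercube n \<Longrightarrow> y \<in> hypercube n \<Longrightarrow> interpolate x y 0 = x"
  by (auto simp: hypercube_def interpolate_def PiE_def extensional_def)

lemma interpolate_n: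
  assumes "x \<in> hypercube n" "y \<in> hypercube n"
  shows "interpolate x y n = y"
proof
  fix j
  show "interpolate x y n j = y j"
    using assms by (cases "j \<le> n") (auto simp: hypercube_def interpolate_def PiE_def extensional_def)
qed

lemma interpolate_step:
  assumes "x \<in> hypercube n" "y \<in> hypercube n" "i < n"
  shows "interpolate x y i = interpolate x y (Suc i)
    \<or> adjacent n (interpolate x y i) (interpolate x y (Suc i))"
proof (cases "x (Suc i) = y (Suc i)")
  case True
  then have "interpolate x y i = interpolate x y (Suc i)"
    by (auto simp: interpolate_def le_Suc_eq)
  then show ?thesis ..
next
  case False
  then have "{j \<in> {1..n}. interpolate x y i j \<noteq> interpolate x y (Suc i) j} = {Suc i}"
    using assms(3) by (auto simp: interpolate_def le_Suc_eq)
  then show ?thesis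
    using assms interpolate_in_hypercube by (simp add: adjacent_def)
qed

text \<open>Only the target of a step must be high. Thus \<open>x\<close> belongs to its cluster
  whatever \<open>\<tau> x\<close> is, every outer boundary site is below \<open>r\<close>, and the
  height of \<open>x\<close> stays separate from that of the other sites in first moment
  counts.\<close>

definition cluster :: "nat \<Rightarrow> real \<Rightarrow> (vertex \<Rightarrow> real) \<Rightarrow> vertex \<Rightarrow> vertex set" where
  "cluster n r \<tau> x = {(u, v). adjacent n u v \<and> r \<le> \<tau> v}\<^sup>* `` {x}"

lemma cluster_refl: "x \<in> cluster n r \<tau> x"
  by (simp add: cluster_def)

lemma cluster_subset:
  assumes "x \<in> hypercube n"
  shows "cluster n r \<tau> x \<subseteq> hypercube n"
proof
  fix z assume "z \<in> cluster n r \<tau> x"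
  then have "(x, z) \<in> {(u, v). adjacent n u v \<and> r \<le> \<tau> v}\<^sup>*" by (simp add: cluster_def)
  then show "z \<in> hypercube n"
    using assms by (induction) (auto simp: adjacent_def)
qed

lemma cluster_boundary:
  assumes "z \<in> cluster n r \<tau> x" "u \<notin> cluster n r \<tau> x" "adjacent n z u"
  shows "\<tau> u < r"
proof (rule ccontr)
  assume "\<not> \<tau> u < r"
  then have "(z, u) \<in> {(u, v). adjacent n u v \<and> r \<le> \<tau> v}" using assms by auto
  then show False
    using assms(1,2) by (auto simp: cluster_def intro: rtrancl.rtrancl_into_rtrancl)
qed

definition total_weight :: "nat \<Rightarrow> real \<Rightarrow> (vertex \<Rightarrow> real) \<Rightarrow> real" where
  "total_weight n r \<tau> = (\<Sum>z\<in>hypercube n. min (1 / r) (\<tau> z))"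

locale exploration_process =
  fixes n :: nat and r :: real and \<tau> :: "vertex \<Rightarrow> real"
    and P :: "'v measure" and Y :: "real \<Rightarrow> 'v \<Rightarrow> vertex"
  assumes n_pos: "0 < n" and r_pos: "0 < r" and \<tau>_pos: "\<And>x. 0 < \<tau> x"
    and process: "markov_jump_process (hypercube n) (jump_rate n r \<tau>) (inv_measure n r \<tau>) P Y"
begin

abbreviation Z where "Z \<equiv> total_weight n r \<tau>"

lemma Z_pos: "0 < Z"
  unfolding total_weight_def
  using r_pos \<tau>_pos finite_hypercube hypercube_nonempty by (intro sum_pos) auto

lemma inv_measure_eq: "inv_measure n r \<tau> x = min (1 / r) (\<tau> x) / Z"
  by (simp add: inv_measure_def total_weight_def)

text \<open>The truncation in the measure cancels the denominator of the rate. What remains is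
  symmetric in \<open>x\<close> and \<open>y\<close>, so reversibility can be read off.\<close>

lemma conductance:
  "inv_measure n r \<tau> x * jump_rate n r \<tau> x y
    = (if adjacent n x y then min (\<tau> y) (\<tau> x) / (n * r * Z) else 0)"
proof -
  have "min (1 / r) (\<tau> x) \<noteq> 0" using r_pos \<tau>_pos[of x] by (simp add: min_def)
  then show ?thesis
    using Z_pos by (simp add: inv_measure_eq jump_rate_def)
qed

sublocale reversible_jump_process "hypercube n" "jump_rate n r \<tau>" "inv_measure n r \<tau>" P Y
proof
  fix x y
  show "0 < inv_measure n r \<tau> x"
    using r_pos \<tau>_pos Z_pos by (simp add: inv_measure_eq)
  show "0 \<le> jump_rate n r \<tau> x y"
    using r_pos \<tau>_pos[of x] \<tau>_pos[of y] by (simp add: jump_rate_def)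
  show "inv_measure n r \<tau> x * jump_rate n r \<tau> x y = inv_measure n r \<tau> y * jump_rate n r \<tau> y x"
    unfolding conductance using adjacent_sym[of n x y] by (simp add: min.commute)
qed (rule process)

text \<open>The largest possible weight of a site, attained where \<tau> \<ge> 1/r; it also serves
  as an upper bound for the weights of all sites in a cluster.\<close>

definition \<mu>0 :: real where "\<mu>0 = 1 / (r * Z)"

lemma \<mu>0_pos: "0 < \<mu>0"
  using r_pos Z_pos by (simp add: \<mu>0_def)

lemma inv_measure_high: "1 / r \<le> \<tau> x \<Longrightarrow> inv_measure n r \<tau> x = \<mu>0"
  by (simp add: inv_measure_eq \<mu>0_def min_def)

text \<open>Along paths through sites with \<open>\<tau> \<ge> 1 / r\<close> all edges conduct well, and \<open>z \<mapsto> green t z x\<close> must be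
  small somewhere on any half of the hypercube, because its mean under the invariant measure is tiny.\<close>

lemma green_bound:
  assumes x: "x \<in> hypercube n" and t: "0 \<le> t" "t \<le> 2 ^ (n - 1)"
    and bad: "2 * card {y \<in> hypercube n. \<exists>i\<le>n. \<tau> (interpolate x y i) < 1 / r} \<le> 2 ^ n"
  shows "green t x x \<le> real n ^ 3 * r + 2"
proof -
  let ?h = "\<lambda>z. green t z x"
  let ?B = "{y \<in> hypercube n. \<exists>i\<le>n. \<tau> (interpolate x y i) < 1 / r}"
  let ?G = "hypercube n - ?B"
  have hx: "0 \<le> ?h x" by (rule green_nonneg[OF x x])
  have nn: "2 * (2::nat) ^ (n - 1) = 2 ^ n"
    using n_pos by (cases n) auto
  have cG: "2 ^ (n - 1) \<le> card ?G"
  proof -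
    have "card ?G = 2 ^ n - card ?B"
      using finite_hypercube card_hypercube by (subst card_Diff_subset) auto
    then show ?thesis using bad nn by linarith
  qed
  have G_ne: "?G \<noteq> {}"
  proof
    assume "?G = {}"
    then have "card ?G = 0" by (simp only: card.empty)
    then show False using cG by simp
  qed
  obtain y0 where y0: "y0 \<in> ?G" using G_ne by blast
  have high: "1 / r \<le> \<tau> (interpolate x y i)" if "y \<in> ?G" "i \<le> n" for y i
    using that by (auto simp: not_less)
  have \<mu>x: "inv_measure n r \<tau> x = \<mu>0"
    using high[OF y0, of 0] interpolate_0[OF x] y0 by (intro inv_measure_high) auto
  have \<mu>G: "inv_measure n r \<tau> y = \<mu>0" if "y \<in> ?G" for y
    using high[OF that, of n] interpolate_n[OF x] that by (intro inv_measure_high) auto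
  \<comment> \<open>Otherwise the sum over \<open>?G\<close> would exceed its cardinality, which is
    at least \<open>2 ^ (n - 1) \<ge> t\<close>, whereas stationarity allows at most
    \<open>t\<close>.\<close>
  have "\<exists>y\<in>?G. ?h y \<le> 1"
  proof (rule ccontr)
    assume "\<not> ?thesis"
    then have "\<forall>y\<in>?G. 1 < ?h y" by (meson not_le)
    then have "(\<Sum>y\<in>?G. 1) < (\<Sum>y\<in>?G. ?h y)"
      using G_ne finite_hypercube by (intro sum_strict_mono) auto
    moreover have "\<mu>0 * (\<Sum>y\<in>?G. ?h y) \<le> \<mu>0 * t"
    proof -
      have "\<mu>0 * (\<Sum>y\<in>?G. ?h y) = (\<Sum>y\<in>?G. inv_measure n r \<tau> y * ?h y)"
        by (simp add: sum_distrib_left \<mu>G)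
      also have "\<dots> \<le> (\<Sum>y\<in>hypercube n. inv_measure n r \<tau> y * ?h y)"
      proof (rule sum_mono2[OF finite_hypercube])
        fix z assume "z \<in> hypercube n - ?G"
        then have z: "z \<in> hypercube n" by simp
        show "0 \<le> inv_measure n r \<tau> z * ?h z"
          using \<mu>_pos[OF z] green_nonneg[OF z x] by simp
      qed simp
      also have "\<dots> = \<mu>0 * t"
        using sum_green[OF x t(1)] \<mu>x by simp
      finally show ?thesis .
    qed
    then have "(\<Sum>y\<in>?G. ?h y) \<le> t" using \<mu>0_pos by simp
    moreover have "t \<le> real (card ?G)"
    proof -
      have "t \<le> real (2 ^ (n - 1))" using t(2) by (simp only: of_nat_power of_nat_numeral)
      also have "\<dots> \<le> real (card ?G)" using cG by (simp only: of_nat_le_iff)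
      finally show ?thesis .
    qed
    ultimately show False by simp
  qed
  then obtain y where y: "y \<in> ?G" "?h y \<le> 1" by blast
  let ?p = "interpolate x y"
  have yc: "y \<in> hypercube n" using y by simp
  \<comment> \<open>Both endpoints are at least 1/r, so the edge has conductance at least
    \<open>\<mu>0 / (n * r)\<close>; dividing the energy bound by this cancels \<mu>0.\<close>
  have step: "\<bar>?h (?p i) - ?h (?p (Suc i))\<bar> \<le> sqrt (n * r * ?h x)" if i: "i < n" for i
  proof (cases "?p i = ?p (Suc i)")
    case True
    then show ?thesis using hx r_pos by simp
  next
    case False
    then have adj: "adjacent n (?p i) (?p (Suc i))"
      using interpolate_step[OF x yc i] by blast
    have "\<mu>0 / (n * r) = (1 / r) / (n * r * Z)"
      by (simp add: \<mu>0_def)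
    also have "\<dots> \<le> min (\<tau> (?p (Suc i))) (\<tau> (?p i)) / (n * r * Z)"
      using high[OF y(1), of i] high[OF y(1), of "Suc i"] i n_pos r_pos Z_pos
      by (intro divide_right_mono) auto
    also have "\<dots> = inv_measure n r \<tau> (?p i) * jump_rate n r \<tau> (?p i) (?p (Suc i))"
      using adj by (simp add: conductance)
    finally have "\<mu>0 / (n * r) * (?h (?p i) - ?h (?p (Suc i)))\<^sup>2
      \<le> inv_measure n r \<tau> (?p i) * jump_rate n r \<tau> (?p i) (?p (Suc i)) * (?h (?p i) - ?h (?p (Suc i)))\<^sup>2"
      by (rule mult_right_mono) simp
    also have "\<dots> \<le> \<mu>0 * ?h x"
      using green_edge_bound[OF x interpolate_in_hypercube[OF x yc] interpolate_in_hypercube[OF x yc] t(1)] \<mu>x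
      by simp
    finally have "(?h (?p i) - ?h (?p (Suc i)))\<^sup>2 \<le> n * r * ?h x"
      using \<mu>0_pos n_pos r_pos by (simp add: field_simps)
    then show ?thesis
      by (rule real_le_rsqrt[OF order_trans[OF eq_refl[OF power2_abs]]])
  qed
  have "?h x - ?h y = (\<Sum>i<n. ?h (?p i) - ?h (?p (Suc i)))"
    using sum_lessThan_telescope'[of "\<lambda>i. ?h (?p i)" n] interpolate_0[OF x yc] interpolate_n[OF x yc]
    by simp
  also have "\<dots> \<le> (\<Sum>i<n. sqrt (n * r * ?h x))"
    using step by (intro sum_mono) (use abs_le_D1 in auto)
  finally have 1: "?h x \<le> 1 + n * sqrt (n * r * ?h x)"
    using y(2) by simp
  \<comment> \<open>The preceding inequality bounds \<open>?h x\<close> by its own square root; this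
    splitting lets half of \<open>?h x\<close> be absorbed on the left.\<close>
  have "2 * (n * sqrt (n * r) * sqrt (?h x)) \<le> (n * sqrt (n * r))\<^sup>2 + (sqrt (?h x))\<^sup>2"
    using sum_squares_bound[of "n * sqrt (n * r)" "sqrt (?h x)"] by simp
  moreover have "(n * sqrt (n * r))\<^sup>2 = real n ^ 3 * r"
    using r_pos by (simp add: power_mult_distrib power2_eq_square power3_eq_cube)
  ultimately show ?thesis
    using 1 hx r_pos by (simp add: real_sqrt_mult mult_ac)
qed

text \<open>Each cluster site weighs at most \<mu>0 and has at most \<open>n\<close> boundary edges,
  each ending below \<open>r\<close> and hence of conductance at most \<open>\<mu>0 * r / n\<close>.
  The condition \<open>1 \<le> t * r\<close> absorbs the initial mass of the cluster into the flow
  term.\<close>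

lemma hitting_bound:
  assumes x: "x \<in> hypercube n" and t: "1 \<le> t * r"
  shows "prob {v \<in> space P. 0 < local_time Y x t v} \<le> 2 * card (cluster n r \<tau> x) * (t * r * \<mu>0)"
proof -
  let ?C = "cluster n r \<tau> x"
  have t0: "0 < t" using t r_pos by (metis less_le_trans zero_less_mult_pos2 zero_less_one)
  have C: "?C \<subseteq> hypercube n" by (rule cluster_subset[OF x])
  have "(\<Sum>z\<in>?C. inv_measure n r \<tau> z) \<le> (\<Sum>z\<in>?C. \<mu>0)"
  proof (rule sum_mono)
    fix z
    have "min (1 / r) (\<tau> z) / Z \<le> (1 / r) / Z"
      using Z_pos by (intro divide_right_mono) auto
    then show "inv_measure n r \<tau> z \<le> \<mu>0" by (simp add: inv_measure_eq \<mu>0_def)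
  qed
  then have 1: "(\<Sum>z\<in>?C. inv_measure n r \<tau> z) \<le> card ?C * \<mu>0" by simp
  have "(\<Sum>u\<in>hypercube n - ?C. \<Sum>z\<in>?C. inv_measure n r \<tau> u * jump_rate n r \<tau> u z)
      = (\<Sum>z\<in>?C. \<Sum>u\<in>hypercube n - ?C. inv_measure n r \<tau> u * jump_rate n r \<tau> u z)"
    by (rule sum.swap)
  also have "\<dots> \<le> (\<Sum>z\<in>?C. r * \<mu>0)"
  proof (rule sum_mono)
    fix z assume z: "z \<in> ?C"
    let ?N = "{u. adjacent n z u}"
    have "(\<Sum>u\<in>hypercube n - ?C. inv_measure n r \<tau> u * jump_rate n r \<tau> u z)
        \<le> (\<Sum>u\<in>hypercube n - ?C. if u \<in> ?N then \<mu>0 * r / n else 0)"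
    proof (rule sum_mono)
      fix u assume u: "u \<in> hypercube n - ?C"
      show "inv_measure n r \<tau> u * jump_rate n r \<tau> u z \<le> (if u \<in> ?N then \<mu>0 * r / n else 0)"
      proof (cases "adjacent n z u")
        case True
        then have "\<tau> u < r" using cluster_boundary[OF z, of u] u by auto
        then have "min (\<tau> z) (\<tau> u) / (n * r * Z) \<le> r / (n * r * Z)"
          using n_pos r_pos Z_pos by (intro divide_right_mono) auto
        then show ?thesis
          using True adjacent_sym[of n u z] r_pos by (simp add: conductance \<mu>0_def field_simps)
      qed (use adjacent_sym[of n u z] in \<open>simp add: conductance\<close>)
    qed
    also have "\<dots> = (\<Sum>u\<in>(hypercube n - ?C) \<inter> ?N. \<mu>0 * r / n)"
      using finite_hypercube by (subst sum.inter_restrict) auto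
    also have "\<dots> = card ((hypercube n - ?C) \<inter> ?N) * (\<mu>0 * r / n)" by simp
    also have "\<dots> \<le> n * (\<mu>0 * r / n)"
    proof (rule mult_right_mono)
      have "card ((hypercube n - ?C) \<inter> ?N) \<le> card ?N"
        using finite_adjacent by (intro card_mono) auto
      then show "real (card ((hypercube n - ?C) \<inter> ?N)) \<le> real n"
        using card_adjacent_le[of n z] by linarith
    qed (use \<mu>0_pos r_pos in auto)
    finally show "(\<Sum>u\<in>hypercube n - ?C. inv_measure n r \<tau> u * jump_rate n r \<tau> u z) \<le> r * \<mu>0"
      using n_pos by (simp add: mult.commute)
  qed
  also have "\<dots> = card ?C * (r * \<mu>0)" by simp
  finally have 2: "t * (\<Sum>u\<in>hypercube n - ?C. \<Sum>z\<in>?C. inv_measure n r \<tau> u * jump_rate n r \<tau> u z)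
      \<le> t * (card ?C * (r * \<mu>0))"
    using t0 by (intro mult_left_mono) auto
  have 3: "card ?C * \<mu>0 * 1 \<le> card ?C * \<mu>0 * (t * r)"
    using t \<mu>0_pos by (intro mult_left_mono) auto
  show ?thesis
    using hitting_prob[OF cluster_refl C t0] 1 2 3 by (simp add: mult_ac)
qed

end

section \<open>Moments of F along local times\<close>

lemma F_fun_eq:
  assumes "0 < x"
  shows "F_fun \<beta> \<epsilon> n c x = x powr alpha_n \<beta> n c * exp (- (ln x)\<^sup>2 / (2 * real n * \<beta>\<^sup>2)) *
    inverse (1 - ln x / (real n * \<beta> * beta_c \<epsilon>))"
  using assms
  by (simp add: F_fun_def powr_def left_diff_distrib exp_diff exp_minus field_simps power2_eq_square)

text \<open>The bound on \<open>ln \<theta>\<close> keeps \<open>ln x\<close> below half of the pole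
  of the last factor, which is therefore at most 2; the Gaussian factor is at most 1.\<close>

lemma F_fun_bounds:
  assumes pos: "0 < n" "0 < \<beta>" "0 < beta_c \<epsilon>" and x: "0 \<le> x" "x \<le> \<theta>"
    and \<theta>: "ln \<theta> \<le> n * \<beta> * beta_c \<epsilon> / 2"
  shows "0 \<le> F_fun \<beta> \<epsilon> n c x" "F_fun \<beta> \<epsilon> n c x \<le> 2 * x powr alpha_n \<beta> n c"
proof -
  have "0 \<le> F_fun \<beta> \<epsilon> n c x \<and> F_fun \<beta> \<epsilon> n c x \<le> 2 * x powr alpha_n \<beta> n c"
  proof (cases "x = 0")
    case True
    then show ?thesis by (simp add: F_fun_def)
  next
    case False
    then have x0: "0 < x" using x by simp
    let ?D = "1 - ln x / (real n * \<beta> * beta_c \<epsilon>)"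
    let ?E = "exp (- (ln x)\<^sup>2 / (2 * real n * \<beta>\<^sup>2))"
    have "ln x \<le> n * \<beta> * beta_c \<epsilon> / 2"
      using x x0 \<theta> by (meson ln_le_cancel_iff order_trans less_le_trans)
    then have D: "1 / 2 \<le> ?D" using pos by (simp add: field_simps)
    have iD: "0 \<le> inverse ?D"
      using D by (intro inverse_nonnegative_iff_nonnegative[THEN iffD2]) linarith
    have iD2: "inverse ?D \<le> 2"
      using le_imp_inverse_le[OF D] by simp
    have E: "0 \<le> ?E" "?E \<le> 1" by auto
    have "x powr alpha_n \<beta> n c * (?E * inverse ?D) \<le> x powr alpha_n \<beta> n c * (1 * 2)"
      using E iD iD2 by (intro mult_left_mono mult_mono) auto
    then show ?thesis
      using iD E by (simp add: F_fun_eq[OF x0] mult_ac)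
  qed
  then show "0 \<le> F_fun \<beta> \<epsilon> n c x" "F_fun \<beta> \<epsilon> n c x \<le> 2 * x powr alpha_n \<beta> n c" by auto
qed

text \<open>As the exponent is at most 1, x^(\<alpha> - 1) is smallest at \<open>x = L\<close>. The
  window bounds \<open>ln x\<close> in absolute value by \<open>ln L\<close>, which controls the
  Gaussian factor; it also keeps the denominator below 2, the origin of the factor 1/2.\<close>

lemma F_fun_ge_linear:
  assumes pos: "0 < n" "0 < \<beta>" "0 < beta_c \<epsilon>" and L: "1 \<le> L" "ln L \<le> n * \<beta> * beta_c \<epsilon> / 2"
    and x: "1 / L \<le> x" "x \<le> L" and a: "alpha_n \<beta> n c \<le> 1"
  shows "L powr (alpha_n \<beta> n c - 1) * exp (- (ln L)\<^sup>2 / (2 * real n * \<beta>\<^sup>2)) / 2 * x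
    \<le> F_fun \<beta> \<epsilon> n c x"
proof -
  let ?a = "alpha_n \<beta> n c"
  have x0: "0 < x" using x L by (meson less_le_trans zero_less_divide_1_iff zero_less_one)
  have "ln (1 / L) \<le> ln x" using x x0 L by (subst ln_le_cancel_iff) auto
  then have lx: "- ln L \<le> ln x" using L by (simp add: ln_div)
  have ux: "ln x \<le> ln L" using x x0 by simp
  let ?D = "1 - ln x / (real n * \<beta> * beta_c \<epsilon>)"
  have D: "1 / 2 \<le> ?D" "?D \<le> 2"
    using pos lx ux L by (simp_all add: field_simps)
  then have iD: "1 / 2 \<le> inverse ?D"
  proof -
    have "0 < ?D" using D(1) by linarith
    then show ?thesis using le_imp_inverse_le[OF D(2)] by simp
  qed
  have "(ln x)\<^sup>2 \<le> (ln L)\<^sup>2"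
    using lx ux by (intro power2_le_iff_abs_le[THEN iffD2]) auto
  then have E: "exp (- (ln L)\<^sup>2 / (2 * real n * \<beta>\<^sup>2)) \<le> exp (- (ln x)\<^sup>2 / (2 * real n * \<beta>\<^sup>2))"
    using pos by (simp add: divide_right_mono)
  have "L powr (?a - 1) \<le> x powr (?a - 1)"
    using x x0 a by (intro powr_mono2') auto
  then have "x * L powr (?a - 1) \<le> x * x powr (?a - 1)" using x0 by simp
  also have "\<dots> = x powr ?a" using x0 by (simp add: powr_diff)
  finally have "x * L powr (?a - 1) * exp (- (ln L)\<^sup>2 / (2 * real n * \<beta>\<^sup>2)) * (1 / 2)
      \<le> x powr ?a * exp (- (ln x)\<^sup>2 / (2 * real n * \<beta>\<^sup>2)) * inverse ?D"
    using E iD x0 by (intro mult_mono) auto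
  then show ?thesis by (simp add: F_fun_eq[OF x0] mult_ac)
qed

lemma F_fun_measurable [measurable]: "F_fun \<beta> \<epsilon> n c \<in> borel_measurable borel"
  unfolding F_fun_def[abs_def] by measurable

text \<open>Constant bound up to the scale \<open>s\<close>, linear bound beyond it. Keeping the
  indicator of \<open>0 < x\<close> turns the constant into a hitting probability after integration;
  without it the rarity of visits would be lost.\<close>

lemma powr_le_interpolation:
  fixes x s a :: real
  assumes "0 \<le> x" "0 < s" "0 \<le> a" "a \<le> 1"
  shows "x powr a \<le> s powr a * (if 0 < x then 1 else 0) + s powr (a - 1) * x"
proof -
  consider "x = 0" | "0 < x" "x \<le> s" | "s < x" using assms by linarith
  then show ?thesis
  proof cases
    case 2
    then have "x powr a \<le> s powr a" using assms by (intro powr_mono2) auto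
    then show ?thesis using 2 by (simp add: add_increasing2)
  next
    case 3
    have "x powr (a - 1) \<le> s powr (a - 1)" using assms 3 by (intro powr_mono2') auto
    then have "x powr (a - 1) * x \<le> s powr (a - 1) * x" using assms by (intro mult_right_mono) auto
    moreover have "x powr (a - 1) * x = x powr a" using assms 3 by (simp add: powr_diff)
    ultimately show ?thesis using assms by (simp add: add_increasing)
  qed simp
qed

locale exploration_F = exploration_process +
  fixes \<beta> \<epsilon> c \<theta> :: real
  assumes \<beta>_pos: "0 < \<beta>" and \<beta>c_pos: "0 < beta_c \<epsilon>" and \<theta>_pos: "0 < \<theta>"
    and \<theta>_small: "ln \<theta> \<le> n * \<beta> * beta_c \<epsilon> / 2" and \<theta>r: "1 \<le> \<theta> * r"
    and \<alpha>_ge: "0 \<le> alpha_n \<beta> n c" and \<alpha>_le: "alpha_n \<beta> n c \<le> 1"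
begin

abbreviation F where "F \<equiv> F_fun \<beta> \<epsilon> n c"

abbreviation \<alpha> where "\<alpha> \<equiv> alpha_n \<beta> n c"

abbreviation lt where "lt x v \<equiv> local_time Y x \<theta> v"

lemma F_lt_bounds:
  assumes "v \<in> space P"
  shows "0 \<le> F (lt x v)" "F (lt x v) \<le> 2 * lt x v powr \<alpha>"
  using F_fun_bounds[OF n_pos \<beta>_pos \<beta>c_pos local_time_nonneg local_time_le[OF assms] \<theta>_small]
    \<theta>_pos by auto

lemma integrable_F: "integrable P (\<lambda>v. F (lt x v))"
proof (rule integrable_const_bound[where B = "2 * \<theta> powr \<alpha>"])
  show "(\<lambda>v. F (lt x v)) \<in> borel_measurable P"
    by (rule measurable_compose[OF local_time_measurable F_fun_measurable])
  show "AE v in P. norm (F (lt x v)) \<le> 2 * \<theta> powr \<alpha>"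
  proof (rule AE_I2)
    fix v assume v: "v \<in> space P"
    have "lt x v powr \<alpha> \<le> \<theta> powr \<alpha>"
      using v \<theta>_pos \<alpha>_ge by (intro powr_mono2 local_time_nonneg local_time_le) auto
    then show "norm (F (lt x v)) \<le> 2 * \<theta> powr \<alpha>"
      using F_lt_bounds[OF v, of x] by simp
  qed
qed

lemma sets_lt_pos: "{v \<in> space P. 0 < lt x v} \<in> sets P"
  using local_time_measurable[of x \<theta>] by measurable

text \<open>At the interpolation scale 1/r the hitting term and the mean term both have order r^(1 -
  \<alpha>) \<theta> \<mu>0, up to the cluster size. With \<open>C\<close> that size, the constant
  is 2 (2 C + 1) \<le> 6 C.\<close>

lemma expectation_F_upper:
  assumes x: "x \<in> hypercube n" and high: "1 / r \<le> \<tau> x"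
  shows "expectation (\<lambda>v. F (lt x v))
    \<le> 6 * card (cluster n r \<tau> x) * r powr (1 - \<alpha>) * (\<theta> * \<mu>0)"
proof -
  let ?A = "{v \<in> space P. 0 < lt x v}"
  let ?C = "real (card (cluster n r \<tau> x))"
  let ?g = "\<lambda>v. 2 * ((1 / r) powr \<alpha> * indicator ?A v + (1 / r) powr (\<alpha> - 1) * lt x v)"
  have int: "integrable P (\<lambda>v. indicator ?A v :: real)" "integrable P (lt x)"
    using sets_lt_pos integrable_local_time[of \<theta> x] \<theta>_pos by (auto intro!: integrable_real_indicator simp: emeasure_eq_measure)
  have "expectation (\<lambda>v. F (lt x v)) \<le> expectation ?g"
  proof (rule integral_mono[OF integrable_F])
    show "integrable P ?g" using int by simp
    fix v assume v: "v \<in> space P"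
    have "F (lt x v) \<le> 2 * lt x v powr \<alpha>" using F_lt_bounds[OF v] by simp
    also have "\<dots> \<le> ?g v"
      using powr_le_interpolation[OF local_time_nonneg _ \<alpha>_ge \<alpha>_le, of "1 / r" x \<theta> v] r_pos v
      by (auto simp: indicator_def)
    finally show "F (lt x v) \<le> ?g v" .
  qed
  also have "expectation ?g = 2 * ((1 / r) powr \<alpha> * prob ?A + (1 / r) powr (\<alpha> - 1) * (\<theta> * \<mu>0))"
    using int x \<theta>_pos high sets_lt_pos
    by (simp add: expectation_local_time inv_measure_high Int_absorb2[OF sets.sets_into_space])
  also have "(1 / r) powr (\<alpha> - 1) = r powr (1 - \<alpha>)"
    using r_pos by (simp add: powr_divide powr_minus_divide[symmetric])
  also have "(1 / r) powr \<alpha> * prob ?A \<le> (1 / r) powr \<alpha> * (2 * ?C * (\<theta> * r * \<mu>0))"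
    using hitting_bound[OF x \<theta>r] by (intro mult_left_mono) auto
  also have "(1 / r) powr \<alpha> * (2 * ?C * (\<theta> * r * \<mu>0)) = 2 * ?C * r powr (1 - \<alpha>) * (\<theta> * \<mu>0)"
    using r_pos by (simp add: powr_divide powr_diff)
  finally have "expectation (\<lambda>v. F (lt x v))
    \<le> 4 * ?C * r powr (1 - \<alpha>) * (\<theta> * \<mu>0) + 2 * (1 * (r powr (1 - \<alpha>) * (\<theta> * \<mu>0)))"
    by simp
  also have "1 * (r powr (1 - \<alpha>) * (\<theta> * \<mu>0)) \<le> ?C * (r powr (1 - \<alpha>) * (\<theta> * \<mu>0))"
  proof (rule mult_right_mono)
    have "finite (cluster n r \<tau> x)"
      using cluster_subset[OF x] finite_hypercube finite_subset by blast
    then have "card (cluster n r \<tau> x) \<noteq> 0"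
      using cluster_refl[of x n r \<tau>] by (metis card_eq_0_iff empty_iff)
    then show "1 \<le> ?C" by simp
  qed (use \<mu>0_pos \<theta>_pos in simp)
  finally show ?thesis by (simp add: mult_ac)
qed

text \<open>The quadratic and the constant term discard the values of the local time outside \<open>[1 / L, L]\<close>,
  where \<open>F\<close> need not dominate a linear function.\<close>

lemma expectation_F_lower:
  assumes x: "x \<in> hypercube n" and high: "1 / r \<le> \<tau> x"
    and L: "1 \<le> L" "ln L \<le> n * \<beta> * beta_c \<epsilon> / 2"
    and gr: "4 * green \<theta> x x \<le> L" and cl: "8 * card (cluster n r \<tau> x) * r \<le> L"
  shows "L powr (\<alpha> - 1) * exp (- (ln L)\<^sup>2 / (2 * real n * \<beta>\<^sup>2)) / 8 * (\<theta> * \<mu>0)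
    \<le> expectation (\<lambda>v. F (lt x v))"
proof -
  let ?A = "{v \<in> space P. 0 < lt x v}"
  let ?C = "real (card (cluster n r \<tau> x))"
  define \<kappa> where "\<kappa> = L powr (\<alpha> - 1) * exp (- (ln L)\<^sup>2 / (2 * real n * \<beta>\<^sup>2)) / 2"
  have \<kappa>: "0 \<le> \<kappa>" by (simp add: \<kappa>_def)
  let ?g = "\<lambda>v. \<kappa> * (lt x v - (lt x v)\<^sup>2 / L - indicator ?A v / L)"
  have sq: "integrable P (\<lambda>v. (lt x v)\<^sup>2)"
  proof (rule integrable_const_bound[where B = "\<theta>\<^sup>2"])
    show "(\<lambda>v. (lt x v)\<^sup>2) \<in> borel_measurable P"
      using local_time_measurable[of x \<theta>] by measurable
    show "AE v in P. norm ((lt x v)\<^sup>2) \<le> \<theta>\<^sup>2"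
      using \<theta>_pos local_time_le local_time_nonneg by (auto intro!: AE_I2 power_mono)
  qed
  have int: "integrable P (\<lambda>v. indicator ?A v :: real)" "integrable P (lt x)"
    using sets_lt_pos integrable_local_time[of \<theta> x] \<theta>_pos by (auto intro!: integrable_real_indicator simp: emeasure_eq_measure)
  \<comment> \<open>The large values cost at most half of the mean \<open>\<theta> * \<mu>0\<close>
    and the small ones at most a quarter; a quarter survives.\<close>
  have "\<kappa> / 4 * (\<theta> * \<mu>0) \<le> \<kappa> * (\<theta> * \<mu>0 - expectation (\<lambda>v. (lt x v)\<^sup>2) / L - prob ?A / L)"
  proof -
    have "expectation (\<lambda>v. (lt x v)\<^sup>2) \<le> 2 * \<theta> * \<mu>0 * green \<theta> x x"
      using expectation_local_time_sq[OF x, of \<theta>] \<theta>_pos high by (simp add: inv_measure_high)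
    also have "\<dots> = \<theta> * \<mu>0 / 2 * (4 * green \<theta> x x)" by simp
    also have "\<dots> \<le> \<theta> * \<mu>0 / 2 * L"
      using gr \<theta>_pos \<mu>0_pos by (intro mult_left_mono) auto
    finally have 1: "expectation (\<lambda>v. (lt x v)\<^sup>2) / L \<le> \<theta> * \<mu>0 / 2"
      using L by (simp add: field_simps)
    have "prob ?A \<le> 2 * ?C * (\<theta> * r * \<mu>0)"
      using hitting_bound[OF x \<theta>r] by simp
    also have "\<dots> = \<theta> * \<mu>0 / 4 * (8 * ?C * r)" by simp
    also have "\<dots> \<le> \<theta> * \<mu>0 / 4 * L"
      using cl \<theta>_pos \<mu>0_pos by (intro mult_left_mono) auto
    finally have 2: "prob ?A / L \<le> \<theta> * \<mu>0 / 4"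
      using L by (simp add: field_simps)
    have "\<kappa> * (\<theta> * \<mu>0 / 4) \<le> \<kappa> * (\<theta> * \<mu>0 - expectation (\<lambda>v. (lt x v)\<^sup>2) / L - prob ?A / L)"
      using 1 2 \<kappa> by (intro mult_left_mono) auto
    then show ?thesis by simp
  qed
  also have "\<dots> = expectation ?g"
    using int sq x \<theta>_pos high sets_lt_pos
    by (simp add: expectation_local_time inv_measure_high Int_absorb2[OF sets.sets_into_space])
  also have "\<dots> \<le> expectation (\<lambda>v. F (lt x v))"
  proof (rule integral_mono[OF _ integrable_F])
    show "integrable P ?g" using int sq by simp
    fix v assume v: "v \<in> space P"
    have F0: "0 \<le> F (lt x v)" using F_lt_bounds[OF v] by simp
    \<comment> \<open>Below \<open>1 / L\<close> the constant term makes \<open>?g\<close>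
      nonpositive, above \<open>L\<close> the quadratic term does; inside the window
      \<open>?g\<close> is at most linear.\<close>
    consider "lt x v = 0" | "0 < lt x v" "lt x v < 1 / L" | "1 / L \<le> lt x v" "lt x v \<le> L" | "L < lt x v"
      using local_time_nonneg[of x \<theta> v] by linarith
    then show "?g v \<le> F (lt x v)"
    proof cases
      case 1
      then show ?thesis using F0 by simp
    next
      case 2
      have "0 \<le> (lt x v)\<^sup>2 / L" using L by simp
      then have "lt x v - (lt x v)\<^sup>2 / L - indicator ?A v / L \<le> 0"
        using 2 v by simp
      then show ?thesis using \<kappa> F0 by (meson mult_nonneg_nonpos order_trans)
    next
      case 3
      have "?g v \<le> \<kappa> * lt x v"
      proof (rule mult_left_mono[OF _ \<kappa>])
        have "0 \<le> (lt x v)\<^sup>2 / L" "0 \<le> indicator ?A v / L" using L by simp_all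
        then show "lt x v - (lt x v)\<^sup>2 / L - indicator ?A v / L \<le> lt x v" by linarith
      qed
      also have "\<dots> \<le> F (lt x v)"
        unfolding \<kappa>_def using F_fun_ge_linear[OF n_pos \<beta>_pos \<beta>c_pos L 3 \<alpha>_le] .
      finally show ?thesis .
    next
      case 4
      have "L * lt x v \<le> (lt x v)\<^sup>2" using 4 L by (simp add: power2_eq_square)
      then have "lt x v \<le> (lt x v)\<^sup>2 / L" using L by (simp add: field_simps)
      moreover have "0 \<le> indicator ?A v / L" using L by simp
      ultimately have "lt x v - (lt x v)\<^sup>2 / L - indicator ?A v / L \<le> 0" by linarith
      then show ?thesis using \<kappa> F0 by (meson mult_nonneg_nonpos order_trans)
    qed
  qed
  finally show ?thesis by (simp add: \<kappa>_def)
qed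

abbreviation T where "T \<equiv> top_set n c \<theta> \<tau>"

abbreviation b where "b \<equiv> b_fun \<beta> \<epsilon> n r c \<theta> \<tau> P Y"

lemma T_subset: "T \<subseteq> hypercube n"
  by (auto simp: top_set_def)

lemma finite_T: "finite T"
  using finite_subset[OF T_subset finite_hypercube] .

lemma b_eq:
  assumes "\<And>x. x \<in> T \<Longrightarrow> 1 / r \<le> \<tau> x"
  shows "b = (\<Sum>x\<in>T. expectation (\<lambda>v. F (lt x v))) / (card T * (\<theta> * \<mu>0))"
proof -
  have "(\<Sum>x\<in>T. inv_measure n r \<tau> x) = card T * \<mu>0"
    using assms inv_measure_high by simp
  then show ?thesis
    unfolding b_fun_def by (simp add: divide_inverse mult_ac)
qed

lemma b_upper:
  fixes K :: real
  assumes high: "\<And>x. x \<in> T \<Longrightarrow> 1 / r \<le> \<tau> x" and ne: "T \<noteq> {}"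
    and cl: "(\<Sum>x\<in>T. real (card (cluster n r \<tau> x))) \<le> K * card T"
  shows "b \<le> 6 * K * r powr (1 - \<alpha>)"
proof -
  have cT: "0 < card T" using ne finite_T by (simp add: card_gt_0_iff)
  have "(\<Sum>x\<in>T. expectation (\<lambda>v. F (lt x v)))
      \<le> (\<Sum>x\<in>T. 6 * card (cluster n r \<tau> x) * r powr (1 - \<alpha>) * (\<theta> * \<mu>0))"
    using T_subset by (intro sum_mono expectation_F_upper high) auto
  also have "\<dots> = (\<Sum>x\<in>T. real (card (cluster n r \<tau> x))) * (6 * r powr (1 - \<alpha>) * (\<theta> * \<mu>0))"
    by (simp add: sum_distrib_left mult_ac)
  also have "\<dots> \<le> (K * card T) * (6 * r powr (1 - \<alpha>) * (\<theta> * \<mu>0))"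
    using cl \<theta>_pos \<mu>0_pos by (intro mult_right_mono) auto
  finally have "(\<Sum>x\<in>T. expectation (\<lambda>v. F (lt x v)))
      \<le> 6 * K * r powr (1 - \<alpha>) * (card T * (\<theta> * \<mu>0))"
    by (simp add: mult_ac)
  moreover have "b = (\<Sum>x\<in>T. expectation (\<lambda>v. F (lt x v))) / (card T * (\<theta> * \<mu>0))"
    by (rule b_eq) (rule high)
  ultimately show ?thesis
    using cT \<theta>_pos \<mu>0_pos by (simp add: pos_divide_le_eq)
qed

text \<open>Sites outside \<open>T'\<close> contribute nonnegatively and may be dropped. Since
  \<open>T'\<close> holds at least half of \<open>T\<close>, the average loses only a factor 2,
  hence 16 instead of 8.\<close>

lemma b_lower:
  assumes high: "\<And>x. x \<in> T \<Longrightarrow> 1 / r \<le> \<tau> x" and ne: "T \<noteq> {}"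
    and L: "1 \<le> L" "ln L \<le> n * \<beta> * beta_c \<epsilon> / 2"
    and T': "T' \<subseteq> T" "card T \<le> 2 * card T'"
    and gr: "\<And>x. x \<in> T' \<Longrightarrow> 4 * green \<theta> x x \<le> L"
    and cl: "\<And>x. x \<in> T' \<Longrightarrow> 8 * card (cluster n r \<tau> x) * r \<le> L"
  shows "L powr (\<alpha> - 1) * exp (- (ln L)\<^sup>2 / (2 * real n * \<beta>\<^sup>2)) / 16 \<le> b"
proof -
  let ?k = "L powr (\<alpha> - 1) * exp (- (ln L)\<^sup>2 / (2 * real n * \<beta>\<^sup>2)) / 8"
  have cT: "0 < card T" using ne finite_T by (simp add: card_gt_0_iff)
  have "card T * (?k / 2 * (\<theta> * \<mu>0)) \<le> (2 * card T') * (?k / 2 * (\<theta> * \<mu>0))"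
    using T'(2) \<theta>_pos \<mu>0_pos by (intro mult_right_mono) auto
  also have "\<dots> = (\<Sum>x\<in>T'. ?k * (\<theta> * \<mu>0))" by simp
  also have "\<dots> \<le> (\<Sum>x\<in>T'. expectation (\<lambda>v. F (lt x v)))"
    using T'(1) T_subset by (intro sum_mono expectation_F_lower high L gr cl) auto
  also have "\<dots> \<le> (\<Sum>x\<in>T. expectation (\<lambda>v. F (lt x v)))"
    using T'(1) F_lt_bounds
    by (intro sum_mono2 finite_T Bochner_Integration.integral_nonneg_AE) auto
  finally have "?k / 2 * (card T * (\<theta> * \<mu>0)) \<le> (\<Sum>x\<in>T. expectation (\<lambda>v. F (lt x v)))"
    by (simp add: mult_ac)
  moreover have "b = (\<Sum>x\<in>T. expectation (\<lambda>v. F (lt x v))) / (card T * (\<theta> * \<mu>0))"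
    by (rule b_eq) (rule high)
  ultimately have "?k / 2 \<le> b"
    using cT \<theta>_pos \<mu>0_pos by (simp add: pos_le_divide_eq)
  then show ?thesis by simp
qed

end

section \<open>Gaussian tails and the random landscape\<close>

lemma (in prob_space) normal_tail:
  assumes X: "distributed M lborel X (normal_density 0 \<sigma>)"
  shows "emeasure M {w \<in> space M. s \<le> X w}
    = (\<integral>\<^sup>+y. ennreal (normal_density 0 \<sigma> y) * indicator {s..} y \<partial>lborel)"
proof -
  have "{w \<in> space M. s \<le> X w} = X -` {s..} \<inter> space M" by auto
  then show ?thesis using distributed_emeasure[OF X, of "{s..}"] by simp
qed

lemma (in prob_space) normal_tail_symmetric:
  assumes X: "distributed M lborel X (normal_density 0 \<sigma>)"
  shows "prob {w \<in> space M. X w \<le> - s} = prob {w \<in> space M. s \<le> X w}"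
proof -
  have "{w \<in> space M. X w \<le> - s} = X -` {..- s} \<inter> space M" by auto
  then have "emeasure M {w \<in> space M. X w \<le> - s}
      = (\<integral>\<^sup>+y. ennreal (normal_density 0 \<sigma> y) * indicator {..- s} y \<partial>lborel)"
    using distributed_emeasure[OF X, of "{..- s}"] by simp
  also have "\<dots> = (\<integral>\<^sup>+y. ennreal (normal_density 0 \<sigma> (- y)) * indicator {..- s} (- y) \<partial>lborel)"
    by (subst nn_integral_real_affine[of _ "-1" 0]) auto
  also have "\<dots> = (\<integral>\<^sup>+y. ennreal (normal_density 0 \<sigma> y) * indicator {s..} y \<partial>lborel)"
    by (intro nn_integral_cong) (auto simp: normal_density_def indicator_def)
  finally show ?thesis
    using normal_tail[OF X, of s] by (simp add: measure_def)
qed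

text \<open>After a shift by \<open>s\<close>, the inequality (s + y)^2 \<ge> s^2 + y^2 for
  nonnegative \<open>s\<close>, \<open>y\<close> splits off the exponential and leaves a total mass
  of 1.\<close>

lemma (in prob_space) normal_tail_upper:
  assumes X: "distributed M lborel X (normal_density 0 \<sigma>)" and \<sigma>: "0 < \<sigma>" and s: "0 \<le> s"
  shows "prob {w \<in> space M. s \<le> X w} \<le> exp (- s\<^sup>2 / (2 * \<sigma>\<^sup>2))"
proof -
  let ?e = "exp (- s\<^sup>2 / (2 * \<sigma>\<^sup>2))"
  have "emeasure M {w \<in> space M. s \<le> X w}
      = (\<integral>\<^sup>+y. ennreal (normal_density 0 \<sigma> (s + y)) * indicator {s..} (s + y) \<partial>lborel)"
    unfolding normal_tail[OF X] by (subst nn_integral_real_affine[of _ 1 s]) auto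
  also have "\<dots> \<le> (\<integral>\<^sup>+y. ennreal ?e * ennreal (normal_density 0 \<sigma> y) \<partial>lborel)"
  proof (intro nn_integral_mono)
    fix y :: real
    show "ennreal (normal_density 0 \<sigma> (s + y)) * indicator {s..} (s + y)
        \<le> ennreal ?e * ennreal (normal_density 0 \<sigma> y)"
    proof (cases "0 \<le> y")
      case True
      have "s\<^sup>2 + y\<^sup>2 \<le> (s + y)\<^sup>2" using True s by (simp add: power2_sum)
      then have "- (s + y)\<^sup>2 / (2 * \<sigma>\<^sup>2) \<le> (- s\<^sup>2 + - y\<^sup>2) / (2 * \<sigma>\<^sup>2)"
        by (intro divide_right_mono) auto
      then have "exp (- (s + y)\<^sup>2 / (2 * \<sigma>\<^sup>2)) \<le> ?e * exp (- y\<^sup>2 / (2 * \<sigma>\<^sup>2))"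
        by (simp add: exp_add[symmetric] diff_divide_distrib)
      then have "normal_density 0 \<sigma> (s + y) \<le> ?e * normal_density 0 \<sigma> y"
        using \<sigma> by (simp add: normal_density_def divide_right_mono)
      then show ?thesis using True by (simp add: ennreal_mult'[symmetric] ennreal_leI)
    qed simp
  qed
  also have "\<dots> = ennreal ?e * (\<integral>\<^sup>+y. ennreal (normal_density 0 \<sigma> y) \<partial>lborel)"
    by (intro nn_integral_cmult) simp
  also have "(\<integral>\<^sup>+y. ennreal (normal_density 0 \<sigma> y) \<partial>lborel) = 1"
    using distributed_emeasure[OF X, of UNIV] emeasure_space_1 by simp
  finally show ?thesis by (simp add: emeasure_eq_measure)
qed

text \<open>On the unit interval to the right of \<open>s\<close> the density is at least its value
  at \<open>s + 1\<close>. The shift by 1 is harmless at the exponential scale where this is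
  used.\<close>

lemma (in prob_space) normal_tail_lower:
  assumes X: "distributed M lborel X (normal_density 0 \<sigma>)" and \<sigma>: "0 < \<sigma>" and s: "0 \<le> s"
  shows "exp (- (s + 1)\<^sup>2 / (2 * \<sigma>\<^sup>2)) / sqrt (2 * pi * \<sigma>\<^sup>2) \<le> prob {w \<in> space M. s \<le> X w}"
proof -
  let ?e = "exp (- (s + 1)\<^sup>2 / (2 * \<sigma>\<^sup>2)) / sqrt (2 * pi * \<sigma>\<^sup>2)"
  have "ennreal ?e = (\<integral>\<^sup>+y. ennreal ?e * indicator {s..s + 1} y \<partial>lborel)"
    by (simp add: nn_integral_cmult_indicator)
  also have "\<dots> \<le> (\<integral>\<^sup>+y. ennreal (normal_density 0 \<sigma> y) * indicator {s..} y \<partial>lborel)"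
  proof (intro nn_integral_mono)
    fix y :: real
    show "ennreal ?e * indicator {s..s + 1} y \<le> ennreal (normal_density 0 \<sigma> y) * indicator {s..} y"
    proof (cases "y \<in> {s..s + 1}")
      case True
      then have "y\<^sup>2 \<le> (s + 1)\<^sup>2" using s by (intro power_mono) auto
      then have "?e \<le> normal_density 0 \<sigma> y"
        unfolding normal_density_def using \<sigma> by (simp add: divide_right_mono)
      then show ?thesis using True by (simp add: ennreal_leI)
    qed simp
  qed
  also have "\<dots> = ennreal (prob {w \<in> space M. s \<le> X w})"
    unfolding normal_tail[OF X, symmetric] by (rule emeasure_eq_measure)
  finally show ?thesis by simp
qed

section \<open>Level probabilities and independence of the landscape\<close>

locale gaussian_landscape =
  fixes M :: "'w measure" and H :: "nat \<Rightarrow> vertex \<Rightarrow> 'w \<Rightarrow> real" and \<beta> :: real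
  assumes env: "gaussian_environment M H" and \<beta>_pos: "0 < \<beta>"
begin

sublocale prob_space M
  using env by (simp add: gaussian_environment_def)

abbreviation \<tau> where "\<tau> n w \<equiv> tau \<beta> H n w"

lemma H_normal:
  "1 < n \<Longrightarrow> x \<in> hypercube n \<Longrightarrow> distributed M lborel (H n x) (normal_density 0 (sqrt (real n)))"
  using env by (simp add: gaussian_environment_def)

lemma H_indep: "1 < n \<Longrightarrow> indep_vars (\<lambda>_. borel) (H n) (hypercube n)"
  using env by (simp add: gaussian_environment_def)

lemma H_measurable: "1 < n \<Longrightarrow> x \<in> hypercube n \<Longrightarrow> H n x \<in> borel_measurable M"
  using H_normal[of n x] by (auto dest: distributed_measurable)

lemma tau_ge_iff: "0 < u \<Longrightarrow> u \<le> \<tau> n w x \<longleftrightarrow> H n x w \<le> - (ln u / \<beta>)"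
proof -
  assume u: "0 < u"
  then have "u \<le> \<tau> n w x \<longleftrightarrow> ln u \<le> - \<beta> * H n x w"
    unfolding tau_def by (metis exp_le_cancel_iff exp_ln)
  then show ?thesis using \<beta>_pos by (auto simp: field_simps)
qed

lemma tail_prob_eq: 
  assumes "1 < n" "x \<in> hypercube n" "0 < u"
  shows "tail_prob M \<beta> H n x u = prob {w \<in> space M. ln u / \<beta> \<le> H n x w}"
  using normal_tail_symmetric[OF H_normal[OF assms(1,2)], of "ln u / \<beta>"] assms(3)
  by (simp add: tail_prob_def tau_ge_iff)

lemma tail_prob_vertex_indep:
  assumes "1 < n" "x \<in> hypercube n" "y \<in> hypercube n" "0 < u"
  shows "tail_prob M \<beta> H n x u = tail_prob M \<beta> H n y u"
  using normal_tail[OF H_normal[OF assms(1,2)], of "ln u / \<beta>"]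
    normal_tail[OF H_normal[OF assms(1,3)], of "ln u / \<beta>"] assms
  by (simp add: tail_prob_eq measure_def)

lemma tail_prob_upper:
  assumes "1 < n" "x \<in> hypercube n" "1 \<le> u"
  shows "tail_prob M \<beta> H n x u \<le> exp (- (ln u / \<beta>)\<^sup>2 / (2 * n))"
  using normal_tail_upper[OF H_normal[OF assms(1,2)], of "ln u / \<beta>"] assms \<beta>_pos
  by (simp add: tail_prob_eq)

lemma tail_prob_lower:
  assumes "1 < n" "x \<in> hypercube n" "1 \<le> u"
  shows "exp (- (ln u / \<beta> + 1)\<^sup>2 / (2 * n)) / sqrt (2 * pi * n) \<le> tail_prob M \<beta> H n x u"
  using normal_tail_lower[OF H_normal[OF assms(1,2)], of "ln u / \<beta>"] assms \<beta>_pos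
  by (simp add: tail_prob_eq)

lemma sets_tau_ge: "1 < n \<Longrightarrow> x \<in> hypercube n \<Longrightarrow> {w \<in> space M. u \<le> \<tau> n w x} \<in> sets M"
  using H_measurable[of n x] unfolding tau_def by measurable

lemma sets_tau_less: "1 < n \<Longrightarrow> x \<in> hypercube n \<Longrightarrow> {w \<in> space M. \<tau> n w x < u} \<in> sets M"
  using H_measurable[of n x] unfolding tau_def by measurable

lemma tail_prob_antimono:
  assumes "1 < n" "x \<in> hypercube n" "u \<le> v"
  shows "tail_prob M \<beta> H n x v \<le> tail_prob M \<beta> H n x u"
  unfolding tail_prob_def using assms sets_tau_ge by (intro finite_measure_mono) auto

text \<open>By symmetry of the field; any level with tail probability below 1/2 must therefore
  exceed 1.\<close>

lemma tail_prob_1: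
  assumes "1 < n" "x \<in> hypercube n"
  shows "1 / 2 \<le> tail_prob M \<beta> H n x 1"
proof -
  let ?A = "{w \<in> space M. H n x w \<le> 0}" and ?B = "{w \<in> space M. 0 \<le> H n x w}"
  have sets: "?A \<in> sets M" "?B \<in> sets M"
    using H_measurable[OF assms] by measurable
  have "space M = ?A \<union> ?B" by auto
  then have "1 \<le> prob ?A + prob ?B"
    using measure_Un_le[OF sets] prob_space by metis
  moreover have "prob ?A = prob ?B"
    using normal_tail_symmetric[OF H_normal[OF assms], of 0] by simp
  ultimately show ?thesis
    using tail_prob_eq[OF assms, of 1] by simp
qed

text \<open>Reflecting the field exchanges \<open>u\<close> with \<open>1 / u\<close>. Thus one tail
  probability governs both the clusters above \<open>r\<close> and the obstructions below
  \<open>1 / r\<close>.\<close>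

lemma prob_tau_small:
  assumes "1 < n" "x \<in> hypercube n" "0 < u"
  shows "prob {w \<in> space M. \<tau> n w x < 1 / u} \<le> tail_prob M \<beta> H n x u"
proof -
  have "\<tau> n w x < 1 / u \<Longrightarrow> ln u / \<beta> \<le> H n x w" for w
  proof -
    assume "\<tau> n w x < 1 / u"
    then have "\<not> 1 / u \<le> \<tau> n w x" by simp
    then show ?thesis
      using assms(3) tau_ge_iff[of "1 / u" n w x] by (simp add: ln_div)
  qed
  then have "{w \<in> space M. \<tau> n w x < 1 / u} \<subseteq> {w \<in> space M. ln u / \<beta> \<le> H n x w}" by auto
  then show ?thesis
    unfolding tail_prob_eq[OF assms]
    using H_measurable[OF assms(1,2)] by (intro finite_measure_mono) measurable
qed

lemma prob_joint:
  assumes "1 < n" "J \<subseteq> hypercube n" "\<And>i. i \<in> J \<Longrightarrow> A i \<in> sets borel"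
  shows "prob {w \<in> space M. \<forall>i\<in>J. H n i w \<in> A i} = (\<Prod>i\<in>J. prob {w \<in> space M. H n i w \<in> A i})"
proof (cases "J = {}")
  case False
  have "finite J" using assms(2) finite_hypercube finite_subset by blast
  then have "prob (\<Inter>i\<in>J. H n i -` A i \<inter> space M) = (\<Prod>i\<in>J. prob (H n i -` A i \<inter> space M))"
    using assms False by (intro indep_varsD[OF H_indep]) auto
  moreover have "(\<Inter>i\<in>J. H n i -` A i \<inter> space M) = {w \<in> space M. \<forall>i\<in>J. H n i w \<in> A i}"
    using False by auto
  moreover have "H n i -` A i \<inter> space M = {w \<in> space M. H n i w \<in> A i}" for i by auto
  ultimately show ?thesis by simp
qed (simp add: prob_space)

lemma prob_joint_tau:
  assumes "1 < n" "x \<in> hypercube n" "J \<subseteq> hypercube n" "x \<notin> J" "B \<in> sets borel"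
  shows "prob {w \<in> space M. a \<le> \<tau> n w x \<and> (\<forall>i\<in>J. \<tau> n w i \<in> B)}
    = tail_prob M \<beta> H n x a * (\<Prod>i\<in>J. prob {w \<in> space M. \<tau> n w i \<in> B})"
proof -
  have fin: "finite J" using assms(3) finite_hypercube finite_subset by blast
  let ?f = "\<lambda>h. exp (- \<beta> * h) :: real"
  define A where "A i = (if i = x then ?f -` {a..} else ?f -` B)" for i
  have f: "?f \<in> borel_measurable borel" by measurable
  have A: "A i \<in> sets borel" for i
    using measurable_sets[OF f, of "{a..}"] measurable_sets[OF f assms(5)] by (simp add: A_def)
  have "prob {w \<in> space M. \<forall>i\<in>insert x J. H n i w \<in> A i}
      = (\<Prod>i\<in>insert x J. prob {w \<in> space M. H n i w \<in> A i})"
    using assms A by (intro prob_joint) auto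
  also have "\<dots> = prob {w \<in> space M. H n x w \<in> A x} * (\<Prod>i\<in>J. prob {w \<in> space M. H n i w \<in> A i})"
    using fin assms(4) by simp
  also have "(\<Prod>i\<in>J. prob {w \<in> space M. H n i w \<in> A i}) = (\<Prod>i\<in>J. prob {w \<in> space M. \<tau> n w i \<in> B})"
    using assms(4) by (intro prod.cong) (auto simp: A_def tau_def)
  also have "prob {w \<in> space M. H n x w \<in> A x} = tail_prob M \<beta> H n x a"
    by (simp add: A_def tail_prob_def tau_def)
  also have "{w \<in> space M. \<forall>i\<in>insert x J. H n i w \<in> A i}
      = {w \<in> space M. a \<le> \<tau> n w x \<and> (\<forall>i\<in>J. \<tau> n w i \<in> B)}"
    using assms(4) by (auto simp: A_def tau_def)
  finally show ?thesis .
qed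

end

section \<open>Counting walks and clusters\<close>

fun walks :: "nat \<Rightarrow> vertex \<Rightarrow> nat \<Rightarrow> vertex list set" where
  "walks n x 0 = {[]}"
| "walks n x (Suc k) = (\<Union>y\<in>{y. adjacent n x y}. (#) y ` walks n y k)"

lemma finite_walks: "finite (walks n x k)"
  by (induction k arbitrary: x) (auto simp: finite_adjacent)

lemma card_walks: "card (walks n x k) \<le> n ^ k"
proof (induction k arbitrary: x)
  case (Suc k)
  have "card (walks n x (Suc k)) \<le> (\<Sum>y\<in>{y. adjacent n x y}. card ((#) y ` walks n y k))"
    by (simp add: card_UN_le finite_adjacent)
  also have "\<dots> \<le> (\<Sum>y\<in>{y. adjacent n x y}. n ^ k)"
    using Suc.IH finite_walks by (intro sum_mono) (meson card_image_le order_trans)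
  also have "\<dots> \<le> n * n ^ k"
    using card_adjacent_le[of n x] by simp
  finally show ?case by simp
qed simp

lemma walks_snoc:
  "xs \<in> walks n x k \<Longrightarrow> adjacent n (last (x # xs)) z \<Longrightarrow> xs @ [z] \<in> walks n x (Suc k)"
  by (induction k arbitrary: x xs) auto

lemma walks_prefix: "ys @ zs \<in> walks n x k \<Longrightarrow> ys \<in> walks n x (length ys)"
  by (induction k arbitrary: x ys; rename_tac x ys; case_tac ys) auto

lemma length_walks: "xs \<in> walks n x k \<Longrightarrow> length xs = k"
  by (induction k arbitrary: x xs) auto

lemma walks_subset: "xs \<in> walks n x k \<Longrightarrow> set xs \<subseteq> hypercube n"
proof (induction k arbitrary: x xs)
  case (Suc k)
  then obtain y ys where "xs = y # ys" "adjacent n x y" "ys \<in> walks n y k" by auto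
  then show ?case using Suc.IH[of ys y] by (simp add: adjacent_def)
qed simp

text \<open>Self-avoiding walks, listed without their starting site. Distinctness makes the heights
  along a walk independent; the height condition itself depends on the environment and is imposed at
  each use.\<close>

definition high_paths :: "nat \<Rightarrow> vertex \<Rightarrow> nat \<Rightarrow> vertex list set" where
  "high_paths n x k = {xs \<in> walks n x k. distinct (x # xs)}"

lemma finite_high_paths: "finite (high_paths n x k)"
  using finite_walks by (simp add: high_paths_def)

lemma card_high_paths: "card (high_paths n x k) \<le> n ^ k"
  using card_mono[OF finite_walks, of "high_paths n x k" n x k] card_walks[of n x k]
  by (auto simp: high_paths_def)

text \<open>Loop erasure: a step to a new site extends the walk, and a step back to a visited site
  cuts the walk to the prefix ending there.\<close>

lemma cluster_path:
  assumes z: "z \<in> cluster n r \<tau> x"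
  shows "\<exists>k. \<exists>xs\<in>high_paths n x k. (\<forall>y\<in>set xs. r \<le> \<tau> y) \<and> last (x # xs) = z"
proof -
  have "(x, z) \<in> {(u, v). adjacent n u v \<and> r \<le> \<tau> v}\<^sup>*"
    using z by (simp add: cluster_def)
  then show ?thesis
  proof (induction rule: rtrancl_induct)
    case base
    then show ?case by (intro exI[of _ 0] bexI[of _ "[]"]) (auto simp: high_paths_def)
  next
    case (step u v)
    then obtain k xs where xs: "xs \<in> walks n x k" "distinct (x # xs)" "\<forall>y\<in>set xs. r \<le> \<tau> y"
      "last (x # xs) = u" by (auto simp: high_paths_def)
    have uv: "adjacent n u v" "r \<le> \<tau> v" using step by auto
    show ?case
    proof (cases "v \<in> set (x # xs)")
      case False
      then show ?thesis
        using xs uv walks_snoc[OF xs(1), of v]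
        by (intro exI[of _ "Suc k"] bexI[of _ "xs @ [v]"]) (auto simp: high_paths_def)
    next
      case True
      show ?thesis
      proof (cases "v = x")
        case True
        then show ?thesis by (intro exI[of _ 0] bexI[of _ "[]"]) (auto simp: high_paths_def)
      next
        case False
        then obtain ys zs where yz: "xs = ys @ v # zs"
          using \<open>v \<in> set (x # xs)\<close> split_list[of v xs] by auto
        then have "(ys @ [v]) @ zs \<in> walks n x k" using xs(1) by simp
        then have "ys @ [v] \<in> walks n x (length (ys @ [v]))" by (rule walks_prefix)
        then show ?thesis
          using xs yz by (intro exI[of _ "length (ys @ [v])"] bexI[of _ "ys @ [v]"])
            (auto simp: high_paths_def)
      qed
    qed
  qed
qed

text \<open>Distinct cluster sites are endpoints of distinct walks. A self-avoiding walk has fewer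
  than \<open>2 ^ n\<close> steps, so the sum over lengths is finite.\<close>

lemma card_cluster_le:
  assumes x: "x \<in> hypercube n"
  shows "card (cluster n r \<tau> x) \<le> (\<Sum>k<2 ^ n. card {xs \<in> high_paths n x k. \<forall>y\<in>set xs. r \<le> \<tau> y})"
proof -
  let ?W = "\<lambda>k. {xs \<in> high_paths n x k. \<forall>y\<in>set xs. r \<le> \<tau> y}"
  have fin: "finite (?W k)" for k using finite_high_paths by simp
  have "cluster n r \<tau> x \<subseteq> (\<lambda>xs. last (x # xs)) ` (\<Union>k<2 ^ n. ?W k)"
  proof
    fix z assume "z \<in> cluster n r \<tau> x"
    then obtain k xs where xs: "xs \<in> high_paths n x k" "\<forall>y\<in>set xs. r \<le> \<tau> y" "last (x # xs) = z"
      using cluster_path by blast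
    have "card (set (x # xs)) \<le> card (hypercube n)"
      using xs x walks_subset[of xs n x k] by (intro card_mono finite_hypercube) (auto simp: high_paths_def)
    moreover have "card (set (x # xs)) = Suc k"
      using xs length_walks[of xs n x k] distinct_card[of "x # xs"] by (auto simp: high_paths_def)
    ultimately have "k < 2 ^ n" by (simp add: card_hypercube)
    then show "z \<in> (\<lambda>xs. last (x # xs)) ` (\<Union>k<2 ^ n. ?W k)" using xs by blast
  qed
  then have "card (cluster n r \<tau> x) \<le> card ((\<lambda>xs. last (x # xs)) ` (\<Union>k<2 ^ n. ?W k))"
    using fin by (intro card_mono) auto
  also have "\<dots> \<le> card (\<Union>k<2 ^ n. ?W k)"
    using fin by (intro card_image_le) auto
  also have "\<dots> \<le> (\<Sum>k<2 ^ n. card (?W k))"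
    by (intro card_UN_le) auto
  finally show ?thesis .
qed

text \<open>Markov's inequality for the counting measure on \<open>T\<close>, applied twice: each
  defect affects at most \<open>m / 8\<close> sites, together at most half of the
  \<open>m / 2\<close> sites that \<open>T\<close> has at least. This fixes the constants 16 in the
  hypotheses and the conclusion.\<close>

lemma most_sites_good:
  fixes m :: real and C B :: "'a \<Rightarrow> nat"
  assumes T: "finite T" "m / 2 \<le> card T" and m: "0 < m" and n: "0 < n"
    and C: "(\<Sum>x\<in>T. real (C x)) \<le> 2 * (real n)\<^sup>2 * m"
    and B: "(\<Sum>x\<in>T. real (B x)) \<le> m * 2 ^ n / 16"
  shows "card T \<le> 2 * card {x \<in> T. C x \<le> 16 * n\<^sup>2 \<and> 2 * B x \<le> 2 ^ n}"
proof -
  let ?T' = "{x \<in> T. C x \<le> 16 * n\<^sup>2 \<and> 2 * B x \<le> 2 ^ n}"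
  let ?U = "{x \<in> T. 16 * n\<^sup>2 < C x}" and ?V = "{x \<in> T. 2 ^ n < 2 * B x}"
  have "card ?U * (16 * (real n)\<^sup>2) = (\<Sum>x\<in>?U. 16 * (real n)\<^sup>2)" by simp
  also have "\<dots> \<le> (\<Sum>x\<in>?U. real (C x))"
  proof (rule sum_mono)
    fix x assume "x \<in> ?U"
    then have "real (16 * n\<^sup>2) \<le> real (C x)" by (simp only: of_nat_le_iff) simp
    then show "16 * (real n)\<^sup>2 \<le> real (C x)" by simp
  qed
  also have "\<dots> \<le> (\<Sum>x\<in>T. real (C x))" using T by (intro sum_mono2) auto
  also have "\<dots> \<le> m / 8 * (16 * (real n)\<^sup>2)" using C by (simp add: mult_ac)
  finally have U: "card ?U \<le> m / 8" using n by simp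
  have "card ?V * (2 ^ n / 2 :: real) = (\<Sum>x\<in>?V. 2 ^ n / 2)" by simp
  also have "\<dots> \<le> (\<Sum>x\<in>?V. real (B x))"
  proof (rule sum_mono)
    fix x assume "x \<in> ?V"
    then have "real (2 ^ n) \<le> real (2 * B x)" by (simp only: of_nat_le_iff) simp
    then show "2 ^ n / 2 \<le> real (B x)" by simp
  qed
  also have "\<dots> \<le> (\<Sum>x\<in>T. real (B x))" using T by (intro sum_mono2) auto
  also have "\<dots> \<le> m / 8 * (2 ^ n / 2)" using B by simp
  finally have V: "card ?V \<le> m / 8" by simp
  have "T \<subseteq> ?T' \<union> (?U \<union> ?V)" by auto
  then have "card T \<le> card (?T' \<union> (?U \<union> ?V))" using T by (intro card_mono) auto
  also have "\<dots> \<le> card ?T' + (card ?U + card ?V)"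
    by (meson add_left_mono card_Un_le order_trans)
  finally have "real (card T) \<le> card ?T' + (card ?U + card ?V)" by (simp only: of_nat_le_iff of_nat_add[symmetric])
  then have "real (card T) \<le> 2 * card ?T'" using U V T(2) by linarith
  then show ?thesis by linarith
qed

text \<open>Markov's inequality in the form of an exceptional event, ready for a union bound and for
  Borel-Cantelli.\<close>

lemma (in prob_space) markov_sum_indicator:
  assumes I: "finite I" and A: "\<And>i. i \<in> I \<Longrightarrow> A i \<in> events" and c: "0 < c"
  shows "\<exists>E\<in>events. prob E \<le> (\<Sum>i\<in>I. prob (A i)) / c \<and>
    (\<forall>w\<in>space M - E. (\<Sum>i\<in>I. indicator (A i) w) \<le> (c :: real))"
proof -
  let ?f = "\<lambda>w. \<Sum>i\<in>I. indicator (A i) w :: real"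
  have int: "integrable M ?f"
    using A by (intro Bochner_Integration.integrable_sum integrable_real_indicator) (auto simp: emeasure_eq_measure)
  have "expectation ?f = (\<Sum>i\<in>I. prob (A i))"
    using A by (subst Bochner_Integration.integral_sum)
      (auto intro!: sum.cong integrable_real_indicator simp: emeasure_eq_measure Int_absorb2[OF sets.sets_into_space])
  then have "prob {w \<in> space M. c \<le> ?f w} \<le> (\<Sum>i\<in>I. prob (A i)) / c"
    using integral_Markov_inequality_measure[OF int sets.top _ c] by (simp add: sum_nonneg)
  moreover have "{w \<in> space M. c \<le> ?f w} \<in> events"
    using int by measurable
  ultimately show ?thesis
    by (intro bexI[of _ "{w \<in> space M. c \<le> ?f w}"]) auto
qed

lemma sum_power_le_2:
  fixes q :: real
  assumes "0 \<le> q" "q \<le> 1 / 2"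
  shows "(\<Sum>k<N. q ^ k) \<le> 2"
proof -
  have "(\<Sum>k<N. q ^ k) \<le> (\<Sum>k. q ^ k)"
    using assms by (intro sum_le_suminf) auto
  also have "\<dots> = 1 / (1 - q)" using assms by (intro suminf_geometric) auto
  also have "\<dots> \<le> 2" using assms by (simp add: field_simps)
  finally show ?thesis .
qed

lemma sum_triple_Sigma:
  assumes "finite A" "finite B" "\<And>x k. finite (C x k)"
  shows "(\<Sum>i\<in>(SIGMA x:A. SIGMA k:B. C x k). f i) = (\<Sum>x\<in>A. \<Sum>k\<in>B. \<Sum>z\<in>C x k. f (x, k, z))"
  using assms by (simp add: sum.Sigma case_prod_beta')

section \<open>Moment counts for the random landscape\<close>

context gaussian_landscape
begin

definition high_set :: "nat \<Rightarrow> real \<Rightarrow> 'w \<Rightarrow> vertex set" where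
  "high_set n a w = {x \<in> hypercube n. a \<le> \<tau> n w x}"

lemma finite_high_set: "finite (high_set n a w)"
  using finite_hypercube by (simp add: high_set_def)

text \<open>Pairwise independence leaves only the diagonal in the variance, which is thus at most
  the mean \<open>2 ^ n * pT\<close>. Chebyshev's inequality at half the mean yields the failure
  probability.\<close>

lemma high_set_count:
  assumes n: "1 < n" and pT: "\<And>x. x \<in> hypercube n \<Longrightarrow> tail_prob M \<beta> H n x a = pT" and pos: "0 < pT"
  shows "\<exists>E\<in>events. prob E \<le> 4 / (2 ^ n * pT) \<and>
    (\<forall>w\<in>space M - E. 2 ^ n * pT / 2 \<le> card (high_set n a w))"
proof -
  let ?S = "hypercube n" and ?m = "2 ^ n * pT"
  let ?A = "\<lambda>x. {w \<in> space M. a \<le> \<tau> n w x}"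
  let ?N = "\<lambda>w. \<Sum>x\<in>?S. indicator (?A x) w :: real"
  have A: "?A x \<in> events" if "x \<in> ?S" for x using sets_tau_ge[OF n that] .
  have pA: "prob (?A x) = pT" if "x \<in> ?S" for x using pT[OF that] by (simp add: tail_prob_def)
  have N: "?N w = card (high_set n a w)" if "w \<in> space M" for w
    using that finite_hypercube
    by (simp add: indicator_def high_set_def sum.If_cases Int_def)
  have int1: "integrable M (indicator (?A x) :: _ \<Rightarrow> real)" if "x \<in> ?S" for x
    using A[OF that] by (intro integrable_real_indicator) (auto simp: emeasure_eq_measure)
  have int: "integrable M ?N" by (intro Bochner_Integration.integrable_sum int1)
  have EN: "expectation ?N = ?m"
    using int1 pA A card_hypercube[of n]
    by (subst Bochner_Integration.integral_sum) (auto simp: Int_absorb2[OF sets.sets_into_space])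
  have sq: "(?N w)\<^sup>2 = (\<Sum>x\<in>?S. \<Sum>y\<in>?S. indicator (?A x \<inter> ?A y) w)" for w
    by (simp add: power2_eq_square sum_product indicator_inter_arith)
  have int2: "integrable M (indicator (?A x \<inter> ?A y) :: _ \<Rightarrow> real)" if "x \<in> ?S" "y \<in> ?S" for x y
    using A[OF that(1)] A[OF that(2)]
    by (intro integrable_real_indicator) (auto simp: emeasure_eq_measure)
  have intsq: "integrable M (\<lambda>w. (?N w)\<^sup>2)" unfolding sq by (intro Bochner_Integration.integrable_sum int2)
  have p2: "prob (?A x \<inter> ?A y) = pT * pT" if xy: "x \<in> ?S" "y \<in> ?S" "x \<noteq> y" for x y
  proof -
    have "?A x \<inter> ?A y = {w \<in> space M. a \<le> \<tau> n w x \<and> (\<forall>i\<in>{y}. \<tau> n w i \<in> {a..})}" by auto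
    then show ?thesis
      using prob_joint_tau[OF n xy(1), of "{y}" "{a..}" a] xy pA[of y] pT[OF xy(1)] by simp
  qed
  have "expectation (\<lambda>w. (?N w)\<^sup>2) = (\<Sum>x\<in>?S. \<Sum>y\<in>?S. prob (?A x \<inter> ?A y))"
    unfolding sq using A
    by (subst Bochner_Integration.integral_sum, intro Bochner_Integration.integrable_sum int2, simp, simp)
      (intro sum.cong refl, subst Bochner_Integration.integral_sum, auto intro: int2
        simp: Int_absorb2[OF sets.sets_into_space] sets.Int)
  also have "\<dots> \<le> (\<Sum>x\<in>?S. \<Sum>y\<in>?S. pT * pT + (if x = y then pT else 0))"
  proof (intro sum_mono)
    fix x y assume "x \<in> ?S" "y \<in> ?S"
    then show "prob (?A x \<inter> ?A y) \<le> pT * pT + (if x = y then pT else 0)"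
      using p2[of x y] pA[of y] pos by (cases "x = y") auto
  qed
  also have "\<dots> = ?m\<^sup>2 + ?m"
    using finite_hypercube card_hypercube[of n]
    by (simp add: sum.distrib power2_eq_square algebra_simps)
  finally have var: "variance ?N \<le> ?m"
    using variance_eq[OF int intsq] EN by simp
  have "prob {w \<in> space M. ?m / 2 \<le> \<bar>?N w - expectation ?N\<bar>} \<le> variance ?N / (?m / 2)\<^sup>2"
    using int pos by (intro Chebyshev_inequality intsq) auto
  also have "\<dots> \<le> ?m / (?m / 2)\<^sup>2"
    by (rule divide_right_mono[OF var]) simp
  also have "\<dots> = 4 / ?m"
    using pos by (simp add: power2_eq_square field_simps)
  finally have "prob {w \<in> space M. ?m / 2 \<le> \<bar>?N w - ?m\<bar>} \<le> 4 / ?m"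
    by (simp only: EN)
  moreover have "?m / 2 \<le> card (high_set n a w)"
    if "w \<in> space M - {w \<in> space M. ?m / 2 \<le> \<bar>?N w - ?m\<bar>}" for w
  proof -
    have "w \<in> space M" "\<not> ?m / 2 \<le> \<bar>?N w - ?m\<bar>" using that by auto
    then show ?thesis using N[of w] by linarith
  qed
  moreover have "{w \<in> space M. ?m / 2 \<le> \<bar>?N w - ?m\<bar>} \<in> events"
    using int by measurable
  ultimately show ?thesis by blast
qed

text \<open>There are at most n^k self-avoiding walks of length k from a site, each high with
  probability p^k independently of the start; \<open>n * p \<le> 1 / 2\<close> sums this to an
  expected total of at most twice \<open>2 ^ n * pT\<close>. Allowing
  \<open>(real n)\<^sup>2\<close> times that much makes the failure probability summable.\<close>

lemma cluster_count:
  assumes n: "1 < n" and pT: "\<And>x. x \<in> hypercube n \<Longrightarrow> tail_prob M \<beta> H n x a = pT" and pos: "0 < pT"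
    and p: "\<And>x. x \<in> hypercube n \<Longrightarrow> tail_prob M \<beta> H n x r = p" and np: "n * p \<le> 1 / 2"
  shows "\<exists>E\<in>events. prob E \<le> 1 / (real n)\<^sup>2 \<and>
    (\<forall>w\<in>space M - E. (\<Sum>x\<in>high_set n a w. real (card (cluster n r (\<tau> n w) x)))
      \<le> 2 * (real n)\<^sup>2 * (2 ^ n * pT))"
proof -
  let ?S = "hypercube n" and ?m = "2 ^ n * pT"
  define I where "I = (SIGMA x:?S. SIGMA k:{..<2 ^ n}. high_paths n x k)"
  define A where "A = (\<lambda>(x, k :: nat, xs). {w \<in> space M. a \<le> \<tau> n w x \<and> (\<forall>y\<in>set xs. r \<le> \<tau> n w y)})"
  have p0: "0 \<le> p"
    using hypercube_nonempty[of n] p by (metis all_not_in_conv measure_nonneg tail_prob_def)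
  have finI: "finite I"
    unfolding I_def by (intro finite_SigmaI finite_hypercube finite_high_paths) auto
  have path: "set xs \<subseteq> ?S \<and> x \<notin> set xs \<and> distinct xs \<and> length xs = k" if "xs \<in> high_paths n x k" for x k xs
    using that walks_subset[of xs n x k] length_walks[of xs n x k] by (auto simp: high_paths_def)
  have A_sets: "A i \<in> events" if "i \<in> I" for i
  proof -
    obtain x k xs where i: "i = (x, k, xs)" "x \<in> ?S" "xs \<in> high_paths n x k"
      using \<open>i \<in> I\<close> by (auto simp: I_def)
    have "A i = {w \<in> space M. a \<le> \<tau> n w x} \<inter> {w \<in> space M. \<forall>y\<in>set xs. r \<le> \<tau> n w y}"
      by (auto simp: A_def i)
    also have "\<dots> \<in> events"
      using path[OF i(3)] by (intro sets.Int sets.sets_Collect_finite_All sets_tau_ge[OF n] i) auto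
    finally show ?thesis .
  qed
  have probA: "prob (A (x, k, xs)) = pT * p ^ k" if "x \<in> ?S" "xs \<in> high_paths n x k" for x k xs
  proof -
    have "prob (A (x, k, xs)) = pT * (\<Prod>y\<in>set xs. prob {w \<in> space M. \<tau> n w y \<in> {r..}})"
      using prob_joint_tau[OF n that(1), of "set xs" "{r..}" a] path[OF that(2)] pT[OF that(1)]
      by (simp add: A_def)
    also have "(\<Prod>y\<in>set xs. prob {w \<in> space M. \<tau> n w y \<in> {r..}}) = (\<Prod>y\<in>set xs. p)"
      using path[OF that(2)] p by (intro prod.cong) (auto simp: tail_prob_def)
    also have "\<dots> = p ^ k" using path[OF that(2)] distinct_card[of xs] by simp
    finally show ?thesis .
  qed
  have "(\<Sum>i\<in>I. prob (A i)) = (\<Sum>x\<in>?S. \<Sum>k<2 ^ n. \<Sum>xs\<in>high_paths n x k. prob (A (x, k, xs)))"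
    unfolding I_def by (simp add: sum_triple_Sigma finite_hypercube finite_high_paths)
  also have "\<dots> = (\<Sum>x\<in>?S. \<Sum>k<2 ^ n. card (high_paths n x k) * (pT * p ^ k))"
    by (intro sum.cong refl) (simp add: probA)
  also have "\<dots> \<le> (\<Sum>x\<in>?S. \<Sum>k<2 ^ n. pT * (n * p) ^ k)"
  proof (intro sum_mono)
    fix x and k :: nat
    have "real (card (high_paths n x k)) \<le> real n ^ k"
      using card_high_paths[of n x k] by (metis of_nat_le_iff of_nat_power)
    then have "card (high_paths n x k) * (pT * p ^ k) \<le> real n ^ k * (pT * p ^ k)"
      using pos p0 by (intro mult_right_mono) auto
    then show "card (high_paths n x k) * (pT * p ^ k) \<le> pT * (n * p) ^ k"
      by (simp add: power_mult_distrib mult_ac)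
  qed
  also have "\<dots> = ?m * (\<Sum>k<2 ^ n. (n * p) ^ k)"
    by (simp add: card_hypercube sum_distrib_left mult_ac)
  also have "\<dots> \<le> ?m * 2"
    using np p0 pos by (intro mult_left_mono sum_power_le_2) auto
  finally have bound: "(\<Sum>i\<in>I. prob (A i)) \<le> ?m * 2" .
  have c0: "0 < 2 * (real n)\<^sup>2 * ?m" using n pos by simp
  obtain E where E: "E \<in> events" "prob E \<le> (\<Sum>i\<in>I. prob (A i)) / (2 * (real n)\<^sup>2 * ?m)"
    "\<And>w. w \<in> space M - E \<Longrightarrow> (\<Sum>i\<in>I. indicator (A i) w) \<le> 2 * (real n)\<^sup>2 * ?m"
    using markov_sum_indicator[of I A "2 * (real n)\<^sup>2 * ?m"] finI A_sets c0 by blast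
  have "(\<Sum>i\<in>I. prob (A i)) / (2 * (real n)\<^sup>2 * ?m) \<le> ?m * 2 / (2 * (real n)\<^sup>2 * ?m)"
    using bound pos by (intro divide_right_mono) auto
  also have "\<dots> = 1 / (real n)\<^sup>2" using pos by simp
  finally have "prob E \<le> 1 / (real n)\<^sup>2" using E(2) by linarith
  moreover have "(\<Sum>x\<in>high_set n a w. real (card (cluster n r (\<tau> n w) x))) \<le> 2 * (real n)\<^sup>2 * ?m"
    if w: "w \<in> space M - E" for w
  proof -
    have "(\<Sum>x\<in>high_set n a w. real (card (cluster n r (\<tau> n w) x)))
      \<le> (\<Sum>x\<in>high_set n a w. \<Sum>k<2 ^ n. real (card {xs \<in> high_paths n x k. \<forall>y\<in>set xs. r \<le> \<tau> n w y}))"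
    proof (rule sum_mono)
      fix x assume "x \<in> high_set n a w"
      then have "card (cluster n r (\<tau> n w) x)
          \<le> (\<Sum>k<2 ^ n. card {xs \<in> high_paths n x k. \<forall>y\<in>set xs. r \<le> \<tau> n w y})"
        by (intro card_cluster_le) (simp add: high_set_def)
      then show "real (card (cluster n r (\<tau> n w) x))
          \<le> (\<Sum>k<2 ^ n. real (card {xs \<in> high_paths n x k. \<forall>y\<in>set xs. r \<le> \<tau> n w y}))"
        by (simp only: of_nat_sum[symmetric] of_nat_le_iff)
    qed
    also have "\<dots> = (\<Sum>x\<in>high_set n a w. \<Sum>k<2 ^ n. \<Sum>xs\<in>high_paths n x k. indicator (A (x, k, xs)) w)"
    proof (intro sum.cong refl)
      fix x and k :: nat assume "x \<in> high_set n a w"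
      then have "indicator (A (x, k, xs)) w = (if \<forall>y\<in>set xs. r \<le> \<tau> n w y then 1 else 0 :: real)" for xs
        using w by (auto simp: A_def high_set_def)
      then show "real (card {xs \<in> high_paths n x k. \<forall>y\<in>set xs. r \<le> \<tau> n w y})
          = (\<Sum>xs\<in>high_paths n x k. indicator (A (x, k, xs)) w)"
        using finite_high_paths by (simp add: sum.If_cases Int_def)
    qed
    also have "\<dots> \<le> (\<Sum>x\<in>?S. \<Sum>k<2 ^ n. \<Sum>xs\<in>high_paths n x k. indicator (A (x, k, xs)) w)"
      by (intro sum_mono2 finite_hypercube sum_nonneg) (auto simp: high_set_def)
    also have "\<dots> = (\<Sum>i\<in>I. indicator (A i) w)"
      unfolding I_def by (simp add: sum_triple_Sigma finite_hypercube finite_high_paths)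
    finally show ?thesis using E(3)[OF w] by linarith
  qed
  ultimately show ?thesis using E(1) by blast
qed

text \<open>Each of the 4^n n triples of start, target and position is bad with probability at most
  \<open>pT * p\<close>. The tolerated total is the one that \<open>most_sites_good\<close> can
  digest.\<close>

lemma obstruction_count:
  assumes n: "1 < n" and pT: "\<And>x. x \<in> hypercube n \<Longrightarrow> tail_prob M \<beta> H n x a = pT" and pos: "0 < pT"
    and p: "\<And>x. x \<in> hypercube n \<Longrightarrow> tail_prob M \<beta> H n x r = p" and r: "0 < r" "1 / r \<le> a"
  shows "\<exists>E\<in>events. prob E \<le> 16 * (n * p) \<and>
    (\<forall>w\<in>space M - E.
      (\<Sum>x\<in>high_set n a w. real (card {y \<in> hypercube n. \<exists>i\<le>n. \<tau> n w (interpolate x y i) < 1 / r}))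
      \<le> 2 ^ n * pT * 2 ^ n / 16)"
proof -
  let ?S = "hypercube n" and ?c = "2 ^ n * pT * 2 ^ n / 16"
  define I where "I = (?S \<times> ?S) \<times> {1..n}"
  define A where "A = (\<lambda>((x, y), i). {w \<in> space M. a \<le> \<tau> n w x \<and> \<tau> n w (interpolate x y i) < 1 / r})"
  have p0: "0 \<le> p"
    using hypercube_nonempty[of n] p by (metis all_not_in_conv measure_nonneg tail_prob_def)
  have finI: "finite I" using finite_hypercube by (simp add: I_def)
  have A_sets: "A i \<in> events" if "i \<in> I" for i
  proof -
    obtain x y k where i: "i = ((x, y), k)" "x \<in> ?S" "y \<in> ?S"
      using \<open>i \<in> I\<close> by (auto simp: I_def)
    have "A i = {w \<in> space M. a \<le> \<tau> n w x} \<inter> {w \<in> space M. \<tau> n w (interpolate x y k) < 1 / r}"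
      by (auto simp: A_def i)
    also have "\<dots> \<in> events"
      by (intro sets.Int sets_tau_ge[OF n] sets_tau_less[OF n] i interpolate_in_hypercube)
    finally show ?thesis .
  qed
  have probA: "prob (A ((x, y), i)) \<le> pT * p" if xy: "x \<in> ?S" "y \<in> ?S" for x y i
  \<comment> \<open>Independence fails when the path has not yet left \<open>x\<close>, but then the
    event is empty: a site cannot be at least \<open>a\<close> and below
    \<open>1 / r \<le> a\<close>.\<close>
  proof (cases "interpolate x y i = x")
    case True
    then have "A ((x, y), i) = {}" using r(2) by (auto simp: A_def)
    then show ?thesis using pos p0 by simp
  next
    case False
    let ?z = "interpolate x y i"
    have z: "?z \<in> ?S" by (intro interpolate_in_hypercube xy)
    have "prob (A ((x, y), i)) = pT * prob {w \<in> space M. \<tau> n w ?z < 1 / r}"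
      using prob_joint_tau[OF n xy(1), of "{?z}" "{..<1 / r}" a] z False pT[OF xy(1)]
      by (simp add: A_def)
    also have "\<dots> \<le> pT * p"
      using prob_tau_small[OF n z r(1)] p[OF z] pos by (intro mult_left_mono) auto
    finally show ?thesis .
  qed
  have "(\<Sum>i\<in>I. prob (A i)) \<le> (\<Sum>i\<in>I. pT * p)"
    using probA by (intro sum_mono) (auto simp: I_def)
  also have "\<dots> = 2 ^ n * 2 ^ n * n * (pT * p)" by (simp add: I_def card_hypercube card_cartesian_product)
  finally have bound: "(\<Sum>i\<in>I. prob (A i)) \<le> 2 ^ n * 2 ^ n * n * (pT * p)" .
  have c0: "0 < ?c" using pos by simp
  obtain E where E: "E \<in> events" "prob E \<le> (\<Sum>i\<in>I. prob (A i)) / ?c"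
    "\<And>w. w \<in> space M - E \<Longrightarrow> (\<Sum>i\<in>I. indicator (A i) w) \<le> ?c"
    using markov_sum_indicator[of I A ?c] finI A_sets c0 by blast
  have "(\<Sum>i\<in>I. prob (A i)) / ?c \<le> 2 ^ n * 2 ^ n * n * (pT * p) / ?c"
    using bound pos by (intro divide_right_mono) auto
  also have "\<dots> = 16 * (n * p)" using pos by simp
  finally have "prob E \<le> 16 * (n * p)" using E(2) by linarith
  moreover have "(\<Sum>x\<in>high_set n a w. real (card {y \<in> ?S. \<exists>i\<le>n. \<tau> n w (interpolate x y i) < 1 / r})) \<le> ?c"
    if w: "w \<in> space M - E" for w
  proof -
    have "(\<Sum>x\<in>high_set n a w. real (card {y \<in> ?S. \<exists>i\<le>n. \<tau> n w (interpolate x y i) < 1 / r}))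
      \<le> (\<Sum>x\<in>high_set n a w. \<Sum>y\<in>?S. \<Sum>i\<in>{1..n}. indicator (A ((x, y), i)) w)"
    proof (rule sum_mono)
      fix x assume x: "x \<in> high_set n a w"
      let ?B = "{y \<in> ?S. \<exists>i\<le>n. \<tau> n w (interpolate x y i) < 1 / r}"
      have "real (card ?B) = (\<Sum>y\<in>?B. 1)" by simp
      also have "\<dots> \<le> (\<Sum>y\<in>?B. \<Sum>i\<in>{1..n}. indicator (A ((x, y), i)) w)"
      proof (rule sum_mono)
        fix y assume y: "y \<in> ?B"
        then obtain i where i: "i \<le> n" "\<tau> n w (interpolate x y i) < 1 / r" by auto
        \<comment> \<open>Position 0 is \<open>x\<close> itself, which is high. Hence only the
          \<open>n\<close> positions of \<open>{1..n}\<close> enter the count.\<close>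
        have "i \<noteq> 0"
          using i(2) x y interpolate_0[of x n y] r(2) by (auto simp: high_set_def intro: gr0I)
        then have "i \<in> {1..n}" using i(1) by simp
        moreover have "w \<in> A ((x, y), i)" using x w i by (auto simp: A_def high_set_def)
        ultimately show "1 \<le> (\<Sum>i\<in>{1..n}. indicator (A ((x, y), i)) w :: real)"
          using member_le_sum[of i "{1..n}" "\<lambda>i. indicator (A ((x, y), i)) w :: real"] by simp
      qed
      also have "\<dots> \<le> (\<Sum>y\<in>?S. \<Sum>i\<in>{1..n}. indicator (A ((x, y), i)) w)"
        by (intro sum_mono2 finite_hypercube sum_nonneg) auto
      finally show "real (card ?B) \<le> (\<Sum>y\<in>?S. \<Sum>i\<in>{1..n}. indicator (A ((x, y), i)) w)" .
    qed
    also have "\<dots> \<le> (\<Sum>x\<in>?S. \<Sum>y\<in>?S. \<Sum>i\<in>{1..n}. indicator (A ((x, y), i)) w)"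
      by (intro sum_mono2 finite_hypercube sum_nonneg) (auto simp: high_set_def)
    also have "\<dots> = (\<Sum>p\<in>?S \<times> ?S. \<Sum>i\<in>{1..n}. indicator (A (p, i)) w)"
      by (rule trans[OF sum.cartesian_product]) (simp add: case_prod_beta')
    also have "\<dots> = (\<Sum>i\<in>I. indicator (A i) w)"
      unfolding I_def by (rule trans[OF sum.cartesian_product]) (simp add: case_prod_beta')
    finally show ?thesis using E(3)[OF w] by linarith
  qed
  ultimately show ?thesis using E(1) by blast
qed

lemma good_environment:
  assumes n: "1 < n" and pT: "\<And>x. x \<in> hypercube n \<Longrightarrow> tail_prob M \<beta> H n x a = pT" and pos: "0 < pT"
    and p: "\<And>x. x \<in> hypercube n \<Longrightarrow> tail_prob M \<beta> H n x r = p" and np: "n * p \<le> 1 / 2"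
    and r: "0 < r" "1 / r \<le> a"
  shows "\<exists>E\<in>events. prob E \<le> 4 / (2 ^ n * pT) + 1 / (real n)\<^sup>2 + 16 * (n * p) \<and>
    (\<forall>w\<in>space M - E. high_set n a w \<noteq> {} \<and>
      (\<Sum>x\<in>high_set n a w. real (card (cluster n r (\<tau> n w) x))) \<le> 4 * (real n)\<^sup>2 * card (high_set n a w) \<and>
      card (high_set n a w) \<le> 2 * card {x \<in> high_set n a w. card (cluster n r (\<tau> n w) x) \<le> 16 * n\<^sup>2 \<and>
        2 * card {y \<in> hypercube n. \<exists>i\<le>n. \<tau> n w (interpolate x y i) < 1 / r} \<le> 2 ^ n})"
proof -
  let ?m = "2 ^ n * pT"
  have m: "0 < ?m" using pos by simp
  obtain E1 where E1: "E1 \<in> events" "prob E1 \<le> 4 / ?m"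
      "\<And>w. w \<in> space M - E1 \<Longrightarrow> ?m / 2 \<le> card (high_set n a w)"
    using high_set_count[OF n pT pos] by blast
  obtain E2 where E2: "E2 \<in> events" "prob E2 \<le> 1 / (real n)\<^sup>2"
      "\<And>w. w \<in> space M - E2 \<Longrightarrow> (\<Sum>x\<in>high_set n a w. real (card (cluster n r (\<tau> n w) x)))
        \<le> 2 * (real n)\<^sup>2 * ?m"
    using cluster_count[OF n pT pos p np] by blast
  obtain E3 where E3: "E3 \<in> events" "prob E3 \<le> 16 * (n * p)"
      "\<And>w. w \<in> space M - E3 \<Longrightarrow>
        (\<Sum>x\<in>high_set n a w. real (card {y \<in> hypercube n. \<exists>i\<le>n. \<tau> n w (interpolate x y i) < 1 / r}))
        \<le> ?m * 2 ^ n / 16"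
    using obstruction_count[OF n pT pos p r] by blast
  let ?E = "E1 \<union> (E2 \<union> E3)"
  have "prob ?E \<le> prob E1 + (prob E2 + prob E3)"
    using E1(1) E2(1) E3(1) measure_Un_le[of E1 M "E2 \<union> E3"] measure_Un_le[of E2 M E3] by auto
  then have "prob ?E \<le> 4 / ?m + 1 / (real n)\<^sup>2 + 16 * (n * p)"
    using E1(2) E2(2) E3(2) by linarith
  moreover have "high_set n a w \<noteq> {}"
    "(\<Sum>x\<in>high_set n a w. real (card (cluster n r (\<tau> n w) x))) \<le> 4 * (real n)\<^sup>2 * card (high_set n a w)"
    "card (high_set n a w) \<le> 2 * card {x \<in> high_set n a w. card (cluster n r (\<tau> n w) x) \<le> 16 * n\<^sup>2 \<and>
        2 * card {y \<in> hypercube n. \<exists>i\<le>n. \<tau> n w (interpolate x y i) < 1 / r} \<le> 2 ^ n}"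
    if w: "w \<in> space M - ?E" for w
  proof -
    have w': "w \<in> space M - E1" "w \<in> space M - E2" "w \<in> space M - E3" using w by auto
    show "high_set n a w \<noteq> {}" using E1(3)[OF w'(1)] m by auto
    have "2 * (real n)\<^sup>2 * ?m = 4 * (real n)\<^sup>2 * (?m / 2)" by simp
    also have "\<dots> \<le> 4 * (real n)\<^sup>2 * card (high_set n a w)"
      using E1(3)[OF w'(1)] by (intro mult_left_mono) auto
    finally show "(\<Sum>x\<in>high_set n a w. real (card (cluster n r (\<tau> n w) x)))
        \<le> 4 * (real n)\<^sup>2 * card (high_set n a w)"
      using E2(3)[OF w'(2)] by linarith
    show "card (high_set n a w) \<le> 2 * card {x \<in> high_set n a w. card (cluster n r (\<tau> n w) x) \<le> 16 * n\<^sup>2 \<and>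
        2 * card {y \<in> hypercube n. \<exists>i\<le>n. \<tau> n w (interpolate x y i) < 1 / r} \<le> 2 ^ n}"
      using n by (intro most_sites_good[OF finite_high_set E1(3)[OF w'(1)] m _ E2(3)[OF w'(2)] E3(3)[OF w'(3)]]) auto
  qed
  moreover have "?E \<in> events" using E1(1) E2(1) E3(1) by auto
  ultimately show ?thesis by blast
qed

end

section \<open>Scaling\<close>

lemma beta_c_pos: "0 < \<epsilon> \<Longrightarrow> 0 < beta_c \<epsilon>"
  by (simp add: beta_c_def)

locale scaling_window = gaussian_landscape M H \<beta>
  for M :: "'w measure" and H :: "nat \<Rightarrow> vertex \<Rightarrow> 'w \<Rightarrow> real" and \<beta> :: real +
  fixes \<epsilon> :: real and r c \<theta> :: "nat \<Rightarrow> real" and c_star :: real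
  assumes c_star: "2 < c_star" and \<epsilon>: "0 < \<epsilon>" "\<epsilon> < 1" and \<beta>_gt: "beta_c \<epsilon> < \<beta>"
    and r_def: "\<And>n x. 1 < n \<Longrightarrow> x \<in> hypercube n \<Longrightarrow>
      real n powr c_star * tail_prob M \<beta> H n x (r n) = 1"
    and c_def: "\<And>n x. 1 < n \<Longrightarrow> x \<in> hypercube n \<Longrightarrow>
      2 powr (\<epsilon> * real n) * tail_prob M \<beta> H n x (c n) = 1"
    and \<theta>_pos: "\<And>n. 1 < n \<Longrightarrow> 0 < \<theta> n"
    and \<theta>_gt: "\<And>n. 1 < n \<Longrightarrow> 4 / (1 - alpha \<beta> \<epsilon>) * ln (r n) < ln (\<theta> n)"
    and \<theta>_lim: "(\<lambda>n. ln (\<theta> n) / real n) \<longlonglongrightarrow> 0"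
begin

lemma tail_r: "1 < n \<Longrightarrow> x \<in> hypercube n \<Longrightarrow> tail_prob M \<beta> H n x (r n) = real n powr (- c_star)"
  using r_def[of n x] by (simp add: powr_minus field_simps)

lemma tail_c: "1 < n \<Longrightarrow> x \<in> hypercube n \<Longrightarrow> tail_prob M \<beta> H n x (c n) = 2 powr (- (\<epsilon> * real n))"
  using c_def[of n x] by (simp add: powr_minus field_simps)

text \<open>Levels up to 1 have tail probability at least 1/2, whereas n^(-c_star) is below 1/2
  already for \<open>n = 2\<close>.\<close>

lemma r_gt_1:
  assumes n: "1 < n"
  shows "1 < r n"
proof (rule ccontr)
  assume "\<not> 1 < r n"
  obtain x where x: "x \<in> hypercube n" using hypercube_nonempty[of n] by blast
  have "1 / 2 \<le> tail_prob M \<beta> H n x (r n)"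
    using tail_prob_1[OF n x] tail_prob_antimono[OF n x, of "r n" 1] \<open>\<not> 1 < r n\<close> by simp
  also have "\<dots> = real n powr (- c_star)" by (rule tail_r[OF n x])
  also have "\<dots> \<le> 2 powr (- c_star)"
    using n c_star by (intro powr_mono2') auto
  also have "\<dots> < 2 powr (-1)" using c_star by (intro powr_less_mono) auto
  finally show False by (simp add: powr_minus)
qed

lemma ln_r_pos: "1 < n \<Longrightarrow> 0 < ln (r n)"
  using r_gt_1[of n] by simp

lemma \<theta>_gt_1:
  assumes n: "1 < n"
  shows "1 < \<theta> n"
proof -
  have "alpha \<beta> \<epsilon> < 1" using \<beta>_gt \<beta>_pos by (simp add: alpha_def)
  then have "0 < 4 / (1 - alpha \<beta> \<epsilon>) * ln (r n)" using ln_r_pos[OF n] by simp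
  then have "0 < ln (\<theta> n)" using \<theta>_gt[OF n] by linarith
  then show ?thesis using \<theta>_pos[OF n] by (simp add: ln_gt_zero_iff)
qed

text \<open>The Gaussian upper tail at level \<open>r n\<close>. It makes \<open>r n\<close>
  subexponential and, sharper, makes
  \<open>exp (- (ln (r n))\<^sup>2 / (2 * n * \<beta>\<^sup>2))\<close> at least a power of
  \<open>n\<close>.\<close>

lemma ln_r_sq_le:
  assumes n: "1 < n"
  shows "(ln (r n))\<^sup>2 \<le> 2 * real n * \<beta>\<^sup>2 * c_star * ln n"
proof -
  obtain x where x: "x \<in> hypercube n" using hypercube_nonempty[of n] by blast
  have "real n powr (- c_star) \<le> exp (- (ln (r n) / \<beta>)\<^sup>2 / (2 * n))"
    using tail_prob_upper[OF n x, of "r n"] r_gt_1[OF n] tail_r[OF n x] by simp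
  moreover have "real n powr (- c_star) = exp (- (c_star * ln n))" using n by (simp add: powr_def)
  ultimately have "(ln (r n) / \<beta>)\<^sup>2 / (2 * n) \<le> c_star * ln n" by simp
  then show ?thesis using n \<beta>_pos by (simp add: power_divide field_simps)
qed

lemma ln_n_over_n: "(\<lambda>n. ln (real n) / real n) \<longlonglongrightarrow> 0"
  by real_asymp

lemma ln_r_over_n: "(\<lambda>n. ln (r n) / real n) \<longlonglongrightarrow> 0"
proof (rule tendsto_sandwich)
  let ?g = "\<lambda>n. sqrt (2 * \<beta>\<^sup>2 * c_star * (ln (real n) / real n))"
  show "\<forall>\<^sub>F n in sequentially. 0 \<le> ln (r n) / real n"
    using eventually_gt_at_top[of 1] by eventually_elim (use ln_r_pos in \<open>simp add: less_imp_le\<close>)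
  show "\<forall>\<^sub>F n in sequentially. ln (r n) / real n \<le> ?g n"
    using eventually_gt_at_top[of 1]
  proof eventually_elim
    case (elim n)
    have "(ln (r n) / n)\<^sup>2 \<le> 2 * real n * \<beta>\<^sup>2 * c_star * ln n / (real n)\<^sup>2"
      unfolding power_divide by (rule divide_right_mono[OF ln_r_sq_le[OF elim]]) simp
    also have "\<dots> = 2 * \<beta>\<^sup>2 * c_star * (ln n / n)" using elim by (simp add: power2_eq_square)
    finally show ?case by (rule real_le_rsqrt)
  qed
  have "?g \<longlonglongrightarrow> sqrt (2 * \<beta>\<^sup>2 * c_star * 0)"
    by (intro tendsto_intros ln_n_over_n)
  then show "?g \<longlonglongrightarrow> 0" by simp
qed simp

text \<open>The level \<open>exp (\<beta> * k * n)\<close> with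
  \<open>k = sqrt (\<epsilon> * ln 2)\<close> lies below the expected order
  \<open>exp (\<beta> * beta_c \<epsilon> * n)\<close>. Its Gaussian exponent is only half of
  \<open>\<epsilon> * ln 2\<close>, and the other half absorbs all lower order terms; linear growth
  of \<open>ln (c n)\<close> is all that is wanted.\<close>

lemma eventually_ln_c_ge:
  "\<forall>\<^sub>F n in sequentially. \<beta> * sqrt (\<epsilon> * ln 2) * n \<le> ln (c n) \<and> 0 < c n"
proof -
  define k where "k = sqrt (\<epsilon> * ln 2)"
  have k: "0 < k" "k\<^sup>2 = \<epsilon> * ln 2" using \<epsilon> by (simp_all add: k_def)
  have "(\<lambda>n. k / real n + 1 / (2 * (real n)\<^sup>2) + ln (2 * pi * real n) / (2 * real n)) \<longlonglongrightarrow> 0"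
    by real_asymp
  then have "\<forall>\<^sub>F n in sequentially.
      k / real n + 1 / (2 * (real n)\<^sup>2) + ln (2 * pi * real n) / (2 * real n) < k\<^sup>2 / 2"
    by (rule order_tendstoD) (use k(1) in simp)
  then show ?thesis
    using eventually_gt_at_top[of 1]
  proof eventually_elim
    case (elim n)
    obtain x where x: "x \<in> hypercube n" using hypercube_nonempty[of n] by blast
    let ?u = "exp (\<beta> * k * n)"
    have u: "1 \<le> ?u" using k \<beta>_pos by simp
    have "2 powr (- (\<epsilon> * real n)) = exp (- (k\<^sup>2 * n))" by (simp add: powr_def k(2) mult_ac)
    also have "\<dots> < exp (- (k * n + 1)\<^sup>2 / (2 * n) - ln (2 * pi * n) / 2)"
    proof -
      have "(k / real n + 1 / (2 * (real n)\<^sup>2) + ln (2 * pi * real n) / (2 * real n)) * n < k\<^sup>2 / 2 * n"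
        using elim by (intro mult_strict_right_mono) auto
      moreover have "(k / real n + 1 / (2 * (real n)\<^sup>2) + ln (2 * pi * real n) / (2 * real n)) * n
          = k + 1 / (2 * n) + ln (2 * pi * n) / 2"
        using elim(2) by (simp add: field_simps power2_eq_square)
      moreover have "(k * n + 1)\<^sup>2 / (2 * n) = k\<^sup>2 / 2 * n + k + 1 / (2 * n)"
        using elim(2) by (simp add: field_simps power2_eq_square)
      ultimately show ?thesis by simp
    qed
    also have "\<dots> = exp (- (k * n + 1)\<^sup>2 / (2 * n)) / exp (ln (2 * pi * n) / 2)"
      by (rule exp_diff)
    also have "exp (ln (2 * pi * n) / 2) = sqrt (2 * pi * n)"
      using elim(2) by (simp add: ln_sqrt[symmetric])
    also have "exp (- (k * n + 1)\<^sup>2 / (2 * n)) / sqrt (2 * pi * n) \<le> tail_prob M \<beta> H n x ?u"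
      using tail_prob_lower[OF elim(2) x u] \<beta>_pos by (simp add: mult.commute)
    finally have lt: "tail_prob M \<beta> H n x (c n) < tail_prob M \<beta> H n x ?u"
      using tail_c[OF elim(2) x] by simp
    have "?u < c n"
      using tail_prob_antimono[OF elim(2) x, of "c n" ?u] lt by linarith
    then have "0 < c n"
      using less_trans[OF exp_gt_zero] by blast
    moreover from this \<open>?u < c n\<close> have "ln ?u < ln (c n)"
      by (subst ln_less_cancel_iff) auto
    ultimately show ?case by (simp add: k_def)
  qed
qed

text \<open>The Gaussian upper tail at level \<open>c n\<close>; together with
  \<open>beta_c \<epsilon> < \<beta>\<close> it keeps the exponent \<open>alpha_n\<close> at most
  1.\<close>

lemma ln_c_le:
  assumes n: "1 < n" and c: "1 \<le> c n"
  shows "ln (c n) \<le> n * \<beta> * beta_c \<epsilon>"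
proof -
  obtain x where x: "x \<in> hypercube n" using hypercube_nonempty[of n] by blast
  have "2 powr (- (\<epsilon> * real n)) \<le> exp (- (ln (c n) / \<beta>)\<^sup>2 / (2 * n))"
    using tail_prob_upper[OF n x c] tail_c[OF n x] by simp
  moreover have "2 powr (- (\<epsilon> * real n)) = exp (- (\<epsilon> * n * ln 2))" by (simp add: powr_def)
  ultimately have "(ln (c n) / \<beta>)\<^sup>2 / (2 * n) \<le> \<epsilon> * n * ln 2" by simp
  then have "(ln (c n))\<^sup>2 \<le> (real n)\<^sup>2 * \<beta>\<^sup>2 * (2 * \<epsilon> * ln 2)"
    using n \<beta>_pos by (simp add: power_divide field_simps power2_eq_square)
  also have "\<dots> = (n * \<beta> * beta_c \<epsilon>)\<^sup>2"
    using \<epsilon> by (simp add: beta_c_def power_mult_distrib)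
  finally show ?thesis
    by (rule power2_le_imp_le) (use \<beta>_pos beta_c_pos[OF \<epsilon>(1)] in simp)
qed

definition threshold :: "nat \<Rightarrow> real" where
  "threshold n = c n * inverse ((real n)\<^sup>2 * \<theta> n)"

text \<open>The deterministic part of "n large". \<open>16 \<le> n\<close> turns numerical constants
  into powers of \<open>n\<close>, \<open>1 \<le> threshold n\<close> puts the top set above
  \<open>1 / r n\<close>, \<open>\<theta> n \<le> 2 ^ (n - 1)\<close> serves
  \<open>green_bound\<close>, and the two half-pole conditions keep the argument of
  \<open>F_fun\<close> away from its pole.\<close>

definition regular :: "nat \<Rightarrow> bool" where
  "regular n \<longleftrightarrow> 16 \<le> n \<and> 1 \<le> c n \<and> 1 \<le> threshold n \<and> ln (\<theta> n) \<le> n * \<beta> * beta_c \<epsilon> / 2 \<and>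
     \<theta> n \<le> 2 ^ (n - 1) \<and> ln (real n ^ 4 * r n) \<le> n * \<beta> * beta_c \<epsilon> / 2 \<and> 16 * ln n \<le> n * \<beta>\<^sup>2"

lemma eventually_regular: "\<forall>\<^sub>F n in sequentially. regular n"
proof -
  define k where "k = \<beta> * sqrt (\<epsilon> * ln 2)"
  define d where "d = \<beta> * beta_c \<epsilon> / 2"
  have pos: "0 < k" "0 < d" "0 < \<beta>\<^sup>2 / 16"
    using \<beta>_pos \<epsilon> beta_c_pos by (auto simp: k_def d_def)
  have l1: "(\<lambda>n. 2 * (ln (real n) / n) + ln (\<theta> n) / n) \<longlonglongrightarrow> 2 * 0 + 0"
    by (intro tendsto_intros ln_n_over_n \<theta>_lim)
  have l2: "(\<lambda>n. 4 * (ln (real n) / n) + ln (r n) / n) \<longlonglongrightarrow> 4 * 0 + 0"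
    by (intro tendsto_intros ln_n_over_n ln_r_over_n)
  have "\<forall>\<^sub>F n in sequentially. 2 * (ln (real n) / n) + ln (\<theta> n) / n < k"
    using pos by (intro order_tendstoD(2)[OF l1]) auto
  moreover have "\<forall>\<^sub>F n in sequentially. 4 * (ln (real n) / n) + ln (r n) / n < d"
    using pos by (intro order_tendstoD(2)[OF l2]) auto
  moreover have "\<forall>\<^sub>F n in sequentially. ln (\<theta> n) / n < d"
    using pos by (intro order_tendstoD(2)[OF \<theta>_lim]) auto
  moreover have "\<forall>\<^sub>F n in sequentially. ln (\<theta> n) / n < ln 2 / 2"
    by (intro order_tendstoD(2)[OF \<theta>_lim]) auto
  moreover have "\<forall>\<^sub>F n in sequentially. ln (real n) / n < \<beta>\<^sup>2 / 16"
    using pos by (intro order_tendstoD(2)[OF ln_n_over_n]) auto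
  ultimately show ?thesis
    using eventually_ln_c_ge eventually_ge_at_top[of 16]
  proof eventually_elim
    case (elim n)
    have n: "1 < n" "0 < real n" using elim(7) by auto
    have \<theta>1: "1 < \<theta> n" and r1: "1 < r n" using \<theta>_gt_1 r_gt_1 n by auto
    have c: "k * n \<le> ln (c n)" "0 < c n" using elim(6) by (auto simp: k_def)
    have c1: "1 \<le> c n"
    proof -
      have "0 < k * n" using pos n by simp
      then have "0 < ln (c n)" using c(1) by linarith
      then show ?thesis using c(2) by (simp add: ln_gt_zero_iff)
    qed
    have "2 * ln n + ln (\<theta> n) < k * n" using elim(1) n by (simp add: field_simps)
    then have "ln ((real n)\<^sup>2 * \<theta> n) \<le> ln (c n)"
      using c(1) n \<theta>1 by (simp add: ln_mult ln_realpow)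
    then have "(real n)\<^sup>2 * \<theta> n \<le> c n" using c(2) n \<theta>1 by (subst (asm) ln_le_cancel_iff) auto
    then have thr: "1 \<le> threshold n"
      unfolding threshold_def using n \<theta>1 by (simp add: divide_inverse[symmetric])
    have "4 * ln n + ln (r n) \<le> d * n" using elim(2) n by (simp add: field_simps)
    then have L: "ln (real n ^ 4 * r n) \<le> n * \<beta> * beta_c \<epsilon> / 2"
      using n r1 by (simp add: ln_mult ln_realpow d_def mult_ac)
    have "ln (\<theta> n) \<le> d * n" using elim(3) n by (simp add: field_simps)
    then have th: "ln (\<theta> n) \<le> n * \<beta> * beta_c \<epsilon> / 2" by (simp add: d_def mult_ac)
    have "ln (\<theta> n) \<le> n / 2 * ln 2" using elim(4) n by (simp add: field_simps)
    also have "\<dots> \<le> real (n - 1) * ln 2" using elim(7) by (intro mult_right_mono) auto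
    also have "\<dots> = ln (2 ^ (n - 1))" by (simp add: ln_realpow)
    finally have "\<theta> n \<le> 2 ^ (n - 1)" using \<theta>1 by (subst (asm) ln_le_cancel_iff) auto
    moreover have "16 * ln n \<le> n * \<beta>\<^sup>2" using elim(5) n by (simp add: field_simps)
    ultimately show ?case
      using elim(7) c1 thr th L by (simp add: regular_def)
  qed
qed

end

section \<open>Polynomial corrections and almost sure bounds on b\<close>

context scaling_window
begin

lemma alpha_n_bounds:
  assumes "regular n"
  shows "0 \<le> alpha_n \<beta> n (c n)" "alpha_n \<beta> n (c n) \<le> 1"
proof -
  have n: "1 < n" and c: "1 \<le> c n" using assms by (auto simp: regular_def)
  show "0 \<le> alpha_n \<beta> n (c n)" using c by (simp add: alpha_n_def)
  have "ln (c n) \<le> real n * \<beta> * \<beta>"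
    using ln_c_le[OF n c] \<beta>_gt \<beta>_pos n by (meson mult_left_mono less_imp_le mult_nonneg_nonneg of_nat_0_le_iff order_trans)
  then show "alpha_n \<beta> n (c n) \<le> 1"
    using n \<beta>_pos by (simp add: alpha_n_def power2_eq_square mult.assoc)
qed

lemma b_bounds_of_good_environment:
  fixes Y :: "real \<Rightarrow> 'v \<Rightarrow> vertex"
  assumes reg: "regular n"
    and process: "markov_jump_process (hypercube n) (jump_rate n (r n) (\<tau> n w))
      (inv_measure n (r n) (\<tau> n w)) Q Y"
    and ne: "high_set n (threshold n) w \<noteq> {}"
    and cl: "(\<Sum>x\<in>high_set n (threshold n) w. real (card (cluster n (r n) (\<tau> n w) x)))
      \<le> 4 * (real n)\<^sup>2 * card (high_set n (threshold n) w)"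
    and most: "card (high_set n (threshold n) w) \<le> 2 * card {x \<in> high_set n (threshold n) w.
      card (cluster n (r n) (\<tau> n w) x) \<le> 16 * n\<^sup>2 \<and>
      2 * card {y \<in> hypercube n. \<exists>i\<le>n. \<tau> n w (interpolate x y i) < 1 / r n} \<le> 2 ^ n}"
  defines "b \<equiv> b_fun \<beta> \<epsilon> n (r n) (c n) (\<theta> n) (\<tau> n w) Q Y"
  shows "inverse (real n powr (2 * c_star + 6) * r n powr (1 + alpha_n \<beta> n (c n))) \<le> b"
    and "b \<le> real n powr 4 * r n powr (1 + alpha_n \<beta> n (c n))"
proof -
  let ?T = "high_set n (threshold n) w" and ?a = "alpha_n \<beta> n (c n)"
  have n16: "16 \<le> n" using reg by (simp add: regular_def)
  then have n: "1 < n" "0 < n" "16 \<le> real n" by auto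
  have r1: "1 < r n" and \<theta>1: "1 < \<theta> n" using r_gt_1 \<theta>_gt_1 n by auto
  have a: "0 \<le> ?a" "?a \<le> 1" using alpha_n_bounds[OF reg] by auto
  interpret ex: exploration_F n "r n" "\<tau> n w" Q Y \<beta> \<epsilon> "c n" "\<theta> n"
  proof
    show "1 \<le> \<theta> n * r n"
      using mult_mono[of 1 "\<theta> n" 1 "r n"] r1 \<theta>1 by simp
  qed (use n r1 \<theta>1 a reg process \<beta>_pos beta_c_pos[OF \<epsilon>(1)] in \<open>auto simp: regular_def tau_def\<close>)
  have T: "ex.T = ?T"
    by (simp add: top_set_def high_set_def threshold_def)
  have high: "1 / r n \<le> \<tau> n w x" if "x \<in> ex.T" for x
  proof -
    have "1 / r n \<le> 1" using r1 by simp
    also have "1 \<le> threshold n" using reg by (simp add: regular_def)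
    also have "threshold n \<le> \<tau> n w x" using that by (simp add: T high_set_def)
    finally show ?thesis .
  qed
  have "b \<le> 6 * (4 * (real n)\<^sup>2) * r n powr (1 - ?a)"
    unfolding b_def using ne cl T by (intro ex.b_upper high) auto
  also have "\<dots> \<le> real n ^ 4 * r n powr (1 + ?a)"
  proof (rule mult_mono)
    have "16 * 16 \<le> real n * real n" using n by (intro mult_mono) auto
    then have "24 * (real n)\<^sup>2 \<le> (real n * real n) * (real n)\<^sup>2"
      by (intro mult_right_mono) auto
    then show "6 * (4 * (real n)\<^sup>2) \<le> real n ^ 4"
      by (simp add: power2_eq_square power4_eq_xxxx mult.assoc)
    show "r n powr (1 - ?a) \<le> r n powr (1 + ?a)"
      using r1 a by (intro powr_mono) auto
  qed auto
  also have "real n ^ 4 = real n powr 4" using n by simp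
  finally show "b \<le> real n powr 4 * r n powr (1 + ?a)" .

  \<comment> \<open>Large enough for both conditions of \<open>b_lower\<close>: four times the Green
    function is at most \<open>12 * n ^ 3 * r n\<close>, and the cluster condition asks for
    \<open>128 * n\<^sup>2 * r n\<close>; \<open>16 \<le> n\<close> covers both constants.\<close>
  define L where "L = real n ^ 4 * r n"
  define T' where "T' = {x \<in> ?T. card (cluster n (r n) (\<tau> n w) x) \<le> 16 * n\<^sup>2 \<and>
      2 * card {y \<in> hypercube n. \<exists>i\<le>n. \<tau> n w (interpolate x y i) < 1 / r n} \<le> 2 ^ n}"
  have n_pow: "real n ^ 4 = real n ^ 3 * real n" "real n ^ 4 = (real n)\<^sup>2 * (real n * real n)"
    by (simp_all add: power_numeral_reduce)
  have n3: "1 \<le> real n ^ 3" using n by simp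
  have L1: "1 \<le> L"
    unfolding L_def using mult_mono[of 1 "real n ^ 4" 1 "r n"] n r1 by simp
  have lnL: "ln L \<le> n * \<beta> * beta_c \<epsilon> / 2" using reg by (simp add: regular_def L_def)
  have "L powr (?a - 1) * exp (- (ln L)\<^sup>2 / (2 * real n * \<beta>\<^sup>2)) / 16 \<le> b"
    unfolding b_def
  proof (rule ex.b_lower[OF high _ L1 lnL, of T'])
    show "ex.T \<noteq> {}" using ne T by simp
    show "T' \<subseteq> ex.T" unfolding T by (auto simp: T'_def)
    show "card ex.T \<le> 2 * card T'" unfolding T T'_def by (rule most)
  next
    fix x assume x: "x \<in> T'"
    have "ex.green (\<theta> n) x x \<le> real n ^ 3 * r n + 2"
      using x \<theta>1 reg by (intro ex.green_bound) (auto simp: T'_def high_set_def regular_def)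
    also have "\<dots> \<le> real n ^ 3 * r n + 2 * (real n ^ 3 * r n)"
    proof -
      have "1 \<le> real n ^ 3 * r n" using mult_mono[of 1 "real n ^ 3" 1 "r n"] n3 r1 by simp
      then show ?thesis by linarith
    qed
    finally have "4 * ex.green (\<theta> n) x x \<le> 12 * (real n ^ 3 * r n)" by simp
    also have "\<dots> \<le> real n * (real n ^ 3 * r n)"
      using n r1 by (intro mult_right_mono) auto
    finally show "4 * ex.green (\<theta> n) x x \<le> L" by (simp add: L_def n_pow(1) mult_ac)
    have "real (card (cluster n (r n) (\<tau> n w) x)) \<le> real (16 * n\<^sup>2)"
      using x unfolding T'_def by (simp only: of_nat_le_iff) simp
    then have "8 * card (cluster n (r n) (\<tau> n w) x) * r n \<le> 128 * (real n)\<^sup>2 * r n"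
      using r1 by (intro mult_right_mono) auto
    also have "\<dots> \<le> (real n * real n) * (real n)\<^sup>2 * r n"
      using mult_mono[of 16 "real n" 16 "real n"] n r1 by (intro mult_right_mono) auto
    finally show "8 * card (cluster n (r n) (\<tau> n w) x) * r n \<le> L"
      by (simp add: L_def n_pow(2) mult_ac)
  qed
  moreover have "inverse (real n powr (2 * c_star + 6) * r n powr (1 + ?a))
      \<le> L powr (?a - 1) * exp (- (ln L)\<^sup>2 / (2 * real n * \<beta>\<^sup>2)) / 16"
  proof -
    have ln_n: "0 < ln (real n)" using n by simp
    have lnL_eq: "ln L = 4 * ln n + ln (r n)"
      unfolding L_def using n r1 by (simp add: ln_mult ln_realpow)
    \<comment> \<open>The two parts of \<open>ln L\<close> are separated at the cost of a factor 2:
      the \<open>r\<close> part gives the exponent \<open>2 * c_star\<close>, and the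
      \<open>n\<close> part is small enough to add only 1.\<close>
    have "(ln L)\<^sup>2 \<le> 2 * (4 * ln n)\<^sup>2 + 2 * (ln (r n))\<^sup>2"
      unfolding lnL_eq using sum_squares_bound[of "4 * ln n" "ln (r n)"] by (simp add: power2_sum)
    also have "\<dots> \<le> 2 * ln n * (16 * ln n) + 2 * (2 * real n * \<beta>\<^sup>2 * c_star * ln n)"
    proof -
      have "2 * (4 * ln (real n))\<^sup>2 = 2 * ln n * (16 * ln n)" by (simp add: power2_eq_square)
      then show ?thesis using ln_r_sq_le[OF n(1)] by linarith
    qed
    also have "\<dots> \<le> 2 * ln n * (n * \<beta>\<^sup>2) + 2 * (2 * real n * \<beta>\<^sup>2 * c_star * ln n)"
      using reg ln_n by (intro add_right_mono mult_left_mono) (auto simp: regular_def)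
    also have "\<dots> = (2 * c_star + 1) * ln n * (2 * real n * \<beta>\<^sup>2)"
      by (simp add: algebra_simps)
    finally have "(ln L)\<^sup>2 / (2 * real n * \<beta>\<^sup>2) \<le> (2 * c_star + 1) * ln n"
      using n \<beta>_pos by (simp add: pos_divide_le_eq)
    then have "exp (- ((2 * c_star + 1) * ln n)) \<le> exp (- ((ln L)\<^sup>2 / (2 * real n * \<beta>\<^sup>2)))"
      by (simp only: exp_le_cancel_iff neg_le_iff_le)
    moreover have "real n powr - (2 * c_star + 1) = exp (- ((2 * c_star + 1) * ln n))"
      using n by (simp add: powr_def algebra_simps)
    ultimately have 1: "real n powr - (2 * c_star + 1) \<le> exp (- (ln L)\<^sup>2 / (2 * real n * \<beta>\<^sup>2))"
      by (simp only: minus_divide_left)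
    have "real n powr (-4) * r n powr - (1 + ?a) \<le> real n powr (4 * (?a - 1)) * r n powr (?a - 1)"
      using n r1 a by (intro mult_mono powr_mono) auto
    also have "\<dots> = L powr (?a - 1)"
      using powr_powr[of "real n" 4 "?a - 1"] n r1 by (simp add: L_def powr_mult)
    finally have 2: "real n powr (-4) * r n powr - (1 + ?a) \<le> L powr (?a - 1)" .
    have 3: "real n powr (-1) \<le> 1 / 16"
      using n by (simp add: powr_minus inverse_eq_divide divide_left_mono)
    \<comment> \<open>The exponent splits into 4 from the power of \<open>L\<close>,
      \<open>2 * c_star + 1\<close> from the Gaussian factor, and 1 from the constant 1/16.\<close>
    have "real n powr - (2 * c_star + 6)
        = real n powr (-4) * real n powr - (2 * c_star + 1) * real n powr (-1)"
      unfolding powr_add[symmetric] by (simp add: algebra_simps)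
    then have "inverse (real n powr (2 * c_star + 6) * r n powr (1 + ?a))
        = (real n powr (-4) * r n powr - (1 + ?a)) * real n powr - (2 * c_star + 1) * real n powr (-1)"
      by (simp only: inverse_mult_distrib powr_minus[symmetric] mult_ac)
    also have "\<dots> \<le> L powr (?a - 1) * exp (- (ln L)\<^sup>2 / (2 * real n * \<beta>\<^sup>2)) * (1 / 16)"
      using 1 2 3 by (intro mult_mono) auto
    finally show ?thesis by simp
  qed
  ultimately show "inverse (real n powr (2 * c_star + 6) * r n powr (1 + ?a)) \<le> b" by linarith
qed

text \<open>The convergence half of the Borel-Cantelli lemma, which asks nothing about dependence
  between different \<open>n\<close>. The exceptional events are built from the environment alone,
  before any jump process is chosen.\<close>

lemma AE_good_environment:
  "AE w in M. \<forall>\<^sub>F n in sequentially. regular n \<and>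
    high_set n (threshold n) w \<noteq> {} \<and>
    (\<Sum>x\<in>high_set n (threshold n) w. real (card (cluster n (r n) (\<tau> n w) x)))
      \<le> 4 * (real n)\<^sup>2 * card (high_set n (threshold n) w) \<and>
    card (high_set n (threshold n) w) \<le> 2 * card {x \<in> high_set n (threshold n) w.
      card (cluster n (r n) (\<tau> n w) x) \<le> 16 * n\<^sup>2 \<and>
      2 * card {y \<in> hypercube n. \<exists>i\<le>n. \<tau> n w (interpolate x y i) < 1 / r n} \<le> 2 ^ n}"
proof -
  define good where "good n w \<longleftrightarrow> high_set n (threshold n) w \<noteq> {} \<and>
    (\<Sum>x\<in>high_set n (threshold n) w. real (card (cluster n (r n) (\<tau> n w) x)))
      \<le> 4 * (real n)\<^sup>2 * card (high_set n (threshold n) w) \<and>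
    card (high_set n (threshold n) w) \<le> 2 * card {x \<in> high_set n (threshold n) w.
      card (cluster n (r n) (\<tau> n w) x) \<le> 16 * n\<^sup>2 \<and>
      2 * card {y \<in> hypercube n. \<exists>i\<le>n. \<tau> n w (interpolate x y i) < 1 / r n} \<le> 2 ^ n}" for n w
  \<comment> \<open>Failure bounds for the size of the top set, for clusters and for obstructions.
    They are summable because the mean size is at least 2^((1 - \<epsilon>) n), by the choice of n^2
    in the cluster count, and because \<open>c_star > 2\<close>.\<close>
  define g where "g n = 4 * (2 powr (\<epsilon> - 1)) ^ n + 1 / (real n)\<^sup>2 + 16 * real n powr (1 - c_star)" for n
  have summable_g: "summable g"
  proof -
    have "2 powr (\<epsilon> - 1) < (1 :: real)"
      using powr_less_mono[of "\<epsilon> - 1" 0 2] \<epsilon> by simp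
    then have "summable (\<lambda>n. (2 powr (\<epsilon> - 1)) ^ n :: real)"
      by (intro summable_geometric) simp
    moreover have "summable (\<lambda>n. 1 / (real n)\<^sup>2)"
      using inverse_power_summable[of 2, where 'a = real] by (simp add: inverse_eq_divide)
    moreover have "summable (\<lambda>n. real n powr (1 - c_star))"
      using c_star by (simp add: summable_real_powr_iff)
    ultimately show ?thesis
      unfolding g_def by (intro summable_add summable_mult)
  qed
  have ex: "\<exists>E\<in>events. prob E \<le> g n \<and> (\<forall>w\<in>space M - E. good n w)" if reg: "regular n" for n
  proof -
    have n: "1 < n" and thr: "1 \<le> threshold n" and c1: "1 \<le> c n" using reg by (auto simp: regular_def)
    have r1: "1 < r n" and \<theta>1: "1 < \<theta> n" using r_gt_1 \<theta>_gt_1 n by auto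
    obtain x0 where x0: "x0 \<in> hypercube n" using hypercube_nonempty[of n] by blast
    define pT where "pT = tail_prob M \<beta> H n x0 (threshold n)"
    have pT: "tail_prob M \<beta> H n x (threshold n) = pT" if "x \<in> hypercube n" for x
      unfolding pT_def using thr by (intro tail_prob_vertex_indep n that x0) simp
    have "1 \<le> (real n)\<^sup>2 * \<theta> n"
      using mult_mono[of 1 "(real n)\<^sup>2" 1 "\<theta> n"] n \<theta>1 by simp
    then have "c n * inverse ((real n)\<^sup>2 * \<theta> n) \<le> c n * 1"
      using c1 le_imp_inverse_le[of 1 "(real n)\<^sup>2 * \<theta> n"] by (intro mult_left_mono) auto
    then have "threshold n \<le> c n" by (simp add: threshold_def)
    then have pT_ge: "2 powr (- (\<epsilon> * real n)) \<le> pT"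
      using tail_prob_antimono[OF n x0, of "threshold n" "c n"] tail_c[OF n x0] by (simp add: pT_def)
    have pT_pos: "0 < pT" using pT_ge less_le_trans[of 0 "2 powr (- (\<epsilon> * real n))"] by simp
    have np_eq: "n * real n powr (- c_star) = real n powr (1 - c_star)"
      using n by (simp add: powr_diff powr_minus divide_inverse)
    have "real n powr (1 - c_star) \<le> real n powr (- 1)" using n c_star by (intro powr_mono) auto
    also have "\<dots> \<le> 1 / 2" using n by (simp add: powr_minus inverse_eq_divide divide_left_mono)
    finally have np: "n * real n powr (- c_star) \<le> 1 / 2" by (simp add: np_eq)
    have r: "0 < r n" "1 / r n \<le> threshold n"
    proof -
      have "1 / r n \<le> 1" using r1 by simp
      then show "0 < r n" "1 / r n \<le> threshold n" using r1 thr by linarith+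
    qed
    obtain E where E: "E \<in> events"
      "prob E \<le> 4 / (2 ^ n * pT) + 1 / (real n)\<^sup>2 + 16 * (n * real n powr (- c_star))"
      "\<And>w. w \<in> space M - E \<Longrightarrow> good n w"
      using good_environment[OF n pT pT_pos tail_r[OF n] np r] unfolding good_def by blast
    have "4 / (2 ^ n * pT) \<le> 4 * (2 powr (\<epsilon> - 1)) ^ n"
    proof -
      have "2 ^ n * 2 powr (- (\<epsilon> * real n)) \<le> 2 ^ n * pT" using pT_ge by simp
      then have "4 / (2 ^ n * pT) \<le> 4 / (2 ^ n * 2 powr (- (\<epsilon> * real n)))"
        by (intro divide_left_mono mult_pos_pos) (use pT_pos in auto)
      also have "\<dots> = 4 * (2 powr (\<epsilon> - 1)) ^ n"
        by (simp add: powr_minus powr_diff powr_powr[symmetric] powr_realpow power_divide field_simps)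
      finally show ?thesis .
    qed
    then have "prob E \<le> g n" using E(2) by (simp add: g_def np_eq)
    then show ?thesis using E by blast
  qed
  \<comment> \<open>The empty set at irregular indices makes measurability and the bound by
    \<open>g n\<close> hold for every \<open>n\<close>.\<close>
  define E where "E n = (if regular n then SOME E. E \<in> events \<and> prob E \<le> g n \<and> (\<forall>w\<in>space M - E. good n w)
    else {})" for n
  have E: "E n \<in> events \<and> prob (E n) \<le> g n \<and> (\<forall>w\<in>space M - E n. good n w)" if "regular n" for n
    using someI_ex[of "\<lambda>E. E \<in> events \<and> prob E \<le> g n \<and> (\<forall>w\<in>space M - E. good n w)"] ex[OF that] that
    unfolding E_def by (simp add: Bex_def)
  have g0: "0 \<le> g n" for n by (simp add: g_def)
  have "AE w in M. \<forall>\<^sub>F n in sequentially. w \<in> space M - E n"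
  proof (rule borel_cantelli_AE1)
    show "E n \<in> events" for n using E[of n] by (cases "regular n") (auto simp: E_def)
    show "summable (\<lambda>n. measure M (E n))"
    proof (rule summable_comparison_test'[OF summable_g])
      show "norm (prob (E n)) \<le> g n" for n
        using E[of n] g0[of n] by (cases "regular n") (auto simp: E_def)
    qed
  qed (simp add: emeasure_eq_measure)
  then show ?thesis
  proof eventually_elim
    case (elim w)
    show ?case
      using elim eventually_regular
    proof eventually_elim
      case (elim n)
      then have "good n w" using E[of n] by blast
      then show ?case using elim(2) unfolding good_def by blast
    qed
  qed
qed

text \<open>The bounds on \<open>b\<close> hold pointwise on good environments. Hence they are
  almost sure even though \<open>P n w\<close> and \<open>Y n w\<close> may depend on
  \<open>w\<close> in an arbitrary, possibly non-measurable way.\<close>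

lemma AE_b_bounds:
  fixes P :: "nat \<Rightarrow> 'w \<Rightarrow> 'v measure" and Y :: "nat \<Rightarrow> 'w \<Rightarrow> real \<Rightarrow> 'v \<Rightarrow> vertex"
  assumes process: "\<And>n w. 1 < n \<Longrightarrow> w \<in> space M \<Longrightarrow>
    markov_jump_process (hypercube n) (jump_rate n (r n) (\<tau> n w)) (inv_measure n (r n) (\<tau> n w))
      (P n w) (Y n w)"
  shows "AE w in M. \<forall>\<^sub>F n in sequentially.
    inverse (real n powr (2 * c_star + 6) * r n powr (1 + alpha_n \<beta> n (c n)))
      \<le> b_fun \<beta> \<epsilon> n (r n) (c n) (\<theta> n) (\<tau> n w) (P n w) (Y n w) \<and>
    b_fun \<beta> \<epsilon> n (r n) (c n) (\<theta> n) (\<tau> n w) (P n w) (Y n w)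
      \<le> real n powr 4 * r n powr (1 + alpha_n \<beta> n (c n))"
  using AE_good_environment AE_space
proof eventually_elim
  case (elim w)
  show ?case
    using elim(1)
  proof eventually_elim
    case good: (elim n)
    then have "1 < n" by (auto simp: regular_def)
    then show ?case
      using good b_bounds_of_good_environment[OF _ process[OF _ elim(2)]] by blast
  qed
qed

text \<open>Both bounds on \<open>b n\<close> are subexponential because \<open>ln (r n) = o(n)\<close>.\<close>

lemma ln_ratio_limit:
  assumes b: "\<forall>\<^sub>F n in sequentially.
      inverse (real n powr k * r n powr (1 + alpha_n \<beta> n (c n))) \<le> b n \<and>
      b n \<le> real n powr 4 * r n powr (1 + alpha_n \<beta> n (c n))"
    and k: "4 \<le> k"
  shows "(\<lambda>n. ln (2 powr (\<epsilon> * real n) / b n) / real n) \<longlonglongrightarrow> \<epsilon> * ln 2"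
proof -
  have "(\<lambda>n. ln (b n) / real n) \<longlonglongrightarrow> 0"
  proof (rule Lim_null_comparison)
    have "(\<lambda>n. k * (ln (real n) / real n) + 2 * (ln (r n) / real n)) \<longlonglongrightarrow> k * 0 + 2 * 0"
      by (intro tendsto_intros ln_n_over_n ln_r_over_n)
    then show "(\<lambda>n. k * (ln (real n) / real n) + 2 * (ln (r n) / real n)) \<longlonglongrightarrow> 0" by simp
    show "\<forall>\<^sub>F n in sequentially. norm (ln (b n) / real n)
        \<le> k * (ln (real n) / real n) + 2 * (ln (r n) / real n)"
      using b eventually_regular
    proof eventually_elim
      case (elim n)
      let ?a = "alpha_n \<beta> n (c n)"
      have n: "1 < n" using elim(2) by (simp add: regular_def)
      have r1: "1 < r n" using r_gt_1[OF n] .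
      have lnpos: "0 < ln (real n)" "0 < ln (r n)" using n r1 by auto
      have up: "0 < real n powr k * r n powr (1 + ?a)" using n r1 by simp
      have b0: "0 < b n" using elim(1) up by (meson inverse_positive_iff_positive less_le_trans)
      have "ln (inverse (real n powr k * r n powr (1 + ?a))) \<le> ln (b n)"
        using elim(1) ln_le_cancel_iff[OF positive_imp_inverse_positive[OF up] b0] by blast
      then have lo: "- (k * ln n + (1 + ?a) * ln (r n)) \<le> ln (b n)"
        using n r1 by (simp add: ln_inverse ln_mult ln_powr)
      have "ln (b n) \<le> ln (real n powr 4 * r n powr (1 + ?a))"
        using elim(1) n r1 b0 by (subst ln_le_cancel_iff) auto
      then have hi: "ln (b n) \<le> 4 * ln n + (1 + ?a) * ln (r n)"
        using n r1 by (simp add: ln_mult ln_powr ln_realpow)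
      have "(1 + ?a) * ln (r n) \<le> 2 * ln (r n)"
        using alpha_n_bounds[OF elim(2)] lnpos by (intro mult_right_mono) auto
      moreover have "4 * ln n \<le> k * ln n" using k lnpos by (intro mult_right_mono) auto
      ultimately have "\<bar>ln (b n)\<bar> \<le> k * ln n + 2 * ln (r n)" using lo hi by linarith
      then have "\<bar>ln (b n)\<bar> / n \<le> (k * ln n + 2 * ln (r n)) / n" by (rule divide_right_mono) simp
      then show ?case by (simp add: add_divide_distrib)
    qed
  qed
  then have "(\<lambda>n. \<epsilon> * ln 2 - ln (b n) / real n) \<longlonglongrightarrow> \<epsilon> * ln 2 - 0"
    by (intro tendsto_intros)
  moreover have "\<forall>\<^sub>F n in sequentially. ln (2 powr (\<epsilon> * real n) / b n) / real n = \<epsilon> * ln 2 - ln (b n) / real n"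
    using b eventually_gt_at_top[of 1]
  proof eventually_elim
    case (elim n)
    have "0 < real n powr k * r n powr (1 + alpha_n \<beta> n (c n))"
      using elim(2) r_gt_1[OF elim(2)] by simp
    then have "0 < b n" using elim(1) by (meson inverse_positive_iff_positive less_le_trans)
    then show ?case using elim(2) by (simp add: ln_div ln_powr diff_divide_distrib)
  qed
  ultimately show ?thesis
    using tendsto_cong by fastforce
qed

end

theorem proposition1p5:
  fixes c_star :: real
  assumes "c_star > 1 + ln 4"
  shows "\<exists>c_minus>0. \<exists>c_plus>0.
    \<forall>(M :: 'w measure) (H :: nat \<Rightarrow> vertex \<Rightarrow> 'w \<Rightarrow> real) (\<beta> :: real) (\<epsilon> :: real)
      (r :: nat \<Rightarrow> real) (c :: nat \<Rightarrow> real) (\<theta> :: nat \<Rightarrow> real)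
      (P :: nat \<Rightarrow> 'w \<Rightarrow> 'v measure) (Y :: nat \<Rightarrow> 'w \<Rightarrow> real \<Rightarrow> 'v \<Rightarrow> vertex).
      gaussian_environment M H \<and>
      0 < \<epsilon> \<and> \<epsilon> < 1 \<and> \<beta> > 0 \<and> \<beta> > beta_c \<epsilon> \<and>
      (\<forall>n>1. \<forall>x\<in>hypercube n. real n powr c_star * tail_prob M \<beta> H n x (r n) = 1) \<and>
      (\<forall>n>1. \<forall>x\<in>hypercube n. 2 powr (\<epsilon> * real n) * tail_prob M \<beta> H n x (c n) = 1) \<and>
      (\<forall>n>1. \<theta> n > 0 \<and> 4 / (1 - alpha \<beta> \<epsilon>) * ln (r n) < ln (\<theta> n)) \<and>
      (\<lambda>n. ln (\<theta> n) / real n) \<longlonglongrightarrow> 0 \<and>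
      (\<forall>n>1. \<forall>w\<in>space M.
         markov_jump_process (hypercube n) (jump_rate n (r n) (tau \<beta> H n w))
           (inv_measure n (r n) (tau \<beta> H n w)) (P n w) (Y n w))
      \<longrightarrow>
      (let b = (\<lambda>n w. b_fun \<beta> \<epsilon> n (r n) (c n) (\<theta> n) (tau \<beta> H n w) (P n w) (Y n w));
           a = (\<lambda>n w. 2 powr (\<epsilon> * real n) / b n w)
       in
         (\<exists>\<delta> :: nat \<Rightarrow> real. \<delta> \<longlonglongrightarrow> 0 \<and>
            (AE w in M. \<forall>\<^sub>F n in sequentially.
               inverse (real n powr c_minus * r n powr (1 + alpha_n \<beta> n (c n) + \<delta> n)) \<le> b n w \<and>
               b n w \<le> real n powr c_plus * r n powr (1 + alpha_n \<beta> n (c n)))) \<and>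
         (AE w in M. (\<lambda>n. ln (a n w) / real n) \<longlonglongrightarrow> \<epsilon> * ln 2))"
proof -
  \<comment> \<open>Since e \<le> 4, the lower bound on \<open>c_star\<close> gives
    \<open>c_star > 2\<close>, the form in which it drives summability.\<close>
  have "exp (1 :: real) \<le> 4" using exp_le by linarith
  then have "1 \<le> ln (4 :: real)" by (subst ln_ge_iff) auto
  then have cs: "2 < c_star" using assms by linarith
  show ?thesis
  \<comment> \<open>Both exponents are fixed before the environment, and they depend on
    \<open>c_star\<close> at most.\<close>
  proof (rule exI[of _ "2 * c_star + 6"], rule conjI[OF _ exI[of _ 4]], goal_cases)
    case 2
    show ?case
    proof (intro conjI allI impI, goal_cases)
      case (2 M H \<beta> \<epsilon> r c \<theta> P Y)
      then interpret scaling_window M H \<beta> \<epsilon> r c \<theta> c_star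
        using cs by unfold_locales auto
      let ?b = "\<lambda>n w. b_fun \<beta> \<epsilon> n (r n) (c n) (\<theta> n) (tau \<beta> H n w) (P n w) (Y n w)"
      have bounds: "AE w in M. \<forall>\<^sub>F n in sequentially.
          inverse (real n powr (2 * c_star + 6) * r n powr (1 + alpha_n \<beta> n (c n))) \<le> ?b n w \<and>
          ?b n w \<le> real n powr 4 * r n powr (1 + alpha_n \<beta> n (c n))"
        using 2 by (intro AE_b_bounds) auto
      have lim: "AE w in M. (\<lambda>n. ln (2 powr (\<epsilon> * real n) / ?b n w) / real n) \<longlonglongrightarrow> \<epsilon> * ln 2"
        using bounds by eventually_elim (rule ln_ratio_limit, assumption, use cs in simp)
      show ?case
        unfolding Let_def using bounds lim by (intro conjI exI[of _ "\<lambda>_. 0"]) auto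
    qed simp
  qed (use cs in simp)
qed

end
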